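(* Let $C>1$ be an integer. For all $j\in[t]$, let $G^{(j)}$ be a $d_j$-regular connected graph with $1<|V(G^{(j)})|\le C$. Let $G=\square_{j=1}^t G^{(j)}$, let $n:=|V(G)|$ and let $d:=\sum_{j=1}^t d_j$. Let $\epsilon>0$ be a small enough constant and let $p=\frac{1+\epsilon}{d}$. Let $L_1$ be the largest component in $G_p$. Then there exists a positive constant $c=c(\epsilon)$ such that whp the following holds. There exists a subgraph $H\subseteq L_1$ such that $|V(H)|\ge\frac{3\epsilon n}{2}$, and for every $S\subseteq V(H)$ with $|S|\le\frac{|V(H)|}{2}$, $$|N_H(S)|\ge\frac{c|S|}{d\ln d}.$$
   Context: Graphs are finite and simple; $[m]=\{1,\ldots,m\}$. The Cartesian product $\square_{j=1}^t G^{(j)}$ is the graph with vertex set $V(G^{(1)})\times\cdots\times V(G^{(t)})$ in which $u$ and $v$ are adjacent iff there is some $j\in[t]$ with $u_jv_j\in E(G^{(j)})$ and $u_m=v_m$ for all $m\ne j$. $G_p$ is the random subgraph of $G$ on $V(G)$ obtained by retaining every edge of $G$ independently with probability $p$. "Whp" means with probability tending to $1$ as $t\to\infty$, where $C,\epsilon$ are fixed and the base graphs may vary with $t$. "$\epsilon$ small enough" means $0<\epsilon\le\epsilon_0$ for some $\epsilon_0>0$ depending only on $C$; constants do not depend on $t$ or on the base graphs. The largest component is the one with most vertices (ties broken arbitrarily). For a graph $H$ and $S\subseteq V(H)$, $N_H(S)$ is the set of vertices in $V(H)\setminus S$ having a neighbour in $S$ in $H$. *)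

theory Defs
  imports "HOL-Probability.Probability"
begin

record 'a ugraph =
  verts :: "'a set"
  edges :: "'a set set"

definition simple_graph :: "'a ugraph \<Rightarrow> bool" where
  "simple_graph G \<longleftrightarrow> finite (verts G) \<and> (\<forall>e\<in>edges G. e \<subseteq> verts G \<and> card e = 2)"

definition regular_graph :: "nat \<Rightarrow> 'a ugraph \<Rightarrow> bool" where
  "regular_graph k G \<longleftrightarrow> (\<forall>v\<in>verts G. card {u. {v, u} \<in> edges G} = k)"

definition reachable :: "'a ugraph \<Rightarrow> 'a \<Rightarrow> 'a \<Rightarrow> bool" where
  "reachable G = (\<lambda>u v. {u, v} \<in> edges G)\<^sup>*\<^sup>*"

definition connected_graph :: "'a ugraph \<Rightarrow> bool" where
  "connected_graph G \<longleftrightarrow> verts G \<noteq> {} \<and> (\<forall>u\<in>verts G. \<forall>v\<in>verts G. reachable G u v)"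

definition is_subgraph :: "'a ugraph \<Rightarrow> 'a ugraph \<Rightarrow> bool" where
  "is_subgraph H G \<longleftrightarrow> simple_graph H \<and> verts H \<subseteq> verts G \<and> edges H \<subseteq> edges G"

definition induced_subgraph :: "'a ugraph \<Rightarrow> 'a set \<Rightarrow> 'a ugraph" where
  "induced_subgraph G W = \<lparr>verts = W, edges = {e \<in> edges G. e \<subseteq> W}\<rparr>"

definition graph_components :: "'a ugraph \<Rightarrow> 'a ugraph set" where
  "graph_components G = (\<lambda>v. induced_subgraph G {u \<in> verts G. reachable G v u}) ` verts G"

text \<open>Several components may satisfy this predicate if there are ties.\<close>

definition largest_component :: "'a ugraph \<Rightarrow> 'a ugraph \<Rightarrow> bool" where
  "largest_component G L \<longleftrightarrow> L \<in> graph_components G \<and>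
     (\<forall>K\<in>graph_components G. card (verts K) \<le> card (verts L))"

definition nbhd :: "'a ugraph \<Rightarrow> 'a set \<Rightarrow> 'a set" where
  "nbhd G S = {v \<in> verts G - S. \<exists>s\<in>S. {s, v} \<in> edges G}"

definition cartesian_product :: "'i set \<Rightarrow> ('i \<Rightarrow> 'a ugraph) \<Rightarrow> ('i \<Rightarrow> 'a) ugraph" where
  "cartesian_product I G =
     \<lparr>verts = (\<Pi>\<^sub>E j\<in>I. verts (G j)),
      edges = {{u, v} | u v. u \<in> (\<Pi>\<^sub>E j\<in>I. verts (G j)) \<and> v \<in> (\<Pi>\<^sub>E j\<in>I. verts (G j)) \<and>
                 (\<exists>j\<in>I. {u j, v j} \<in> edges (G j) \<and> (\<forall>m\<in>I - {j}. u m = v m))}\<rparr>"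

text \<open>The law of the random subgraph keeping each edge independently with probability \<open>p\<close>. It is
  meaningful for graphs with finitely many edges and \<open>0 \<le> p \<le> 1\<close>; \<^const>\<open>bernoulli_pmf\<close>
  truncates \<open>p\<close> to the unit interval otherwise.\<close>

definition percolation :: "'a ugraph \<Rightarrow> real \<Rightarrow> 'a ugraph pmf" where
  "percolation G p =
     map_pmf (\<lambda>\<omega>. \<lparr>verts = verts G, edges = {e \<in> edges G. \<omega> e}\<rparr>)
       (Pi_pmf (edges G) False (\<lambda>_. bernoulli_pmf p))"

end

theory Submission imports Defs "HOL-Real_Asymp.Real_Asymp"
begin

text \<open>
  The edges are exposed in five independent layers whose union is percolation with probability
  \<open>p\<close>: a main layer of density almost \<open>p\<close> and four sprinkled layers of density \<open>\<delta> / d\<close>.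
  An exploration in the main layer that inspects only a small multiple of \<open>d\<close> vertices is
  compared with a branching process by an exponential supermartingale; this gives clusters of order
  \<open>d\<close> with probability close to \<open>2\<epsilon>\<close>, and the submartingale bound gives \<open>2\<epsilon>\<close> as an upper bound.
  The product structure supplies linearly many disjoint boxes (fix some marker coordinates and
  change exactly one of them) in which clusters are independent. Hence one sprinkling step
  enlarges clusters to \<open>K d\<close> vertices for any constant \<open>K\<close>, and all but an \<open>exp (- \<Omega>(d))\<close> fraction
  of the vertices have \<open>\<Omega>(d)\<close> neighbours in the set \<open>W\<close> of vertices in such clusters. The
  Efron--Stein inequality gives concentration of \<open>card W\<close>, and also the edge-isoperimetry of the
  product.

  A set with vertex boundary \<open>X\<close> of size at most \<open>m = c n / (d ln d)\<close> cuts \<open>W - X\<close> along pieces of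
  clusters of the first two layers. There are \<open>exp (O(c n / d))\<close> choices of \<open>X\<close> and, since \<open>X\<close>
  meets only \<open>O(m ln d)\<close> open edges, \<open>exp (O((c + 1 / K) n / d))\<close> choices of the cut, whereas a
  given balanced cut is bridged by a path of three sprinkled edges except with probability
  \<open>exp (- \<Omega>(n / d))\<close>: isoperimetry yields \<open>\<Omega>(n)\<close> candidate middle edges, each of whose ends
  attaches to its side with constant probability. So all sets that split the largest component in a
  balanced way have boundary larger than \<open>m\<close>, and removing a largest small non-expanding set
  leaves the desired subgraph.
\<close>

section \<open>Finite product measures\<close>

text \<open>The factor \<open>ln d\<close> is the price of the union bound over the boundary
  \<open>X\<close>. A set of at most m vertices can be chosen in about exp (m ln (n / m)) ways; m =
  c n / (d ln d) turns this into exp (O(c n / d)), which a failure probability exp (- \<Omega>(n /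
  d)) can absorb. The obstacle is a possible circularity of constants: up to n / (K d) clusters give
  exp (O(n / (K d))) cuts, to be beaten by a sprinkling rate \<open>cs\<close> times n / d. It is
  avoided because \<open>cs\<close> comes only from isoperimetry and from the linear number of
  neighbours in \<open>W\<close>, neither of which deteriorates when \<open>K\<close> grows. So
  \<open>cs\<close> is fixed first, then \<open>K\<close>, while \<open>c\<close> is a fraction of
  \<open>cs\<close>. Each edge of a three-edge bridge has its own layer (2, 3 or 4), which makes the
  attachment of both ends and the middle edge independent. The upper bound close to 2\<epsilon>
  controls the part of the largest component outside \<open>W\<close>: it has at most 0.2 \<epsilon>
  n vertices, so a balanced split of the component is also a balanced split of \<open>W\<close>, and
  only splits of \<open>W\<close> have to be enumerated.\<close>

definition mean :: "'a pmf \<Rightarrow> ('a \<Rightarrow> real) \<Rightarrow> real" where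
  "mean M f = (\<Sum>x\<in>set_pmf M. pmf M x * f x)"

text \<open>Like \<open>mean\<close>, a finite sum over the support: linearity and exchange of sums
  then need no integrability. Finiteness of the support matters only for total mass 1,
  push-forwards, products and the link to \<open>measure_pmf\<close>.\<close>

definition prb :: "'a pmf \<Rightarrow> ('a \<Rightarrow> bool) \<Rightarrow> real" where
  "prb M P = mean M (\<lambda>x. of_bool (P x))"

lemma mean_expectation:
  assumes "finite (set_pmf M)"
  shows "mean M f = measure_pmf.expectation M f"
  unfolding mean_def using assms
  by (subst integral_measure_pmf_real[of "set_pmf M"]) (auto simp: mult.commute)

lemma mean_add: "mean M (\<lambda>x. f x + g x) = mean M f + mean M g"
  by (simp add: mean_def algebra_simps sum.distrib)

lemma mean_diff: "mean M (\<lambda>x. f x - g x) = mean M f - mean M g"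
  by (simp add: mean_def algebra_simps sum_subtractf)

lemma mean_cmult: "mean M (\<lambda>x. a * f x) = a * mean M f"
  unfolding mean_def sum_distrib_left by (intro sum.cong) (auto simp: mult_ac)

lemma mean_cmult2: "mean M (\<lambda>x. f x * a) = mean M f * a"
  unfolding mean_def sum_distrib_right by (intro sum.cong) (auto simp: mult_ac)

lemma mean_const: "finite (set_pmf M) \<Longrightarrow> mean M (\<lambda>x. a) = a"
  by (simp add: mean_def sum_distrib_right[symmetric] sum_pmf_eq_1)

lemma mean_mono: "(\<And>x. x \<in> set_pmf M \<Longrightarrow> f x \<le> g x) \<Longrightarrow> mean M f \<le> mean M g"
  unfolding mean_def by (intro sum_mono mult_left_mono) auto

lemma mean_cong: "(\<And>x. x \<in> set_pmf M \<Longrightarrow> f x = g x) \<Longrightarrow> mean M f = mean M g"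
  unfolding mean_def by (intro sum.cong) auto

lemma mean_nonneg: "(\<And>x. x \<in> set_pmf M \<Longrightarrow> 0 \<le> f x) \<Longrightarrow> 0 \<le> mean M f"
  unfolding mean_def by (intro sum_nonneg) auto

lemma mean_le: "finite (set_pmf M) \<Longrightarrow> (\<And>x. x \<in> set_pmf M \<Longrightarrow> f x \<le> a) \<Longrightarrow> mean M f \<le> a"
  using mean_mono[of M f "\<lambda>_. a"] by (simp add: mean_const)

lemma mean_swap: "mean M (\<lambda>x. mean N (f x)) = mean N (\<lambda>y. mean M (\<lambda>x. f x y))"
  unfolding mean_def
  by (simp add: sum_distrib_left sum.swap[of _ "set_pmf N"] mult_ac)

lemma mean_sum: "mean M (\<lambda>x. \<Sum>i\<in>I. f i x) = (\<Sum>i\<in>I. mean M (f i))"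
  unfolding mean_def sum_distrib_left by (rule sum.swap)

lemma mean_map:
  assumes "finite (set_pmf M)"
  shows "mean (map_pmf g M) f = mean M (\<lambda>x. f (g x))"
  using assms by (simp add: mean_expectation)

lemma mean_pair:
  assumes "finite (set_pmf M)" "finite (set_pmf N)"
  shows "mean (pair_pmf M N) f = mean M (\<lambda>x. mean N (\<lambda>y. f (x, y)))"
  unfolding mean_def set_pair_pmf
  by (simp add: sum_distrib_left sum.cartesian_product case_prod_beta pmf_pair mult.assoc
      del: mult.commute) (intro sum.cong, auto simp: pmf_pair)

lemma prb_prob:
  assumes "finite (set_pmf M)"
  shows "prb M P = measure_pmf.prob M {x. P x}"
proof -
  have "(\<lambda>x. of_bool (P x)) = indicat_real {x. P x}"
    by (auto simp: indicator_def)
  then show ?thesis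
    using assms by (simp add: prb_def mean_expectation)
qed

lemma prb_nonneg: "0 \<le> prb M P"
  unfolding prb_def by (rule mean_nonneg) auto

lemma prb_le_1: "finite (set_pmf M) \<Longrightarrow> prb M P \<le> 1"
  unfolding prb_def by (rule mean_le) auto

lemma prb_mono: "(\<And>x. x \<in> set_pmf M \<Longrightarrow> P x \<Longrightarrow> Q x) \<Longrightarrow> prb M P \<le> prb M Q"
  unfolding prb_def by (rule mean_mono) auto

lemma prb_cong: "(\<And>x. x \<in> set_pmf M \<Longrightarrow> P x \<longleftrightarrow> Q x) \<Longrightarrow> prb M P = prb M Q"
  unfolding prb_def by (rule mean_cong) auto

lemma prb_not: "finite (set_pmf M) \<Longrightarrow> prb M (\<lambda>x. \<not> P x) = 1 - prb M P"
proof -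
  assume "finite (set_pmf M)"
  then have "mean M (\<lambda>x. 1 - of_bool (P x)) = 1 - prb M P"
    unfolding prb_def by (simp add: mean_diff mean_const del: of_bool_not_iff)
  then show ?thesis by (simp add: prb_def of_bool_not_iff)
qed

lemma prb_union: "prb M (\<lambda>x. P x \<or> Q x) \<le> prb M P + prb M Q"
  unfolding prb_def mean_add[symmetric] by (rule mean_mono) auto

lemma prb_Union:
  assumes "finite I"
  shows "prb M (\<lambda>x. \<exists>i\<in>I. P i x) \<le> (\<Sum>i\<in>I. prb M (P i))"
  using assms
proof (induction I)
  case empty
  then show ?case by (simp add: prb_def mean_def)
next
  case (insert a I)
  have "prb M (\<lambda>x. \<exists>i\<in>insert a I. P i x) \<le> prb M (\<lambda>x. P a x \<or> (\<exists>i\<in>I. P i x))"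
    by (rule prb_mono) auto
  also have "\<dots> \<le> prb M (P a) + prb M (\<lambda>x. \<exists>i\<in>I. P i x)"
    by (rule prb_union)
  finally show ?case using insert by simp
qed

lemma prb_markov:
  assumes "\<And>x. x \<in> set_pmf M \<Longrightarrow> 0 \<le> f x" "0 < a"
  shows "prb M (\<lambda>x. a \<le> f x) \<le> mean M f / a"
proof -
  have "a * prb M (\<lambda>x. a \<le> f x) \<le> mean M f"
    unfolding prb_def mean_cmult[symmetric] using assms by (intro mean_mono) auto
  then show ?thesis using assms(2) by (simp add: field_simps)
qed

section \<open>Variance and the Efron--Stein inequality\<close>

definition vari :: "'a pmf \<Rightarrow> ('a \<Rightarrow> real) \<Rightarrow> real" where
  "vari M f = mean M (\<lambda>x. (f x)\<^sup>2) - (mean M f)\<^sup>2"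

lemma vari_alt: "finite (set_pmf M) \<Longrightarrow> vari M f = mean M (\<lambda>x. (f x - mean M f)\<^sup>2)"
proof -
  assume fin: "finite (set_pmf M)"
  let ?m = "mean M f"
  have "mean M (\<lambda>x. (f x - ?m)\<^sup>2) = mean M (\<lambda>x. (f x)\<^sup>2 - 2 * ?m * f x + ?m\<^sup>2)"
    by (intro mean_cong) (auto simp: power2_eq_square algebra_simps)
  also have "\<dots> = mean M (\<lambda>x. (f x)\<^sup>2) - 2 * ?m * ?m + ?m\<^sup>2"
    by (simp only: mean_add mean_diff mean_cmult mean_const[OF fin])
  finally show ?thesis by (simp add: power2_eq_square vari_def)
qed

lemma jensen_square: "finite (set_pmf M) \<Longrightarrow> (mean M f)\<^sup>2 \<le> mean M (\<lambda>x. (f x)\<^sup>2)"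
  using vari_alt[of M f] mean_nonneg[of M "\<lambda>x. (f x - mean M f)\<^sup>2"] by (simp add: vari_def)

lemma prb_chebyshev:
  assumes "finite (set_pmf M)" "0 < a"
  shows "prb M (\<lambda>x. a \<le> \<bar>f x - mean M f\<bar>) \<le> vari M f / a\<^sup>2"
proof -
  have "prb M (\<lambda>x. a \<le> \<bar>f x - mean M f\<bar>) = prb M (\<lambda>x. a\<^sup>2 \<le> (f x - mean M f)\<^sup>2)"
    using assms(2) by (intro prb_cong) (metis abs_le_square_iff abs_of_pos)
  also have "\<dots> \<le> mean M (\<lambda>x. (f x - mean M f)\<^sup>2) / a\<^sup>2"
    using assms(2) by (intro prb_markov) auto
  finally show ?thesis using vari_alt[OF assms(1)] by simp
qed

text \<open>Jensen's inequality for the square, applied to the average over \<open>N\<close> of the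
  centred functions \<open>g y x - ?b x\<close>. It is what lets the induction for
  \<open>efron_stein\<close> close.\<close>

lemma vari_mean_le:
  assumes M: "finite (set_pmf M)" and N: "finite (set_pmf N)"
  shows "vari M (\<lambda>y. mean N (g y)) \<le> mean N (\<lambda>x. vari M (\<lambda>y. g y x))"
proof -
  let ?b = "\<lambda>x. mean M (\<lambda>y. g y x)"
  have "vari M (\<lambda>y. mean N (g y)) = mean M (\<lambda>y. (mean N (g y) - mean N ?b)\<^sup>2)"
    unfolding vari_alt[OF M] by (subst mean_swap) simp
  also have "\<dots> = mean M (\<lambda>y. (mean N (\<lambda>x. g y x - ?b x))\<^sup>2)"
    by (simp add: mean_diff)
  also have "\<dots> \<le> mean M (\<lambda>y. mean N (\<lambda>x. (g y x - ?b x)\<^sup>2))"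
    by (intro mean_mono jensen_square N)
  also have "\<dots> = mean N (\<lambda>x. vari M (\<lambda>y. g y x))"
    unfolding vari_alt[OF M] by (rule mean_swap)
  finally show ?thesis .
qed

lemma finite_set_Pi_pmf:
  assumes "finite I" "\<And>i. i \<in> I \<Longrightarrow> finite (set_pmf (P i))"
  shows "finite (set_pmf (Pi_pmf I d P))"
  using assms by (auto simp: set_Pi_pmf)

text \<open>Induction on the coordinates: the law of total variance splits off coordinate
  \<open>a\<close>. The variance of the conditional mean is bounded by \<open>vari_mean_le\<close>,
  the mean of the conditional variance by the induction hypothesis.\<close>

lemma efron_stein:
  assumes "finite I" "\<And>i. i \<in> I \<Longrightarrow> finite (set_pmf (P i))"
  shows "vari (Pi_pmf I d P) f \<le>
    (\<Sum>i\<in>I. mean (Pi_pmf I d P) (\<lambda>x. vari (P i) (\<lambda>y. f (x(i := y)))))"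
  using assms
proof (induction I arbitrary: f rule: finite_induct)
  case empty
  then show ?case by (simp add: vari_def mean_def)
next
  case (insert a I)
  let ?N = "Pi_pmf I d P"
  have finN: "finite (set_pmf ?N)" and fina: "finite (set_pmf (P a))"
    using insert by (auto intro: finite_set_Pi_pmf)
  have E: "mean (Pi_pmf (insert a I) d P) h = mean (P a) (\<lambda>y. mean ?N (\<lambda>x. h (x(a := y))))" for h
    by (subst Pi_pmf_insert[OF insert(1,2)])
      (simp add: mean_map mean_pair finN fina case_prod_beta)
  let ?g = "\<lambda>y x. f (x(a := y))"
  have "vari (Pi_pmf (insert a I) d P) f =
      mean (P a) (\<lambda>y. vari ?N (?g y)) + vari (P a) (\<lambda>y. mean ?N (?g y))"
    unfolding vari_def E mean_diff by simp
  also have "vari (P a) (\<lambda>y. mean ?N (?g y)) \<le> mean ?N (\<lambda>x. vari (P a) (\<lambda>y. ?g y x))"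
    by (rule vari_mean_le[OF fina finN])
  also have "mean ?N (\<lambda>x. vari (P a) (\<lambda>y. ?g y x)) =
      mean (Pi_pmf (insert a I) d P) (\<lambda>x. vari (P a) (\<lambda>y. f (x(a := y))))"
    unfolding E by (simp add: mean_const[OF fina])
  also have "mean (P a) (\<lambda>y. vari ?N (?g y)) \<le>
     mean (P a) (\<lambda>y. \<Sum>i\<in>I. mean ?N (\<lambda>x. vari (P i) (\<lambda>z. ?g y (x(i := z)))))"
    using insert by (intro mean_mono insert.IH) auto
  also have "\<dots> = (\<Sum>i\<in>I. mean (P a) (\<lambda>y. mean ?N (\<lambda>x. vari (P i) (\<lambda>z. ?g y (x(i := z))))))"
    by (rule mean_sum)
  also have "\<dots> = (\<Sum>i\<in>I. mean (Pi_pmf (insert a I) d P) (\<lambda>x. vari (P i) (\<lambda>z. f (x(i := z)))))"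
  proof (rule sum.cong)
    fix i assume "i \<in> I"
    then have "i \<noteq> a" using insert by auto
    then show "mean (P a) (\<lambda>y. mean ?N (\<lambda>x. vari (P i) (\<lambda>z. ?g y (x(i := z))))) =
      mean (Pi_pmf (insert a I) d P) (\<lambda>x. vari (P i) (\<lambda>z. f (x(i := z))))"
      unfolding E by (simp add: fun_upd_twist)
  qed simp
  finally show ?case unfolding sum.insert[OF insert(1,2)] by linarith
qed

section \<open>Independence of functions of disjoint blocks of coordinates\<close>

definition dep_on :: "'i set \<Rightarrow> (('i \<Rightarrow> 'b) \<Rightarrow> 'c) \<Rightarrow> bool" where
  "dep_on B f \<longleftrightarrow> (\<forall>x y. (\<forall>i\<in>B. x i = y i) \<longrightarrow> f x = f y)"

lemma dep_onI: "(\<And>x y. (\<And>i. i \<in> B \<Longrightarrow> x i = y i) \<Longrightarrow> f x = f y) \<Longrightarrow> dep_on B f"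
  unfolding dep_on_def by blast

lemma dep_onD: "dep_on B f \<Longrightarrow> (\<And>i. i \<in> B \<Longrightarrow> x i = y i) \<Longrightarrow> f x = f y"
  unfolding dep_on_def by blast

lemma dep_on_comp: "dep_on B f \<Longrightarrow> dep_on B (\<lambda>x. g (f x))"
  unfolding dep_on_def by metis

text \<open>The substitute for conditioning: in \<open>override_on x y B\<close> the sample
  \<open>x\<close> carries what is revealed outside \<open>B\<close>, and \<open>y\<close> is fresh
  randomness on \<open>B\<close>. Later arguments that expose one layer after another use this with
  a suitable \<open>B\<close>.\<close>

lemma Pi_pmf_resample:
  fixes P :: "'i \<Rightarrow> 'b pmf"
  assumes "finite I"
  shows "map_pmf (\<lambda>(x, y). override_on x y B) (pair_pmf (Pi_pmf I d P) (Pi_pmf I d P)) = Pi_pmf I d P"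
proof -
  let ?A1 = "I - B" and ?A2 = "I \<inter> B"
  let ?M = "Pi_pmf I d P"
  let ?r = "\<lambda>A f x. if x \<in> A then f x else d"
  have "pair_pmf (Pi_pmf ?A1 d P) (Pi_pmf ?A2 d P) = pair_pmf (map_pmf (?r ?A1) ?M) (map_pmf (?r ?A2) ?M)"
    by (intro arg_cong2[where f = pair_pmf] Pi_pmf_subset assms) auto
  then have pair: "pair_pmf (Pi_pmf ?A1 d P) (Pi_pmf ?A2 d P) = map_pmf (\<lambda>(x, y). (?r ?A1 x, ?r ?A2 y)) (pair_pmf ?M ?M)"
    by (simp only: map_pair)
  have "Pi_pmf (?A1 \<union> ?A2) d P = map_pmf (\<lambda>(f,g) x. if x \<in> ?A1 then f x else g x)
      (pair_pmf (Pi_pmf ?A1 d P) (Pi_pmf ?A2 d P))"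
    using assms by (intro Pi_pmf_union) auto
  also have "\<dots> = map_pmf (\<lambda>(x, y) i. if i \<in> ?A1 then x i else if i \<in> ?A2 then y i else d) (pair_pmf ?M ?M)"
    unfolding pair pmf.map_comp by (intro map_pmf_cong refl) (auto simp: fun_eq_iff)
  \<comment> \<open>\<open>B\<close> may contain indices outside \<open>I\<close>; there both
    samples almost surely equal the default \<open>d\<close>, so overriding is harmless.\<close>
  also have "\<dots> = map_pmf (\<lambda>(x, y). override_on x y B) (pair_pmf ?M ?M)"
  proof (rule map_pmf_cong[OF refl], clarify, rule ext)
    fix x y i assume "(x, y) \<in> set_pmf (pair_pmf ?M ?M)"
    then have "\<forall>i. i \<notin> I \<longrightarrow> x i = d \<and> y i = d"
      using set_Pi_pmf_subset[OF assms, of d P] by auto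
    then show "(if i \<in> ?A1 then x i else if i \<in> ?A2 then y i else d) = override_on x y B i"
      by (auto simp: override_on_def)
  qed
  finally have "Pi_pmf (?A1 \<union> ?A2) d P = map_pmf (\<lambda>(x, y). override_on x y B) (pair_pmf ?M ?M)" .
  moreover have "?A1 \<union> ?A2 = I" by auto
  ultimately show ?thesis by simp
qed

locale fin_product =
  fixes I :: "'i set" and d :: 'b and P :: "'i \<Rightarrow> 'b pmf"
  assumes finI: "finite I" and finP: "\<And>i. i \<in> I \<Longrightarrow> finite (set_pmf (P i))"
begin

abbreviation "M \<equiv> Pi_pmf I d P"

lemma finM: "finite (set_pmf M)"
  by (rule finite_set_Pi_pmf[OF finI finP])

lemma mean_resample: "mean M f = mean M (\<lambda>x. mean M (\<lambda>y. f (override_on x y B)))"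
  by (subst Pi_pmf_resample[OF finI, of B, symmetric])
    (simp add: mean_map mean_pair finM case_prod_beta)

lemma prb_resample: "prb M Q = mean M (\<lambda>x. prb M (\<lambda>y. Q (override_on x y B)))"
  unfolding prb_def by (rule mean_resample)

lemma mean_indep:
  assumes "dep_on B f" "dep_on C g" "B \<inter> C = {}"
  shows "mean M (\<lambda>x. f x * g x) = mean M f * mean M g"
proof -
  have "mean M (\<lambda>x. f x * g x) = mean M (\<lambda>x. mean M (\<lambda>y. f (override_on x y B) * g (override_on x y B)))"
    by (rule mean_resample)
  also have "\<dots> = mean M (\<lambda>x. mean M (\<lambda>y. f y * g x))"
  proof -
    have "f (override_on x y B) = f y" "g (override_on x y B) = g x" for x y
      using assms by (auto intro!: dep_onD[OF assms(1)] dep_onD[OF assms(2)] simp: override_on_def)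
    then show ?thesis by simp
  qed
  also have "\<dots> = mean M f * mean M g"
    by (simp add: mean_cmult mean_cmult2)
  finally show ?thesis .
qed

lemma mean_prod_blocks:
  fixes f :: "'j \<Rightarrow> ('i \<Rightarrow> 'b) \<Rightarrow> real"
  assumes "finite J" "\<And>j. j \<in> J \<Longrightarrow> dep_on (B j) (f j)"
    "\<And>j j'. j \<in> J \<Longrightarrow> j' \<in> J \<Longrightarrow> j \<noteq> j' \<Longrightarrow> B j \<inter> B j' = {}"
  shows "mean M (\<lambda>x. \<Prod>j\<in>J. f j x) = (\<Prod>j\<in>J. mean M (f j))"
  using assms
proof (induction J)
  case empty
  then show ?case by (simp add: mean_const finM)
next
  case (insert a J)
  have "dep_on (\<Union>j\<in>J. B j) (\<lambda>x. \<Prod>j\<in>J. f j x)"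
  proof (rule dep_onI)
    fix x y :: "'i \<Rightarrow> 'b" assume "\<And>i. i \<in> (\<Union>j\<in>J. B j) \<Longrightarrow> x i = y i"
    then have "f j x = f j y" if "j \<in> J" for j
      using insert.prems(1)[of j] that by (auto intro: dep_onD)
    then show "(\<Prod>j\<in>J. f j x) = (\<Prod>j\<in>J. f j y)" by simp
  qed
  moreover have "dep_on (B a) (f a)" "B a \<inter> (\<Union>j\<in>J. B j) = {}"
    using insert by fast+
  ultimately have "mean M (\<lambda>x. f a x * (\<Prod>j\<in>J. f j x)) = mean M (f a) * mean M (\<lambda>x. \<Prod>j\<in>J. f j x)"
    by (intro mean_indep)
  moreover have "mean M (\<lambda>x. \<Prod>j\<in>J. f j x) = (\<Prod>j\<in>J. mean M (f j))"
    using insert by (intro insert.IH) auto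
  ultimately show ?case using insert(1,2) by simp
qed

text \<open>Disjoint blocks factorise the Laplace transform, and each factor is 1 - (1 - exp (- w))
  P(Ev). Weights in [0, 1] instead of plain counts are needed in \<open>prb_three_path\<close>,
  where a weight is a rescaled number of neighbours.\<close>

lemma exp_indep_le:
  assumes J: "finite J" and dep: "\<And>j. j \<in> J \<Longrightarrow> dep_on (B j) (Ev j)"
    and disj: "\<And>j j'. j \<in> J \<Longrightarrow> j' \<in> J \<Longrightarrow> j \<noteq> j' \<Longrightarrow> B j \<inter> B j' = {}"
    and q: "\<And>j. j \<in> J \<Longrightarrow> q \<le> prb M (Ev j)"
    and w: "\<And>j. j \<in> J \<Longrightarrow> 0 \<le> w j \<and> w j \<le> 1"
  shows "mean M (\<lambda>x. exp (- (\<Sum>j\<in>J. w j * of_bool (Ev j x)))) \<le> exp (- (q / 2) * (\<Sum>j\<in>J. w j))"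
proof -
  have "mean M (\<lambda>x. exp (- (\<Sum>j\<in>J. w j * of_bool (Ev j x)))) =
      mean M (\<lambda>x. \<Prod>j\<in>J. exp (- (w j * of_bool (Ev j x))))"
    by (simp only: exp_sum[OF J] sum_negf[symmetric])
  also have "\<dots> = (\<Prod>j\<in>J. mean M (\<lambda>x. exp (- (w j * of_bool (Ev j x)))))"
    by (intro mean_prod_blocks[where B = B] J dep_on_comp[OF dep] disj)
  also have "\<dots> \<le> (\<Prod>j\<in>J. exp (- (q / 2) * w j))"
  proof (intro prod_mono conjI)
    fix j assume j: "j \<in> J"
    show "0 \<le> mean M (\<lambda>x. exp (- (w j * of_bool (Ev j x))))"
      by (rule mean_nonneg) simp
    \<comment> \<open>The source of the 1/2 in the exponent: exp (- w) \<le> 1 / (1 + w) \<le> 1 - w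
      / 2, the last step using w \<le> 1.\<close>
    have e: "exp (- w j) \<le> 1 - w j / 2"
    proof -
      let ?w = "w j"
      have "0 \<le> ?w" "?w \<le> 1" using w[OF j] by auto
      have "1 + ?w \<le> exp ?w" by (rule exp_ge_add_one_self)
      then have "exp (- ?w) \<le> 1 / (1 + ?w)"
        using \<open>0 \<le> ?w\<close> by (simp add: exp_minus field_simps)
      also have "\<dots> \<le> 1 - ?w / 2"
        using \<open>0 \<le> ?w\<close> \<open>?w \<le> 1\<close> mult_left_mono[of ?w 1 ?w] by (simp add: field_simps)
      finally show ?thesis .
    qed
    have "mean M (\<lambda>x. exp (- (w j * of_bool (Ev j x)))) = mean M (\<lambda>x. 1 - (1 - exp (- w j)) * of_bool (Ev j x))"
      by (intro mean_cong) auto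
    also have "\<dots> = 1 - (1 - exp (- w j)) * prb M (Ev j)"
      by (simp add: mean_diff mean_cmult mean_const finM prb_def)
    also have "\<dots> \<le> 1 - (w j / 2) * prb M (Ev j)"
      using e by (intro diff_left_mono mult_right_mono prb_nonneg) auto
    also have "\<dots> \<le> 1 - (w j / 2) * q"
      using w[OF j] q[OF j] by (intro diff_left_mono mult_left_mono) auto
    also have "\<dots> \<le> exp (- (q / 2) * w j)"
      using exp_ge_add_one_self[of "- (q / 2) * w j"] by (simp add: mult.commute)
    finally show "mean M (\<lambda>x. exp (- (w j * of_bool (Ev j x)))) \<le> exp (- (q / 2) * w j)" .
  qed
  also have "\<dots> = exp (- (q / 2) * (\<Sum>j\<in>J. w j))"
    using J by (simp add: exp_sum sum_distrib_left)
  finally show ?thesis .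
qed

text \<open>Exponential Markov inequality with parameter 1. The case z = 0 bounds the probability
  that none of the events occurs, the form used for sprinkled edges.\<close>

lemma count_indep_le:
  assumes J: "finite J" and dep: "\<And>j. j \<in> J \<Longrightarrow> dep_on (B j) (Ev j)"
    and disj: "\<And>j j'. j \<in> J \<Longrightarrow> j' \<in> J \<Longrightarrow> j \<noteq> j' \<Longrightarrow> B j \<inter> B j' = {}"
    and q: "\<And>j. j \<in> J \<Longrightarrow> q \<le> prb M (Ev j)"
  shows "prb M (\<lambda>x. real (card {j\<in>J. Ev j x}) \<le> z) \<le> exp (z - q / 2 * real (card J))"
proof -
  have c: "(\<Sum>j\<in>J. 1 * of_bool (Ev j x)) = real (card {j\<in>J. Ev j x})" for x
    using J by (simp add: of_bool_def sum.If_cases Int_def)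
  have "prb M (\<lambda>x. real (card {j\<in>J. Ev j x}) \<le> z) \<le> mean M (\<lambda>x. exp z * exp (- (\<Sum>j\<in>J. 1 * of_bool (Ev j x))))"
    unfolding prb_def c by (intro mean_mono) (auto simp flip: exp_add)
  also have "\<dots> \<le> exp z * exp (- (q / 2) * (\<Sum>j\<in>J. 1))"
    unfolding mean_cmult
    by (intro mult_left_mono exp_indep_le[where B = B] J dep disj q) auto
  also have "\<dots> = exp (z - q / 2 * real (card J))"
    by (simp flip: exp_add)
  finally show ?thesis .
qed

text \<open>Resampling a single coordinate preserves the law; \<open>isoperimetry\<close> uses this
  to turn fibre averages into global averages.\<close>

lemma mean_coord:
  assumes "j \<in> I"
  shows "mean M (\<lambda>x. mean (P j) (\<lambda>a. h (x(j := a)))) = mean M h"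
proof -
  have "mean M h = mean M (\<lambda>x. mean M (\<lambda>y. h (override_on x y {j})))"
    by (rule mean_resample)
  also have "\<dots> = mean M (\<lambda>x. mean (map_pmf (\<lambda>y. y j) M) (\<lambda>a. h (x(j := a))))"
    by (simp add: mean_map[OF finM] override_on_insert)
  also have "map_pmf (\<lambda>y. y j) M = P j"
    using assms finI by (subst Pi_pmf_component) auto
  finally show ?thesis by (simp add: fun_upd_def)
qed

text \<open>Independence forces a product formula involving only \<open>J\<close>, \<open>F\<close>
  and \<open>p\<close>, not the underlying space. Hence two different spaces produce the same random
  edge set, as needed in \<open>percolation_eq_layers\<close>.\<close>

lemma prb_random_subset:
  fixes Ev :: "'j \<Rightarrow> ('i \<Rightarrow> 'b) \<Rightarrow> bool"
  assumes J: "finite J" and dep: "\<And>j. j \<in> J \<Longrightarrow> dep_on (B j) (Ev j)"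
    and disj: "\<And>j j'. j \<in> J \<Longrightarrow> j' \<in> J \<Longrightarrow> j \<noteq> j' \<Longrightarrow> B j \<inter> B j' = {}"
    and p: "\<And>j. j \<in> J \<Longrightarrow> prb M (Ev j) = p"
  shows "prb M (\<lambda>x. {j\<in>J. Ev j x} = F) = (if F \<subseteq> J then \<Prod>j\<in>J. if j \<in> F then p else 1 - p else 0)"
proof (cases "F \<subseteq> J")
  case True
  have "prb M (\<lambda>x. {j\<in>J. Ev j x} = F) = mean M (\<lambda>x. \<Prod>j\<in>J. of_bool (Ev j x = (j \<in> F)))"
    unfolding prb_def using J True by (intro mean_cong) auto
  also have "\<dots> = (\<Prod>j\<in>J. mean M (\<lambda>x. of_bool (Ev j x = (j \<in> F))))"
    by (intro mean_prod_blocks[where B = B] J dep_on_comp[OF dep] disj)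
  also have "\<dots> = (\<Prod>j\<in>J. if j \<in> F then p else 1 - p)"
    by (intro prod.cong refl) (simp add: p prb_not[OF finM] flip: prb_def)
  finally show ?thesis using True by simp
next
  case False
  then have "prb M (\<lambda>x. {j\<in>J. Ev j x} = F) = prb M (\<lambda>_. False)"
    by (intro prb_cong) blast
  then show ?thesis using False by (simp add: prb_def mean_def)
qed

lemma pmf_map_prb: "pmf (map_pmf f M) y = prb M (\<lambda>x. f x = y)"
  by (simp add: pmf_map prb_prob[OF finM] vimage_def)

end

lemma mean_of_set:
  "finite A \<Longrightarrow> A \<noteq> {} \<Longrightarrow> mean (pmf_of_set A) f = (\<Sum>x\<in>A. f x) / real (card A)"
  by (subst mean_expectation) (auto simp: integral_pmf_of_set)

section \<open>Exploring clusters\<close>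

text \<open>Paths start in the active set \<open>A\<close> and step only into the unexplored set \<open>U\<close>.\<close>

definition expl :: "'v set set \<Rightarrow> 'v set \<Rightarrow> 'v set \<Rightarrow> 'v set" where
  "expl F A U = {y. \<exists>a\<in>A. (\<lambda>u v. {u, v} \<in> F \<and> v \<in> U)\<^sup>*\<^sup>* a y}"

lemma expl_base: "A \<subseteq> expl F A U"
  unfolding expl_def by blast

lemma expl_step: "y \<in> expl F A U \<Longrightarrow> {y, v} \<in> F \<Longrightarrow> v \<in> U \<Longrightarrow> v \<in> expl F A U"
  unfolding expl_def by (auto intro: rtranclp.rtrancl_into_rtrancl)

lemma expl_least:
  assumes "A \<subseteq> S" "\<And>y v. y \<in> S \<Longrightarrow> {y, v} \<in> F \<Longrightarrow> v \<in> U \<Longrightarrow> v \<in> S"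
  shows "expl F A U \<subseteq> S"
proof
  fix y assume "y \<in> expl F A U"
  then obtain a where "a \<in> A" "(\<lambda>u v. {u, v} \<in> F \<and> v \<in> U)\<^sup>*\<^sup>* a y"
    unfolding expl_def by blast
  from this(2) show "y \<in> S"
    by induction (use assms \<open>a \<in> A\<close> in auto)
qed

lemma expl_sub: "expl F A U \<subseteq> A \<union> U"
  by (rule expl_least) auto

lemma finite_expl: "finite A \<Longrightarrow> finite U \<Longrightarrow> finite (expl F A U)"
  by (rule finite_subset[OF expl_sub]) simp

lemma expl_empty [simp]: "expl F {} U = {}"
  unfolding expl_def by simp

lemma expl_mono: "F \<subseteq> F' \<Longrightarrow> A \<subseteq> A' \<Longrightarrow> U \<subseteq> U' \<Longrightarrow> expl F A U \<subseteq> expl F' A' U'"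
  by (rule expl_least) (use expl_base[of A' F' U'] in \<open>auto intro: expl_step\<close>)

lemma expl_cong:
  assumes "\<And>y v. y \<in> A \<union> U \<Longrightarrow> v \<in> U \<Longrightarrow> {y, v} \<in> F \<longleftrightarrow> {y, v} \<in> F'"
  shows "expl F A U = expl F' A U"
proof
  show "expl F A U \<subseteq> expl F' A U"
  proof (rule expl_least[OF expl_base])
    fix y v assume "y \<in> expl F' A U" "{y, v} \<in> F" "v \<in> U"
    then show "v \<in> expl F' A U"
      using assms[of y v] expl_sub[of F' A U] by (auto intro: expl_step[of y])
  qed
  show "expl F' A U \<subseteq> expl F A U"
  proof (rule expl_least[OF expl_base])
    fix y v assume "y \<in> expl F A U" "{y, v} \<in> F'" "v \<in> U"
    then show "v \<in> expl F A U"
      using assms[of y v] expl_sub[of F A U] by (auto intro: expl_step[of y])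
  qed
qed

text \<open>Processing \<open>a\<close> moves its unexplored neighbours \<open>N\<close> to the
  active set. Since \<open>a\<close> lies outside \<open>U\<close> it is never entered again, so no
  other edge at \<open>a\<close> matters afterwards.\<close>

lemma expl_process:
  assumes "a \<in> A" "A \<inter> U = {}" "N = {u \<in> U. {a, u} \<in> F}"
  shows "expl F A U = insert a (expl F (A - {a} \<union> N) (U - N))"
proof
  let ?R = "expl F (A - {a} \<union> N) (U - N)"
  show "expl F A U \<subseteq> insert a ?R"
  proof (rule expl_least)
    show "A \<subseteq> insert a ?R" using expl_base[of "A - {a} \<union> N" F "U - N"] by blast
    fix y v assume y: "y \<in> insert a ?R" "{y, v} \<in> F" "v \<in> U"
    show "v \<in> insert a ?R"
    proof (cases "v \<in> N")
      case True
      then show ?thesis using expl_base[of "A - {a} \<union> N" F "U - N"] by blast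
    next
      case False
      then have "y \<noteq> a" using y assms(3) by auto
      then show ?thesis using y False expl_step[of y F "A - {a} \<union> N" "U - N" v] by auto
    qed
  qed
  have "a \<in> expl F A U" using assms(1) expl_base[of A F U] by auto
  moreover have "?R \<subseteq> expl F A U"
  proof (rule expl_least)
    show "A - {a} \<union> N \<subseteq> expl F A U"
      using expl_base[of A F U] expl_step[OF \<open>a \<in> expl F A U\<close>] assms(3) by auto
  qed (auto intro: expl_step)
  ultimately show "insert a ?R \<subseteq> expl F A U" by blast
qed

lemma card_expl_process:
  assumes "a \<in> A" "A \<inter> U = {}" "N = {u \<in> U. {a, u} \<in> F}" "finite A" "finite U"
  shows "card (expl F A U) = Suc (card (expl F (A - {a} \<union> N) (U - N)))"
proof -
  have "a \<notin> expl F (A - {a} \<union> N) (U - N)"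
    using expl_sub[of F "A - {a} \<union> N" "U - N"] assms by auto
  moreover have "finite (expl F (A - {a} \<union> N) (U - N))"
    using assms by (intro finite_expl) auto
  ultimately show ?thesis unfolding expl_process[OF assms(1-3)] by simp
qed

text \<open>A return to the starting point adds nothing. The right-hand side has disjoint active and
  unexplored sets, the form in which the exploration bounds are stated.\<close>

lemma expl_remove: "expl F {x} Y = expl F {x} (Y - {x})"
proof
  show "expl F {x} Y \<subseteq> expl F {x} (Y - {x})"
  proof (rule expl_least[OF expl_base])
    fix y v assume "y \<in> expl F {x} (Y - {x})" "{y, v} \<in> F" "v \<in> Y"
    then show "v \<in> expl F {x} (Y - {x})"
      using expl_base[of "{x}" F "Y - {x}"] by (cases "v = x") (auto intro: expl_step)
  qed
qed (intro expl_mono, auto)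

text \<open>Paths can be reversed because edges are unordered; \<open>v \<in> V\<close> is needed
  since the reversed path has to step into \<open>v\<close>.\<close>

lemma expl_sym:
  assumes "v \<in> V" "y \<in> expl F {v} V"
  shows "v \<in> expl F {y} V"
proof -
  have "expl F {v} V \<subseteq> {y \<in> V. v \<in> expl F {y} V}"
  proof (rule expl_least)
    show "{v} \<subseteq> {y \<in> V. v \<in> expl F {y} V}" using assms expl_base[of "{v}" F V] by auto
    fix y w assume y: "y \<in> {y \<in> V. v \<in> expl F {y} V}" and w: "{y, w} \<in> F" "w \<in> V"
    have "{w, y} \<in> F" using w by (simp add: insert_commute)
    then have "y \<in> expl F {w} V" using y expl_base[of "{w}" F V] by (auto intro: expl_step[of w])
    then have "expl F {y} V \<subseteq> expl F {w} V"
      by (intro expl_least) (auto intro: expl_step)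
    then show "w \<in> {y \<in> V. v \<in> expl F {y} V}" using y w by auto
  qed
  then show ?thesis using assms by auto
qed

lemma expl_trans: "y \<in> expl F {v} V \<Longrightarrow> expl F {y} V \<subseteq> expl F {v} V"
  by (intro expl_least) (auto intro: expl_step)

lemma expl_eq: "v \<in> V \<Longrightarrow> y \<in> expl F {v} V \<Longrightarrow> expl F {y} V = expl F {v} V"
  using expl_trans[of y F v V] expl_trans[of v F y V] expl_sym[of v V y F] by auto

lemma mean_bernoulli: "0 \<le> p \<Longrightarrow> p \<le> 1 \<Longrightarrow> mean (bernoulli_pmf p) g = p * g True + (1 - p) * g False"
  by (subst mean_expectation) auto

section \<open>Percolation built from independent layers\<close>

locale layered =
  fixes V :: "'v set" and E :: "'v set set" and \<Lambda> :: "nat set" and pr :: "nat \<Rightarrow> real"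
  assumes finV: "finite V" and E: "\<And>e. e \<in> E \<Longrightarrow> e \<subseteq> V \<and> card e = 2"
    and fin\<Lambda>: "finite \<Lambda>" and pr: "\<And>l. 0 \<le> pr l \<and> pr l \<le> 1"
begin

lemma finE: "finite E"
  using finite_subset[of E "Pow V"] E finV by auto

sublocale fin_product "E \<times> \<Lambda>" False "\<lambda>(e, l). bernoulli_pmf (pr l)"
  by unfold_locales (use finE fin\<Lambda> in auto)

definition opn :: "nat set \<Rightarrow> ('v set \<times> nat \<Rightarrow> bool) \<Rightarrow> 'v set set" where
  "opn L \<omega> = {e \<in> E. \<exists>l\<in>L. \<omega> (e, l)}"

definition pL :: "nat set \<Rightarrow> real" where
  "pL L = 1 - (\<Prod>l\<in>L. 1 - pr l)"

lemma opn_sub: "opn L \<omega> \<subseteq> E" by (auto simp: opn_def)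

lemma opn_mono: "L \<subseteq> L' \<Longrightarrow> opn L \<omega> \<subseteq> opn L' \<omega>" by (auto simp: opn_def)

lemma dep_opn: "dep_on ({e} \<times> L) (\<lambda>\<omega>. e \<in> opn L \<omega>)"
  by (rule dep_onI) (auto simp: opn_def)

lemma prb_coord:
  assumes "e \<in> E" "l \<in> \<Lambda>"
  shows "prb M (\<lambda>\<omega>. \<omega> (e, l)) = pr l"
proof -
  have "prb M (\<lambda>\<omega>. \<omega> (e, l)) = mean (map_pmf (\<lambda>\<omega>. \<omega> (e, l)) M) of_bool"
    by (simp add: mean_map[OF finM] prb_def)
  also have "map_pmf (\<lambda>\<omega>. \<omega> (e, l)) M = bernoulli_pmf (pr l)"
    using assms finI by (subst Pi_pmf_component) auto
  finally show ?thesis using pr by (simp add: mean_bernoulli)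
qed

lemma prb_opn:
  assumes "e \<in> E" "L \<subseteq> \<Lambda>"
  shows "prb M (\<lambda>\<omega>. e \<in> opn L \<omega>) = pL L"
proof -
  have finL: "finite L" using assms fin\<Lambda> finite_subset by auto
  have "prb M (\<lambda>\<omega>. \<not> e \<in> opn L \<omega>) = mean M (\<lambda>\<omega>. \<Prod>l\<in>L. of_bool (\<not> \<omega> (e, l)))"
    unfolding prb_def using assms(1) finL
    by (intro mean_cong) (auto simp: opn_def)
  also have "\<dots> = (\<Prod>l\<in>L. mean M (\<lambda>\<omega>. of_bool (\<not> \<omega> (e, l))))"
    by (intro mean_prod_blocks[where B = "\<lambda>l. {(e, l)}"] finL) (auto intro!: dep_onI)
  also have "\<dots> = (\<Prod>l\<in>L. 1 - pr l)"
    using assms by (intro prod.cong refl)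
      (auto simp: prb_not[OF finM] prb_coord simp flip: prb_def)
  finally show ?thesis unfolding pL_def by (simp add: prb_not[OF finM])
qed

lemma pL_bounds: "L \<subseteq> \<Lambda> \<Longrightarrow> 0 \<le> pL L \<and> pL L \<le> 1"
  unfolding pL_def using pr by (auto intro!: prod_nonneg prod_le_1)

text \<open>The Markov property of the exploration: \<open>N\<close> reads only edges at
  \<open>a\<close>, and the remaining exploration only edges avoiding \<open>a\<close>, so the
  latter may be resampled.\<close>

lemma prb_expl_process:
  fixes a :: "'v" and U :: "'v set" and L :: "nat set"
  assumes "a \<in> A" "A \<inter> U = {}" "finite A" "finite U"
  defines "N \<equiv> \<lambda>\<omega>. {u \<in> U. {a, u} \<in> opn L \<omega>}"
  shows "prb M (\<lambda>\<omega>. card (expl (opn L \<omega>) A U) < Suc k) =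
    mean M (\<lambda>\<omega>. prb M (\<lambda>\<omega>'. card (expl (opn L \<omega>') (A - {a} \<union> N \<omega>) (U - N \<omega>)) < k))"
proof -
  let ?B = "{(e, l). a \<notin> e}"
  have "prb M (\<lambda>\<omega>. card (expl (opn L \<omega>) A U) < Suc k) =
     prb M (\<lambda>\<omega>. card (expl (opn L \<omega>) (A - {a} \<union> N \<omega>) (U - N \<omega>)) < k)"
    using card_expl_process[OF assms(1,2) _ assms(3,4)] unfolding N_def by simp
  also have "\<dots> = mean M (\<lambda>\<omega>. prb M (\<lambda>\<omega>'. card (expl (opn L (override_on \<omega> \<omega>' ?B))
      (A - {a} \<union> N (override_on \<omega> \<omega>' ?B)) (U - N (override_on \<omega> \<omega>' ?B))) < k))"
    by (rule prb_resample)
  also have "\<dots> = mean M (\<lambda>\<omega>. prb M (\<lambda>\<omega>'. card (expl (opn L \<omega>') (A - {a} \<union> N \<omega>) (U - N \<omega>)) < k))"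
  proof -
    have "N (override_on \<omega> \<omega>' ?B) = N \<omega>" for \<omega> \<omega>'
      unfolding N_def opn_def by (auto simp: override_on_def)
    moreover have "expl (opn L (override_on \<omega> \<omega>' ?B)) (A - {a} \<union> N \<omega>) (U - N \<omega>) =
       expl (opn L \<omega>') (A - {a} \<union> N \<omega>) (U - N \<omega>)" for \<omega> \<omega>'
    proof (rule expl_cong)
      fix y v assume "y \<in> A - {a} \<union> N \<omega> \<union> (U - N \<omega>)" "v \<in> U - N \<omega>"
      then have "a \<notin> {y, v}" using assms(1,2) by (auto simp: N_def)
      then show "({y, v} \<in> opn L (override_on \<omega> \<omega>' ?B)) = ({y, v} \<in> opn L \<omega>')"
        by (auto simp: opn_def override_on_def)
    qed
    ultimately show ?thesis by simp
  qed
  finally show ?thesis .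
qed

lemma mean_exp_nbrs:
  assumes "a \<notin> U" "finite U" "L \<subseteq> \<Lambda>"
  shows "mean M (\<lambda>\<omega>. exp (- \<theta> * real (card {u \<in> U. {a, u} \<in> opn L \<omega>}))) =
    (1 - pL L * (1 - exp (- \<theta>))) ^ card {u \<in> U. {a, u} \<in> E}"
proof -
  let ?J = "{u \<in> U. {a, u} \<in> E}"
  have finJ: "finite ?J" using assms by auto
  have c: "real (card {u \<in> U. {a, u} \<in> opn L \<omega>}) = (\<Sum>u\<in>?J. of_bool ({a, u} \<in> opn L \<omega>))" for \<omega>
  proof -
    have "{u \<in> U. {a, u} \<in> opn L \<omega>} = ?J \<inter> {u. {a, u} \<in> opn L \<omega>}" using opn_sub by auto
    then show ?thesis using finJ by (simp add: of_bool_def sum.If_cases)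
  qed
  have "mean M (\<lambda>\<omega>. exp (- \<theta> * real (card {u \<in> U. {a, u} \<in> opn L \<omega>}))) =
     mean M (\<lambda>\<omega>. \<Prod>u\<in>?J. exp (- \<theta> * of_bool ({a, u} \<in> opn L \<omega>)))"
    unfolding c sum_distrib_left by (simp only: exp_sum[OF finJ])
  also have "\<dots> = (\<Prod>u\<in>?J. mean M (\<lambda>\<omega>. exp (- \<theta> * of_bool ({a, u} \<in> opn L \<omega>))))"
  proof (rule mean_prod_blocks[where B = "\<lambda>u. {{a, u}} \<times> L"])
    show "dep_on ({{a, u}} \<times> L) (\<lambda>\<omega>. exp (- \<theta> * of_bool ({a, u} \<in> opn L \<omega>)))" for u
      by (rule dep_on_comp[OF dep_opn])
  qed (use finJ in \<open>auto simp: doubleton_eq_iff\<close>)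
  also have "\<dots> = (\<Prod>u\<in>?J. 1 - pL L * (1 - exp (- \<theta>)))"
  proof (rule prod.cong)
    fix u assume "u \<in> ?J"
    have "mean M (\<lambda>\<omega>. exp (- \<theta> * of_bool ({a, u} \<in> opn L \<omega>))) =
       mean M (\<lambda>\<omega>. 1 - (1 - exp (- \<theta>)) * of_bool ({a, u} \<in> opn L \<omega>))"
      by (intro mean_cong) auto
    also have "\<dots> = 1 - (1 - exp (- \<theta>)) * prb M (\<lambda>\<omega>. {a, u} \<in> opn L \<omega>)"
      by (simp add: mean_diff mean_cmult mean_const finM prb_def)
    finally show "mean M (\<lambda>\<omega>. exp (- \<theta> * of_bool ({a, u} \<in> opn L \<omega>))) = 1 - pL L * (1 - exp (- \<theta>))"
      using \<open>u \<in> ?J\<close> assms(3) by (simp add: prb_opn mult.commute)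
  qed simp
  finally show ?thesis by simp
qed

lemma process_invariant:
  assumes "a \<in> A" "A \<inter> U = {}" "finite A" "finite U" "N \<subseteq> U"
    and deg: "\<And>v. v \<in> A \<union> U \<Longrightarrow> D + Suc k \<le> card {u \<in> U. {v, u} \<in> E} + card A"
    and v: "v \<in> A - {a} \<union> N \<union> (U - N)"
  shows "D + k \<le> card {u \<in> U - N. {v, u} \<in> E} + card (A - {a} \<union> N)"
    "card (A - {a} \<union> N) + 1 = card A + card N"
proof -
  have finN: "finite N" by (rule finite_subset[OF assms(5,4)])
  have "card (A - {a} \<union> N) = card (A - {a}) + card N"
    using assms(1-5) finN by (intro card_Un_disjoint) auto
  then show c: "card (A - {a} \<union> N) + 1 = card A + card N"
    using card_Suc_Diff1[OF assms(3,1)] by linarith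
  have "card {u \<in> U. {v, u} \<in> E} \<le> card ({u \<in> U - N. {v, u} \<in> E} \<union> N)"
    using assms(1-5) finN by (intro card_mono) auto
  also have "\<dots> \<le> card {u \<in> U - N. {v, u} \<in> E} + card N" by (rule card_Un_le)
  finally show "D + k \<le> card {u \<in> U - N. {v, u} \<in> E} + card (A - {a} \<union> N)"
    using c deg[of v] v assms(5) by fastforce
qed

text \<open>The invariant \<open>D + k \<le> card {u \<in> U. {v, u} \<in> E} + card A\<close> survives a step: every vertex
  leaving \<open>U\<close> enters \<open>A\<close>, and the processed vertex is paid for by \<open>k\<close>.\<close>

lemma expl_lower:
  assumes "L \<subseteq> \<Lambda>" "0 \<le> \<theta>" and key: "(1 - pL L * (1 - exp (- \<theta>))) ^ D \<le> exp (- \<theta>)"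
  shows "finite A \<Longrightarrow> finite U \<Longrightarrow> A \<inter> U = {} \<Longrightarrow>
    (\<And>v. v \<in> A \<union> U \<Longrightarrow> D + k \<le> card {u \<in> U. {v, u} \<in> E} + card A) \<Longrightarrow>
    prb M (\<lambda>\<omega>. card (expl (opn L \<omega>) A U) < k) \<le> exp (- \<theta> * real (card A))"
proof (induction k arbitrary: A U)
  case 0
  then show ?case by (simp add: prb_def mean_def)
next
  case (Suc k)
  let ?x = "1 - pL L * (1 - exp (- \<theta>))"
  have "exp (- \<theta>) \<le> 1" using assms(2) by simp
  then have x: "0 \<le> ?x" "?x \<le> 1"
    using pL_bounds[OF assms(1)] mult_mono[of "pL L" 1 "1 - exp (- \<theta>)" 1] by auto
  consider "A = {}" | "Suc k \<le> card A" | a where "a \<in> A" "card A \<le> k"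
    by (meson all_not_in_conv not_less_eq_eq)
  then show ?case
  proof cases
    case 1
    then show ?thesis using prb_le_1[OF finM] by simp
  next
    case 2
    have "card A \<le> card (expl (opn L \<omega>) A U)" for \<omega>
      using Suc.prems by (intro card_mono finite_expl expl_base) auto
    then have "\<not> card (expl (opn L \<omega>) A U) < Suc k" for \<omega>
      using 2 by (meson le_trans not_le)
    then show ?thesis by (simp add: prb_def mean_def)
  next
    case (3 a)
    let ?N = "\<lambda>\<omega>. {u \<in> U. {a, u} \<in> opn L \<omega>}"
    have "prb M (\<lambda>\<omega>. card (expl (opn L \<omega>) A U) < Suc k) =
      mean M (\<lambda>\<omega>. prb M (\<lambda>\<omega>'. card (expl (opn L \<omega>') (A - {a} \<union> ?N \<omega>) (U - ?N \<omega>)) < k))"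
      using 3 Suc.prems by (intro prb_expl_process) auto
    also have "\<dots> \<le> mean M (\<lambda>\<omega>. exp (- \<theta> * (real (card A) - 1)) * exp (- \<theta> * real (card (?N \<omega>))))"
    proof (rule mean_mono)
      fix \<omega>
      have inv: "D + k \<le> card {u \<in> U - ?N \<omega>. {v, u} \<in> E} + card (A - {a} \<union> ?N \<omega>)"
        "card (A - {a} \<union> ?N \<omega>) + 1 = card A + card (?N \<omega>)" if "v \<in> A - {a} \<union> ?N \<omega> \<union> (U - ?N \<omega>)" for v
        by (rule process_invariant[of a A U _ D k v, OF 3(1) _ _ _ _ Suc.prems(4)]; use Suc.prems that in auto)+
      \<comment> \<open>\<open>inv\<close> speaks about some remaining vertex \<open>v\<close>; if
        there is none, then \<open>A = {a}\<close> and no neighbour was found, and the equation is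
        checked directly.\<close>
      have c: "card (A - {a} \<union> ?N \<omega>) + 1 = card A + card (?N \<omega>)"
      proof (cases "A - {a} \<union> ?N \<omega> \<union> (U - ?N \<omega>) = {}")
        case True
        then have "A = {a}" "?N \<omega> = {}" using 3 by auto
        then show ?thesis by (simp only:) simp
      qed (use inv(2) in blast)
      have "prb M (\<lambda>\<omega>'. card (expl (opn L \<omega>') (A - {a} \<union> ?N \<omega>) (U - ?N \<omega>)) < k)
          \<le> exp (- \<theta> * real (card (A - {a} \<union> ?N \<omega>)))"
        using inv(1) Suc.prems by (intro Suc.IH) auto
      also have "\<dots> = exp (- \<theta> * (real (card A) - 1)) * exp (- \<theta> * real (card (?N \<omega>)))"
      proof -
        have "real (card (A - {a} \<union> ?N \<omega>)) = (real (card A) - 1) + real (card (?N \<omega>))"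
          using c by linarith
        then show ?thesis by (simp only: distrib_left exp_add)
      qed
      finally show "prb M (\<lambda>\<omega>'. card (expl (opn L \<omega>') (A - {a} \<union> ?N \<omega>) (U - ?N \<omega>)) < k)
          \<le> exp (- \<theta> * (real (card A) - 1)) * exp (- \<theta> * real (card (?N \<omega>)))" .
    qed
    also have "\<dots> = exp (- \<theta> * (real (card A) - 1)) * ?x ^ card {u \<in> U. {a, u} \<in> E}"
      unfolding mean_cmult using 3 Suc.prems assms(1) by (subst mean_exp_nbrs) auto
    \<comment> \<open>\<open>card A \<le> k\<close> and the invariant leave \<open>a\<close> at
      least \<open>D\<close> unexplored neighbours, so by \<open>key\<close> the weight exp (-
      \<theta> |A|) is a supermartingale at this step.\<close>
    also have "\<dots> \<le> exp (- \<theta> * (real (card A) - 1)) * exp (- \<theta>)"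
    proof -
      have "?x ^ card {u \<in> U. {a, u} \<in> E} \<le> ?x ^ D"
        using Suc.prems(4)[of a] 3 x by (intro power_decreasing) auto
      with key show ?thesis by (intro mult_left_mono) auto
    qed
    also have "\<dots> = exp (- \<theta> * real (card A))"
      by (simp add: algebra_simps flip: exp_add)
    finally show ?thesis .
  qed
qed

text \<open>By \<open>key1\<close> the weight exp (- \<theta> |A|) is a submartingale, but processes
  that do not die before step k must not be counted. The subtracted term pays for them: it dominates
  at k = 0 and, through exp (- (\<theta> - \<mu>)) \<le> \<beta>, whenever
  \<open>Suc k \<le> card A\<close>. By \<open>key2\<close> the weight exp (- \<mu> |A|) shrinks in
  mean by a factor \<beta> per step, so with \<beta> < 1 the correction is small for a large
  constant \<open>k\<close>.\<close>

lemma expl_upper: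
  assumes "L \<subseteq> \<Lambda>" "0 \<le> \<mu>" "\<mu> \<le> \<theta>" "0 \<le> \<beta>" "exp (- (\<theta> - \<mu>)) \<le> \<beta>"
    and key1: "exp (- \<theta>) \<le> (1 - pL L * (1 - exp (- \<theta>))) ^ dd"
    and key2: "(1 - pL L * (1 - exp (- \<mu>))) ^ D \<le> \<beta> * exp (- \<mu>)"
  shows "finite A \<Longrightarrow> finite U \<Longrightarrow> A \<inter> U = {} \<Longrightarrow>
    (\<And>v. v \<in> A \<union> U \<Longrightarrow> D + k \<le> card {u \<in> U. {v, u} \<in> E} + card A) \<Longrightarrow>
    (\<And>v. v \<in> A \<union> U \<Longrightarrow> card {u \<in> U. {v, u} \<in> E} \<le> dd) \<Longrightarrow>
    exp (- \<theta> * real (card A)) - \<beta> ^ k * exp (- \<mu> * real (card A)) \<le>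
    prb M (\<lambda>\<omega>. card (expl (opn L \<omega>) A U) < k)"
proof (induction k arbitrary: A U)
  case 0
  have "exp (- \<theta> * real (card A)) \<le> exp (- \<mu> * real (card A))"
    using assms by (simp add: mult_right_mono)
  then show ?case using prb_nonneg[of M] by (simp add: prb_def mean_def)
next
  case (Suc k)
  let ?x = "1 - pL L * (1 - exp (- \<theta>))" and ?y = "1 - pL L * (1 - exp (- \<mu>))"
  have "exp (- \<theta>) \<le> 1" "exp (- \<mu>) \<le> 1" using assms(2,3) by simp_all
  then have x: "0 \<le> ?x" "?x \<le> 1" and y: "0 \<le> ?y" "?y \<le> 1"
    using pL_bounds[OF assms(1)] mult_mono[of "pL L" 1 "1 - exp (- \<theta>)" 1]
      mult_mono[of "pL L" 1 "1 - exp (- \<mu>)" 1] by auto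
  consider "A = {}" | "Suc k \<le> card A" | a where "a \<in> A" "card A \<le> k"
    by (meson all_not_in_conv not_less_eq_eq)
  then show ?case
  proof cases
    case 1
    have "0 \<le> \<beta> ^ Suc k" using assms by simp
    then show ?thesis using 1 by (simp add: prb_def mean_const finM)
  next
    case 2
    have "exp (- (\<theta> - \<mu>)) ^ card A \<le> exp (- (\<theta> - \<mu>)) ^ Suc k"
      using 2 assms by (intro power_decreasing) auto
    also have "\<dots> \<le> \<beta> ^ Suc k" using assms by (intro power_mono) auto
    finally have "exp (- (\<theta> - \<mu>)) ^ card A * exp (- \<mu> * real (card A)) \<le> \<beta> ^ Suc k * exp (- \<mu> * real (card A))"
      by (intro mult_right_mono) auto
    moreover have "exp (- (\<theta> - \<mu>)) ^ card A * exp (- \<mu> * real (card A)) = exp (- \<theta> * real (card A))"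
      by (simp add: algebra_simps flip: exp_add exp_of_nat_mult)
    ultimately show ?thesis
      using prb_nonneg[of M "\<lambda>\<omega>. card (expl (opn L \<omega>) A U) < Suc k"] by linarith
  next
    case (3 a)
    let ?N = "\<lambda>\<omega>. {u \<in> U. {a, u} \<in> opn L \<omega>}"
    let ?c = "real (card A) - 1"
    have "exp (- \<theta> * real (card A)) - \<beta> ^ Suc k * exp (- \<mu> * real (card A))
        = exp (- \<theta> * ?c) * exp (- \<theta>) - \<beta> ^ k * exp (- \<mu> * ?c) * (\<beta> * exp (- \<mu>))"
      by (simp add: algebra_simps flip: exp_add)
    also have "\<dots> \<le> exp (- \<theta> * ?c) * ?x ^ card {u \<in> U. {a, u} \<in> E}
        - \<beta> ^ k * exp (- \<mu> * ?c) * ?y ^ card {u \<in> U. {a, u} \<in> E}"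
    proof (intro diff_mono mult_left_mono)
      have "?x ^ dd \<le> ?x ^ card {u \<in> U. {a, u} \<in> E}"
        using Suc.prems(5)[of a] 3 x by (intro power_decreasing) auto
      with key1 show "exp (- \<theta>) \<le> ?x ^ card {u \<in> U. {a, u} \<in> E}" by linarith
      have "?y ^ card {u \<in> U. {a, u} \<in> E} \<le> ?y ^ D"
        using Suc.prems(4)[of a] 3 y by (intro power_decreasing) auto
      with key2 show "?y ^ card {u \<in> U. {a, u} \<in> E} \<le> \<beta> * exp (- \<mu>)" by linarith
    qed (use assms in auto)
    also have "\<dots> = mean M (\<lambda>\<omega>. exp (- \<theta> * ?c) * exp (- \<theta> * real (card (?N \<omega>))) -
        \<beta> ^ k * exp (- \<mu> * ?c) * exp (- \<mu> * real (card (?N \<omega>))))"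
    proof -
      have aU: "a \<notin> U" using 3 Suc.prems by auto
      show ?thesis
        by (simp only: mean_cmult mean_diff mean_exp_nbrs[OF aU Suc.prems(2) assms(1)])
    qed
    also have "\<dots> \<le> mean M (\<lambda>\<omega>. prb M (\<lambda>\<omega>'. card (expl (opn L \<omega>') (A - {a} \<union> ?N \<omega>) (U - ?N \<omega>)) < k))"
    proof (rule mean_mono)
      fix \<omega>
      have inv: "D + k \<le> card {u \<in> U - ?N \<omega>. {v, u} \<in> E} + card (A - {a} \<union> ?N \<omega>)"
        "card (A - {a} \<union> ?N \<omega>) + 1 = card A + card (?N \<omega>)" if "v \<in> A - {a} \<union> ?N \<omega> \<union> (U - ?N \<omega>)" for v
        by (rule process_invariant[of a A U _ D k v, OF 3(1) _ _ _ _ Suc.prems(4)]; use Suc.prems that in auto)+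
      have c: "card (A - {a} \<union> ?N \<omega>) + 1 = card A + card (?N \<omega>)"
      proof (cases "A - {a} \<union> ?N \<omega> \<union> (U - ?N \<omega>) = {}")
        case True
        then have "A = {a}" "?N \<omega> = {}" using 3 by auto
        then show ?thesis by (simp only:) simp
      qed (use inv(2) in blast)
      have "exp (- \<theta> * real (card (A - {a} \<union> ?N \<omega>))) - \<beta> ^ k * exp (- \<mu> * real (card (A - {a} \<union> ?N \<omega>)))
         \<le> prb M (\<lambda>\<omega>'. card (expl (opn L \<omega>') (A - {a} \<union> ?N \<omega>) (U - ?N \<omega>)) < k)"
      proof (rule Suc.IH)
        show "card {u \<in> U - ?N \<omega>. {v, u} \<in> E} \<le> dd" if "v \<in> A - {a} \<union> ?N \<omega> \<union> (U - ?N \<omega>)" for v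
        proof -
          have "card {u \<in> U - ?N \<omega>. {v, u} \<in> E} \<le> card {u \<in> U. {v, u} \<in> E}"
            using Suc.prems by (intro card_mono) auto
          also have "\<dots> \<le> dd" using that by (intro Suc.prems(5)) auto
          finally show ?thesis .
        qed
      qed (use inv(1) Suc.prems in auto)
      also have "real (card (A - {a} \<union> ?N \<omega>)) = (real (card A) - 1) + real (card (?N \<omega>))"
          using c by linarith
      finally show "exp (- \<theta> * ?c) * exp (- \<theta> * real (card (?N \<omega>))) -
        \<beta> ^ k * exp (- \<mu> * ?c) * exp (- \<mu> * real (card (?N \<omega>))) \<le> prb M (\<lambda>\<omega>'. card (expl (opn L \<omega>') (A - {a} \<union> ?N \<omega>) (U - ?N \<omega>)) < k)"
        by (simp only: mult.assoc exp_add[symmetric] distrib_left)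
    qed
    also have "\<dots> = prb M (\<lambda>\<omega>. card (expl (opn L \<omega>) A U) < Suc k)"
      using 3 Suc.prems by (intro prb_expl_process[symmetric]) auto
    finally show ?thesis .
  qed
qed

lemma cluster_lower:
  assumes "L \<subseteq> \<Lambda>" "0 \<le> \<theta>" "(1 - pL L * (1 - exp (- \<theta>))) ^ D \<le> exp (- \<theta>)"
    and Y: "Y \<subseteq> V" "x \<in> Y" and deg: "\<And>v. v \<in> Y \<Longrightarrow> D + k \<le> card {u \<in> Y. {v, u} \<in> E}"
  shows "1 - exp (- \<theta>) \<le> prb M (\<lambda>\<omega>. k \<le> card (expl (opn L \<omega>) {x} Y))"
proof -
  have finY: "finite Y" using Y finV finite_subset by auto
  have "prb M (\<lambda>\<omega>. card (expl (opn L \<omega>) {x} (Y - {x})) < k) \<le> exp (- \<theta> * real (card {x}))"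
  proof (rule expl_lower[OF assms(1-3)])
    fix v assume "v \<in> {x} \<union> (Y - {x})"
    then have "D + k \<le> card {u \<in> Y. {v, u} \<in> E}" using deg Y by auto
    \<comment> \<open>Taking \<open>x\<close> out of the unexplored set costs at most one neighbour,
      which \<open>card {x} = 1\<close> repays in the invariant.\<close>
    also have "\<dots> \<le> card (insert x {u \<in> Y - {x}. {v, u} \<in> E})"
      using finY by (intro card_mono) auto
    also have "\<dots> \<le> card {u \<in> Y - {x}. {v, u} \<in> E} + card {x}"
      using finY by (simp add: card_insert_if)
    finally show "D + k \<le> card {u \<in> Y - {x}. {v, u} \<in> E} + card {x}" .
  qed (use finY in auto)
  then have "prb M (\<lambda>\<omega>. \<not> k \<le> card (expl (opn L \<omega>) {x} Y)) \<le> exp (- \<theta>)"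
    by (subst expl_remove) (simp add: not_le)
  then show ?thesis by (simp add: prb_not[OF finM])
qed

lemma cluster_upper:
  assumes "L \<subseteq> \<Lambda>" "0 \<le> \<mu>" "\<mu> \<le> \<theta>" "0 \<le> \<beta>" "exp (- (\<theta> - \<mu>)) \<le> \<beta>"
    and "exp (- \<theta>) \<le> (1 - pL L * (1 - exp (- \<theta>))) ^ dd"
    and "(1 - pL L * (1 - exp (- \<mu>))) ^ D \<le> \<beta> * exp (- \<mu>)"
    and x: "x \<in> V" and deg: "\<And>v. v \<in> V \<Longrightarrow> D + k \<le> card {u \<in> V. {v, u} \<in> E}"
    and dd: "\<And>v. v \<in> V \<Longrightarrow> card {u \<in> V. {v, u} \<in> E} \<le> dd"
  shows "prb M (\<lambda>\<omega>. k \<le> card (expl (opn L \<omega>) {x} V)) \<le> 1 - exp (- \<theta>) + \<beta> ^ k"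
proof -
  have "exp (- \<theta> * real (card {x})) - \<beta> ^ k * exp (- \<mu> * real (card {x})) \<le>
    prb M (\<lambda>\<omega>. card (expl (opn L \<omega>) {x} (V - {x})) < k)"
  proof (rule expl_upper[OF assms(1-7)])
    fix v assume "v \<in> {x} \<union> (V - {x})"
    then have v: "v \<in> V" using x by auto
    then have "D + k \<le> card {u \<in> V. {v, u} \<in> E}" using deg by auto
    also have "\<dots> \<le> card (insert x {u \<in> V - {x}. {v, u} \<in> E})"
      using finV by (intro card_mono) auto
    also have "\<dots> \<le> card {u \<in> V - {x}. {v, u} \<in> E} + card {x}"
      using finV by (simp add: card_insert_if)
    finally show "D + k \<le> card {u \<in> V - {x}. {v, u} \<in> E} + card {x}" .
    have "card {u \<in> V - {x}. {v, u} \<in> E} \<le> card {u \<in> V. {v, u} \<in> E}"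
      using finV by (intro card_mono) auto
    with dd[OF v] show "card {u \<in> V - {x}. {v, u} \<in> E} \<le> dd" by linarith
  qed (use finV in auto)
  moreover have "\<beta> ^ k * exp (- \<mu>) \<le> \<beta> ^ k * 1"
    using assms by (intro mult_left_mono) auto
  ultimately have "exp (- \<theta>) - \<beta> ^ k \<le> prb M (\<lambda>\<omega>. \<not> k \<le> card (expl (opn L \<omega>) {x} V))"
    by (subst expl_remove) (simp add: not_le)
  then show ?thesis by (simp add: prb_not[OF finM])
qed

section \<open>Vertices in large clusters and the variance of their number\<close>

definition big :: "nat \<Rightarrow> 'v set set \<Rightarrow> 'v set" where
  "big k F = {v \<in> V. k \<le> card (expl F {v} V)}"

lemma big_sub: "big k F \<subseteq> V" by (auto simp: big_def)

lemma finite_big: "finite (big k F)" using finite_subset[OF big_sub finV] .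

lemma big_mono: "F \<subseteq> F' \<Longrightarrow> k' \<le> k \<Longrightarrow> big k F \<subseteq> big k' F'"
proof
  fix v assume "F \<subseteq> F'" "k' \<le> k" and v: "v \<in> big k F"
  have "card (expl F {v} V) \<le> card (expl F' {v} V)"
    using \<open>F \<subseteq> F'\<close> finV by (intro card_mono finite_expl expl_mono) auto
  with v \<open>k' \<le> k\<close> show "v \<in> big k' F'" by (auto simp: big_def)
qed

text \<open>Only the vertices of the two clusters joined by the new edge can become big.\<close>

lemma big_insert_edge:
  assumes "a \<in> V" "b \<in> V"
  shows "card (big k (insert {a, b} F)) \<le> card (big k F) + 2 * k"
proof -
  let ?S = "\<lambda>x. if card (expl F {x} V) < k then expl F {x} V else {}"
  have "big k (insert {a, b} F) \<subseteq> big k F \<union> (?S a \<union> ?S b)"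
  proof
    fix v assume v: "v \<in> big k (insert {a, b} F)"
    then have vV: "v \<in> V" by (auto simp: big_def)
    show "v \<in> big k F \<union> (?S a \<union> ?S b)"
    proof (rule ccontr)
      assume n: "v \<notin> big k F \<union> (?S a \<union> ?S b)"
      then have c: "card (expl F {v} V) < k" using vV by (auto simp: big_def)
      have "x \<notin> expl F {v} V" if "x = a \<or> x = b" for x
      proof
        assume x: "x \<in> expl F {v} V"
        then have "expl F {x} V = expl F {v} V" using vV by (intro expl_eq)
        moreover have "v \<in> expl F {v} V" using expl_base[of "{v}" F V] by auto
        ultimately have "v \<in> ?S x" using c by simp
        then show False using n that by auto
      qed
      then have "expl (insert {a, b} F) {v} V \<subseteq> expl F {v} V"
        by (intro expl_least expl_base) (auto intro: expl_step simp: doubleton_eq_iff)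
      then have "card (expl (insert {a, b} F) {v} V) \<le> card (expl F {v} V)"
        using finV by (intro card_mono finite_expl) auto
      then show False using v c by (auto simp: big_def)
    qed
  qed
  then have "card (big k (insert {a, b} F)) \<le> card (big k F \<union> (?S a \<union> ?S b))"
    by (intro card_mono) (auto intro!: finite_big finite_expl finV)
  also have "\<dots> \<le> card (big k F) + (card (?S a) + card (?S b))"
    by (meson add_left_mono card_Un_le le_trans)
  also have "\<dots> \<le> card (big k F) + (k + k)" by (intro add_mono) auto
  finally show ?thesis by simp
qed

text \<open>Efron--Stein over the edge-layer bits: flipping one bit moves the count by at most
  \<open>2 * k\<close>, by \<open>big_insert_edge\<close>, and a Bernoulli bit contributes pr (1 -
  pr) times the squared change. For densities of order 1 / deg the bound becomes O(k^2 n).\<close>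

lemma vari_big:
  "vari M (\<lambda>\<omega>. real (card (big k (opn L \<omega>)))) \<le> 4 * (real k)\<^sup>2 * (real (card E) * (\<Sum>l\<in>\<Lambda>. pr l))"
proof -
  let ?f = "\<lambda>\<omega>. real (card (big k (opn L \<omega>)))"
  have "vari M ?f \<le> (\<Sum>i\<in>E \<times> \<Lambda>. mean M (\<lambda>x. vari ((\<lambda>(e, l). bernoulli_pmf (pr l)) i) (\<lambda>y. ?f (x(i := y)))))"
    by (rule efron_stein) (use finI finP in auto)
  also have "\<dots> \<le> (\<Sum>i\<in>E \<times> \<Lambda>. pr (snd i) * (4 * (real k)\<^sup>2))"
  proof (intro sum_mono mean_le finM)
    fix i x assume i: "i \<in> E \<times> \<Lambda>"
    obtain e l where el: "i = (e, l)" by force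
    obtain a b where ab: "e = {a, b}" using E[of e] i el by (auto simp: card_2_iff)
    have abV: "a \<in> V" "b \<in> V" using E[of e] i el ab by auto
    let ?T = "?f (x(i := True))" and ?F = "?f (x(i := False))"
    have p: "0 \<le> pr l" "pr l \<le> 1" using pr by auto
    have "opn L (x(i := True)) = opn L (x(i := False)) \<or> opn L (x(i := True)) = insert {a, b} (opn L (x(i := False)))"
      using i unfolding opn_def el ab by auto
    then have d: "0 \<le> ?T - ?F" "?T - ?F \<le> 2 * real k"
    proof -
      assume o: "opn L (x(i := True)) = opn L (x(i := False)) \<or> opn L (x(i := True)) = insert {a, b} (opn L (x(i := False)))"
      have "card (big k (opn L (x(i := False)))) \<le> card (big k (opn L (x(i := True))))"
        using o by (intro card_mono finite_big big_mono) auto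
      then show "0 \<le> ?T - ?F" by simp
      have "card (big k (opn L (x(i := True)))) \<le> card (big k (opn L (x(i := False)))) + 2 * k"
        using o big_insert_edge[OF abV, of k "opn L (x(i := False))"] by auto
      then show "?T - ?F \<le> 2 * real k" by linarith
    qed
    have "vari (bernoulli_pmf (pr l)) (\<lambda>y. ?f (x(i := y))) = (pr l * (1 - pr l)) * (?T - ?F)\<^sup>2"
      unfolding vari_def using p by (simp add: mean_bernoulli power2_eq_square algebra_simps)
    also have "\<dots> \<le> (pr l * 1) * (2 * real k)\<^sup>2"
      using p d by (intro mult_mono power_mono) auto
    finally show "vari ((\<lambda>(e, l). bernoulli_pmf (pr l)) i) (\<lambda>y. ?f (x(i := y))) \<le> pr (snd i) * (4 * (real k)\<^sup>2)"
      by (simp add: el power_mult_distrib)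
  qed
  also have "\<dots> = 4 * (real k)\<^sup>2 * (real (card E) * (\<Sum>l\<in>\<Lambda>. pr l))"
    by (simp add: sum.cartesian_product' sum_distrib_right[symmetric])
  finally show ?thesis .
qed

end

section \<open>Product graphs\<close>

locale product_graph =
  fixes T :: "'i set" and Gs :: "'i \<Rightarrow> 'a ugraph" and k :: "'i \<Rightarrow> nat" and C :: nat
  assumes finT: "finite T"
    and simple: "\<And>j. j \<in> T \<Longrightarrow> simple_graph (Gs j)"
    and conn: "\<And>j. j \<in> T \<Longrightarrow> connected_graph (Gs j)"
    and reg: "\<And>j. j \<in> T \<Longrightarrow> regular_graph (k j) (Gs j)"
    and card_gt: "\<And>j. j \<in> T \<Longrightarrow> 1 < card (verts (Gs j))"
    and card_le: "\<And>j. j \<in> T \<Longrightarrow> card (verts (Gs j)) \<le> C"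
begin

definition V :: "('i \<Rightarrow> 'a) set" where "V = (\<Pi>\<^sub>E j\<in>T. verts (Gs j))"
definition E :: "('i \<Rightarrow> 'a) set set" where "E = edges (cartesian_product T Gs)"
definition deg :: nat where "deg = (\<Sum>j\<in>T. k j)"
text \<open>The subproduct through \<open>x\<close> in the directions \<open>I\<close>. It is
  regular of degree \<open>\<Sum>j\<in>I. k j\<close>, see \<open>card_nbrs_box\<close>, so freezing
  a few coordinates costs little degree and the cluster bounds apply inside it.\<close>

definition box :: "('i \<Rightarrow> 'a) \<Rightarrow> 'i set \<Rightarrow> ('i \<Rightarrow> 'a) set" where
  "box x I = {y \<in> V. \<forall>j\<in>T - I. y j = x j}"

lemma fin_verts: "j \<in> T \<Longrightarrow> finite (verts (Gs j))"
  using simple unfolding simple_graph_def by auto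

lemma edge_verts: "j \<in> T \<Longrightarrow> {a, b} \<in> edges (Gs j) \<Longrightarrow> a \<in> verts (Gs j) \<and> b \<in> verts (Gs j) \<and> a \<noteq> b"
  using simple[of j] unfolding simple_graph_def by (cases "a = b") fastforce+

lemma finite_V: "finite V" unfolding V_def using finT fin_verts by (auto intro: finite_PiE)

lemma V_coord: "v \<in> V \<Longrightarrow> j \<in> T \<Longrightarrow> v j \<in> verts (Gs j)" unfolding V_def by auto

lemma V_upd: "v \<in> V \<Longrightarrow> j \<in> T \<Longrightarrow> a \<in> verts (Gs j) \<Longrightarrow> v(j := a) \<in> V"
  unfolding V_def by (auto simp: PiE_def extensional_def)

lemma V_eqI: "u \<in> V \<Longrightarrow> v \<in> V \<Longrightarrow> (\<And>j. j \<in> T \<Longrightarrow> u j = v j) \<Longrightarrow> u = v"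
  unfolding V_def by (rule PiE_ext)

lemma E_iff: "{u, v} \<in> E \<longleftrightarrow> u \<in> V \<and> v \<in> V \<and>
  (\<exists>j\<in>T. {u j, v j} \<in> edges (Gs j) \<and> (\<forall>m\<in>T - {j}. u m = v m))"
  unfolding E_def cartesian_product_def V_def[symmetric]
  by (auto simp: doubleton_eq_iff insert_commute) (metis insert_commute)+

lemma E_upd_iff: "v \<in> V \<Longrightarrow> {v, u} \<in> E \<longleftrightarrow> (\<exists>j\<in>T. {v j, u j} \<in> edges (Gs j) \<and> u = v(j := u j))"
proof
  assume v: "v \<in> V" and "{v, u} \<in> E"
  then obtain j where j: "j \<in> T" "{v j, u j} \<in> edges (Gs j)" "\<forall>m\<in>T - {j}. v m = u m" "u \<in> V"
    unfolding E_iff by blast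
  have "u = v(j := u j)"
    by (rule V_eqI) (use j v in \<open>auto intro: V_upd V_coord\<close>)
  then show "\<exists>j\<in>T. {v j, u j} \<in> edges (Gs j) \<and> u = v(j := u j)" using j by blast
next
  assume v: "v \<in> V" and "\<exists>j\<in>T. {v j, u j} \<in> edges (Gs j) \<and> u = v(j := u j)"
  then obtain j where j: "j \<in> T" "{v j, u j} \<in> edges (Gs j)" "u = v(j := u j)" by blast
  have "u \<in> V" using V_upd[OF v j(1), of "u j"] edge_verts[OF j(1,2)] j(3) by simp
  moreover have "\<forall>m\<in>T - {j}. v m = u m" using j(3) by (metis Diff_iff fun_upd_other insertI1)
  ultimately show "{v, u} \<in> E" unfolding E_iff using v j by blast
qed

lemma E_simple: "e \<in> E \<Longrightarrow> e \<subseteq> V \<and> card e = 2"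
proof -
  assume e: "e \<in> E"
  then obtain u v where uv: "e = {u, v}"
    unfolding E_def cartesian_product_def by auto
  then have "u \<in> V" "v \<in> V" and "\<exists>j\<in>T. {u j, v j} \<in> edges (Gs j)" using e E_iff by blast+
  then have "u \<noteq> v" using edge_verts by blast
  then show ?thesis using uv \<open>u \<in> V\<close> \<open>v \<in> V\<close> by auto
qed

lemma k_ge: assumes j: "j \<in> T" and a: "a \<in> verts (Gs j)" shows "\<exists>w. {a, w} \<in> edges (Gs j)"
proof -
  have "verts (Gs j) \<noteq> {a}" using card_gt[OF j] by auto
  then obtain b where b: "b \<in> verts (Gs j)" "b \<noteq> a" using a by auto
  have "(\<lambda>u v. {u, v} \<in> edges (Gs j))\<^sup>*\<^sup>* a b"
    using conn[OF j] a b unfolding connected_graph_def reachable_def by blast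
  then show ?thesis by (cases rule: converse_rtranclpE) (use b(2) in auto)
qed

lemma k_pos: assumes j: "j \<in> T" shows "1 \<le> k j" "k j < C"
proof -
  obtain a where a: "a \<in> verts (Gs j)" using card_gt[OF j] by (cases "verts (Gs j) = {}") auto
  have c: "card {u. {a, u} \<in> edges (Gs j)} = k j" using reg[OF j] a unfolding regular_graph_def by blast
  have sub: "{u. {a, u} \<in> edges (Gs j)} \<subseteq> verts (Gs j) - {a}" using edge_verts[OF j] by blast
  have fin: "finite {u. {a, u} \<in> edges (Gs j)}" by (rule finite_subset[OF sub]) (simp add: fin_verts j)
  have "{u. {a, u} \<in> edges (Gs j)} \<noteq> {}" using k_ge[OF j a] by blast
  then have "0 < k j" unfolding c[symmetric] using fin by (simp add: card_gt_0_iff)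
  then show "1 \<le> k j" by simp
  have "k j \<le> card (verts (Gs j) - {a})" unfolding c[symmetric] using fin_verts[OF j] sub by (intro card_mono) auto
  also have "\<dots> < card (verts (Gs j))" using a fin_verts[OF j] by (intro psubset_card_mono) auto
  finally show "k j < C" using card_le[OF j] by linarith
qed

lemma deg_ge: "card T \<le> deg" unfolding deg_def using sum_bounded_below[of T 1 k] k_pos by auto

lemma sum_k_le: "I \<subseteq> T \<Longrightarrow> (\<Sum>j\<in>I. k j) \<le> C * card I"
  using sum_bounded_above[of I k C] k_pos(2) by (force simp: mult.commute)

lemma deg_le: "deg \<le> C * card T" unfolding deg_def by (rule sum_k_le) simp

text \<open>The number of vertices is exponential in \<open>card T\<close> whereas
  \<open>deg\<close> is linear in it; Chebyshev errors of order deg^2 / card V therefore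
  vanish.\<close>

lemma card_V: "2 ^ card T \<le> card V"
proof -
  have "(\<Prod>j\<in>T. (2::nat)) \<le> (\<Prod>j\<in>T. card (verts (Gs j)))"
    using card_gt by (intro prod_mono) (auto simp: Suc_le_eq numeral_2_eq_2)
  then show ?thesis unfolding V_def using finT by (simp add: card_PiE)
qed

lemma V_pos: "0 < card V" using card_V by (metis less_le_trans zero_less_numeral zero_less_power)

lemma nbrs_box:
  assumes I: "I \<subseteq> T" and v: "v \<in> box x I"
  shows "{u \<in> box x I. {v, u} \<in> E} = (\<Union>j\<in>I. (\<lambda>w. v(j := w)) ` {w. {v j, w} \<in> edges (Gs j)})"
proof -
  have vV: "v \<in> V" using v by (auto simp: box_def)
  show ?thesis
  proof (intro equalityI subsetI)
    fix u assume u: "u \<in> {u \<in> box x I. {v, u} \<in> E}"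
    then obtain j where j: "j \<in> T" "{v j, u j} \<in> edges (Gs j)" "u = v(j := u j)"
      using E_upd_iff[OF vV] by blast
    have "j \<in> I"
    proof (rule ccontr)
      assume "j \<notin> I"
      then have "u j = v j" using u v j(1) by (auto simp: box_def)
      then show False using edge_verts[OF j(1,2)] by auto
    qed
    then show "u \<in> (\<Union>j\<in>I. (\<lambda>w. v(j := w)) ` {w. {v j, w} \<in> edges (Gs j)})" using j by blast
  next
    fix u assume "u \<in> (\<Union>j\<in>I. (\<lambda>w. v(j := w)) ` {w. {v j, w} \<in> edges (Gs j)})"
    then obtain j w where jw: "j \<in> I" "{v j, w} \<in> edges (Gs j)" "u = v(j := w)" by blast
    have "{v, u} \<in> E" unfolding E_upd_iff[OF vV] using jw I by (intro bexI[of _ j]) auto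
    moreover have "u \<in> box x I"
      using v jw I V_upd[OF vV, of j w] edge_verts[of j "v j" w] by (auto simp: box_def)
    ultimately show "u \<in> {u \<in> box x I. {v, u} \<in> E}" by simp
  qed
qed

text \<open>Factors have no loops, so the neighbours found in different directions are distinct. The
  predicate \<open>Q\<close> lets one count serve for degrees and for boundary edges.\<close>

lemma sum_nbrs_box:
  assumes I: "I \<subseteq> T" and v: "v \<in> box x I"
  shows "card {u \<in> box x I. {v, u} \<in> E \<and> Q u} = (\<Sum>j\<in>I. card {w. {v j, w} \<in> edges (Gs j) \<and> Q (v(j := w))})"
proof -
  have vV: "v \<in> V" using v by (auto simp: box_def)
  have finI: "finite I" using I finT finite_subset by auto
  have fin: "finite {w. {v j, w} \<in> edges (Gs j)}" if "j \<in> I" for j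
  proof -
    have jT: "j \<in> T" using that I by auto
    show ?thesis by (rule finite_subset[OF _ fin_verts[OF jT]]) (use edge_verts[OF jT] in blast)
  qed
  have "{u \<in> box x I. {v, u} \<in> E \<and> Q u} = (\<Union>j\<in>I. (\<lambda>w. v(j := w)) ` {w. {v j, w} \<in> edges (Gs j) \<and> Q (v(j := w))})"
  proof -
    have "{u \<in> box x I. {v, u} \<in> E \<and> Q u} = {u \<in> {u \<in> box x I. {v, u} \<in> E}. Q u}" by simp
    also have "\<dots> = (\<Union>j\<in>I. (\<lambda>w. v(j := w)) ` {w. {v j, w} \<in> edges (Gs j) \<and> Q (v(j := w))})"
      unfolding nbrs_box[OF assms] by auto
    finally show ?thesis .
  qed
  also have "card \<dots> = (\<Sum>j\<in>I. card ((\<lambda>w. v(j := w)) ` {w. {v j, w} \<in> edges (Gs j) \<and> Q (v(j := w))}))"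
  proof (rule card_UN_disjoint[OF finI])
    show "\<forall>i\<in>I. finite ((\<lambda>w. v(i := w)) ` {w. {v i, w} \<in> edges (Gs i) \<and> Q (v(i := w))})"
            by (intro ballI finite_imageI) (rule finite_subset[OF _ fin], auto)
    show "\<forall>i\<in>I. \<forall>j\<in>I. i \<noteq> j \<longrightarrow> (\<lambda>w. v(i := w)) ` {w. {v i, w} \<in> edges (Gs i) \<and> Q (v(i := w))} \<inter>
        (\<lambda>w. v(j := w)) ` {w. {v j, w} \<in> edges (Gs j) \<and> Q (v(j := w))} = {}"
    proof (intro ballI impI, rule ccontr)
      fix i j assume ij: "i \<in> I" "j \<in> I" "i \<noteq> j" and "(\<lambda>w. v(i := w)) ` {w. {v i, w} \<in> edges (Gs i) \<and> Q (v(i := w))} \<inter>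
        (\<lambda>w. v(j := w)) ` {w. {v j, w} \<in> edges (Gs j) \<and> Q (v(j := w))} \<noteq> {}"
      then obtain w w' where w: "{v i, w} \<in> edges (Gs i)" "v(i := w) = v(j := w')" by blast
      then have "w = v i" using ij(3) by (metis fun_upd_other fun_upd_same)
      then show False using edge_verts[of i "v i" w] w ij I by auto
    qed
  qed
  also have "\<dots> = (\<Sum>j\<in>I. card {w. {v j, w} \<in> edges (Gs j) \<and> Q (v(j := w))})"
    by (intro sum.cong refl card_image) (auto simp: inj_on_def dest: fun_upd_eqD)
  finally show ?thesis .
qed

lemma card_nbrs_box:
  assumes "I \<subseteq> T" "v \<in> box x I"
  shows "card {u \<in> box x I. {v, u} \<in> E} = (\<Sum>j\<in>I. k j)"
proof -
  have "card {u \<in> box x I. {v, u} \<in> E} = (\<Sum>j\<in>I. card {w. {v j, w} \<in> edges (Gs j)})"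
    using sum_nbrs_box[OF assms, of "\<lambda>_. True"] by simp
  also have "\<dots> = (\<Sum>j\<in>I. k j)"
  proof (rule sum.cong)
    fix j assume "j \<in> I"
    then show "card {w. {v j, w} \<in> edges (Gs j)} = k j"
      using reg[of j] assms V_coord[of v j] unfolding regular_graph_def by (auto simp: box_def)
  qed simp
  finally show ?thesis .
qed

lemma box_T [simp]: "box x T = V" by (auto simp: box_def)

lemma card_nbrs: "v \<in> V \<Longrightarrow> card {u \<in> V. {v, u} \<in> E} = deg"
  using card_nbrs_box[of T v v] by (simp add: deg_def)

lemma card_E: "card E \<le> card V * deg"
proof -
  have "E \<subseteq> (\<lambda>(u, v). {u, v}) ` (SIGMA u:V. {v \<in> V. {u, v} \<in> E})"
  proof
    fix e assume e: "e \<in> E"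
    then obtain u v where uv: "e = {u, v}" using E_simple[OF e] unfolding card_2_iff by blast
    then have "u \<in> V" "v \<in> V" using E_simple[OF e] by auto
    with e uv show "e \<in> (\<lambda>(u, v). {u, v}) ` (SIGMA u:V. {v \<in> V. {u, v} \<in> E})"
      by (intro image_eqI[of _ _ "(u, v)"]) auto
  qed
  moreover have fin: "finite (SIGMA u:V. {v \<in> V. {u, v} \<in> E})"
    using finite_V by auto
  ultimately have "card E \<le> card ((\<lambda>(u, v). {u, v}) ` (SIGMA u:V. {v \<in> V. {u, v} \<in> E}))"
    by (intro card_mono finite_imageI)
  also have "\<dots> \<le> card (SIGMA u:V. {v \<in> V. {u, v} \<in> E})"
    using fin by (rule card_image_le)
  also have "\<dots> = card V * deg"
    using finite_V by (simp add: card_SigmaI card_nbrs)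
  finally show ?thesis .
qed

text \<open>The crude bound 1 on the variance of an indicator suffices: the right-hand side is a
  count, and it is at least 1 as soon as a path in the factor leads from inside \<open>S\<close> to
  outside.\<close>

lemma fibre_vari:
  assumes j: "j \<in> T" and x: "x \<in> V"
  shows "vari (pmf_of_set (verts (Gs j))) (\<lambda>y. of_bool (x(j := y) \<in> S))
    \<le> (\<Sum>a\<in>verts (Gs j). real (card {w. {a, w} \<in> edges (Gs j) \<and> x(j := a) \<in> S \<and> x(j := w) \<notin> S}))"
proof -
  let ?P = "pmf_of_set (verts (Gs j))" and ?f = "\<lambda>y. of_bool (x(j := y) \<in> S) :: real"
  have ne: "verts (Gs j) \<noteq> {}" using card_gt[OF j] by auto
  have finP: "finite (set_pmf ?P)" and setP: "set_pmf ?P = verts (Gs j)" using fin_verts[OF j] ne by auto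
  let ?R = "\<Sum>a\<in>verts (Gs j). real (card {w. {a, w} \<in> edges (Gs j) \<and> x(j := a) \<in> S \<and> x(j := w) \<notin> S})"
  have R0: "0 \<le> ?R" by (intro sum_nonneg) auto
  have le1: "vari ?P ?f \<le> 1"
  proof -
    have "mean ?P (\<lambda>y. (?f y)\<^sup>2) \<le> 1" by (rule mean_le[OF finP]) simp
    then show ?thesis unfolding vari_def using zero_le_power2[of "mean ?P ?f"] by linarith
  qed
  have const: "vari ?P ?f = 0" if "\<And>y. y \<in> verts (Gs j) \<Longrightarrow> ?f y = c" for c
  proof -
    have "mean ?P ?f = mean ?P (\<lambda>_. c)" "mean ?P (\<lambda>y. (?f y)\<^sup>2) = mean ?P (\<lambda>_. c\<^sup>2)"
      by (intro mean_cong; use that setP in simp)+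
    then show ?thesis by (simp add: vari_def mean_const[OF finP])
  qed
  consider "\<forall>y\<in>verts (Gs j). ?f y = 1" | "\<forall>y\<in>verts (Gs j). ?f y = 0"
    | a b where "a \<in> verts (Gs j)" "b \<in> verts (Gs j)" "x(j := a) \<in> S" "x(j := b) \<notin> S"
    by (metis of_bool_def)
  then show ?thesis
  proof cases
    case (3 a b)
    have "(\<lambda>u v. {u, v} \<in> edges (Gs j))\<^sup>*\<^sup>* a b"
      using conn[OF j] 3 unfolding connected_graph_def reachable_def by blast
    then have "\<exists>a' w. {a', w} \<in> edges (Gs j) \<and> x(j := a') \<in> S \<and> x(j := w) \<notin> S"
      using 3(3,4) by (induction rule: rtranclp_induct) auto
    then obtain a' w where aw: "{a', w} \<in> edges (Gs j)" "x(j := a') \<in> S" "x(j := w) \<notin> S" by blast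
    have a': "a' \<in> verts (Gs j)" using edge_verts[OF j aw(1)] by auto
    have "finite {w. {a', w} \<in> edges (Gs j) \<and> x(j := a') \<in> S \<and> x(j := w) \<notin> S}"
      by (rule finite_subset[OF _ fin_verts[OF j]]) (use edge_verts[OF j] in blast)
    then have "0 < card {w. {a', w} \<in> edges (Gs j) \<and> x(j := a') \<in> S \<and> x(j := w) \<notin> S}"
      using aw by (auto simp: card_gt_0_iff)
    then have "1 \<le> real (card {w. {a', w} \<in> edges (Gs j) \<and> x(j := a') \<in> S \<and> x(j := w) \<notin> S})" by linarith
    also have "\<dots> \<le> ?R" using a' fin_verts[OF j] by (intro member_le_sum) auto
    finally show ?thesis using le1 by linarith
  qed (use const R0 in auto)
qed

text \<open>Efron--Stein for the indicator of \<open>S\<close> under the uniform measure: by connectivity of the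
  factors, a fibre on which the indicator is not constant contains a boundary edge.\<close>

lemma isoperimetry:
  assumes S: "S \<subseteq> V"
  shows "real (card S) * real (card (V - S)) \<le>
    real C * real (card V) * (\<Sum>u\<in>S. real (card {v \<in> V - S. {u, v} \<in> E}))"
proof -
  let ?P = "\<lambda>j. pmf_of_set (verts (Gs j))"
  let ?n = "real (card V)"
  let ?f = "\<lambda>x. of_bool (x \<in> S) :: real"
  have ne: "verts (Gs j) \<noteq> {}" if "j \<in> T" for j using card_gt[OF that] by auto
  interpret fp: fin_product T undefined ?P
    by unfold_locales (use finT fin_verts ne in auto)
  \<comment> \<open>Choosing \<open>undefined\<close> as the default of the product measure matches
    the extensional functions in \<open>V\<close>, so the product of uniform laws is uniform on
    \<open>V\<close>.\<close>
  have dfl: "PiE_dflt T undefined (\<lambda>j. verts (Gs j)) = V"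
    unfolding PiE_dflt_def V_def PiE_def extensional_def Pi_def by auto
  have M: "fp.M = pmf_of_set V"
    using finT fin_verts ne by (subst Pi_pmf_of_set) (auto simp: dfl)
  have Vne: "V \<noteq> {}" using V_pos by auto
  have meanM: "mean fp.M g = (\<Sum>x\<in>V. g x) / ?n" for g
    unfolding M using finite_V Vne by (simp add: mean_of_set)
  have setM: "set_pmf fp.M = V" unfolding M using finite_V Vne by simp
  have cS: "real (card (V - S)) = ?n - real (card S)"
    using S finite_V by (simp add: card_Diff_subset finite_subset card_mono of_nat_diff)
  have VS: "V \<inter> S = S" using S by auto
  have m: "mean fp.M ?f = real (card S) / ?n"
    unfolding meanM using finite_V VS by (simp add: of_bool_def sum.If_cases)
  have "(\<lambda>x. (?f x)\<^sup>2) = ?f" by auto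
  then have m2: "mean fp.M (\<lambda>x. (?f x)\<^sup>2) = real (card S) / ?n"
    using m by simp
  have npos: "0 < ?n" using V_pos by simp
  have v: "vari fp.M ?f = real (card S) * real (card (V - S)) / ?n\<^sup>2"
    unfolding vari_def m m2 cS using npos by (simp add: field_simps power2_eq_square)
  let ?g = "\<lambda>j u. real (card {w. {u j, w} \<in> edges (Gs j) \<and> u \<in> S \<and> u(j := w) \<notin> S})"
  have "vari fp.M ?f \<le> (\<Sum>j\<in>T. mean fp.M (\<lambda>x. vari (?P j) (\<lambda>y. ?f (x(j := y)))))"
    by (rule efron_stein) (use finT fin_verts ne in auto)
  also have "\<dots> \<le> (\<Sum>j\<in>T. real C * mean fp.M (?g j))"
  proof (rule sum_mono)
    fix j assume j: "j \<in> T"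
    have "mean fp.M (\<lambda>x. vari (?P j) (\<lambda>y. ?f (x(j := y)))) \<le>
        mean fp.M (\<lambda>x. real (card (verts (Gs j))) * mean (?P j) (\<lambda>a. ?g j (x(j := a))))"
    proof (rule mean_mono)
      fix x assume "x \<in> set_pmf fp.M"
      then have x: "x \<in> V" by (simp add: setM)
      have "vari (?P j) (\<lambda>y. ?f (x(j := y))) \<le> (\<Sum>a\<in>verts (Gs j). ?g j (x(j := a)))"
        using fibre_vari[OF j x, of S] by simp
      \<comment> \<open>A sum over the fibre is its size times a mean over it; bounding this size by
        \<open>C\<close> is where the constant \<open>C\<close> comes from.\<close>
      also have "\<dots> = real (card (verts (Gs j))) * mean (?P j) (\<lambda>a. ?g j (x(j := a)))"
        using card_gt[OF j] by (simp add: mean_of_set fin_verts[OF j] ne[OF j])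
      finally show "vari (?P j) (\<lambda>y. ?f (x(j := y))) \<le> real (card (verts (Gs j))) * mean (?P j) (\<lambda>a. ?g j (x(j := a)))" .
    qed
    also have "\<dots> = real (card (verts (Gs j))) * mean fp.M (?g j)"
      unfolding mean_cmult by (subst fp.mean_coord[OF j]) simp
    also have "\<dots> \<le> real C * mean fp.M (?g j)"
      using card_le[OF j] by (intro mult_right_mono mean_nonneg) auto
    finally show "mean fp.M (\<lambda>x. vari (?P j) (\<lambda>y. ?f (x(j := y)))) \<le> real C * mean fp.M (?g j)" .
  qed
  also have "\<dots> = real C * (mean fp.M (\<lambda>u. \<Sum>j\<in>T. ?g j u))"
    by (simp add: sum_distrib_left mean_sum)
  \<comment> \<open>Summed over all directions, the fibre terms count every boundary edge at
    \<open>u\<close> exactly once.\<close>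
  also have "mean fp.M (\<lambda>u. \<Sum>j\<in>T. ?g j u) = mean fp.M (\<lambda>u. if u \<in> S then real (card {v \<in> V - S. {u, v} \<in> E}) else 0)"
  proof (rule mean_cong)
    fix u assume "u \<in> set_pmf fp.M"
    then have u: "u \<in> V" by (simp add: setM)
    have "{v \<in> V - S. {u, v} \<in> E} = {v \<in> V. {u, v} \<in> E \<and> v \<notin> S}" by auto
    then show "(\<Sum>j\<in>T. ?g j u) = (if u \<in> S then real (card {v \<in> V - S. {u, v} \<in> E}) else 0)"
      using sum_nbrs_box[of T u u "\<lambda>v. v \<notin> S"] u by simp
  qed
  also have "\<dots> = (\<Sum>u\<in>S. real (card {v \<in> V - S. {u, v} \<in> E})) / ?n"
    unfolding meanM using finite_V VS by (simp add: sum.If_cases)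
  finally show ?thesis
    unfolding v using npos by (simp add: field_simps power2_eq_square)
qed

text \<open>One fixed neighbour in each factor. Replacing coordinate \<open>j\<close> of
  \<open>v\<close> by it gives one neighbouring box for every marker \<open>j\<close>, so the number
  of disjoint boxes is linear in the number of markers.\<close>

definition nb :: "'i \<Rightarrow> 'a \<Rightarrow> 'a" where "nb j a = (SOME w. {a, w} \<in> edges (Gs j))"

lemma nb: "j \<in> T \<Longrightarrow> a \<in> verts (Gs j) \<Longrightarrow> {a, nb j a} \<in> edges (Gs j)"
  unfolding nb_def by (rule someI_ex) (rule k_ge)

lemma nb_V:
  assumes "j \<in> T" "v \<in> V"
  shows "v(j := nb j (v j)) \<in> V" "{v, v(j := nb j (v j))} \<in> E" "nb j (v j) \<noteq> v j"
proof -
  have e: "{v j, nb j (v j)} \<in> edges (Gs j)" using assms by (intro nb V_coord)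
  show "v(j := nb j (v j)) \<in> V" "nb j (v j) \<noteq> v j"
    using edge_verts[OF assms(1) e] assms by (auto intro: V_upd)
  show "{v, v(j := nb j (v j))} \<in> E"
    unfolding E_upd_iff[OF assms(2)] using e assms by (intro bexI[of _ j]) auto
qed

end

section \<open>Growing clusters in disjoint boxes\<close>

locale percolated_product = product_graph T Gs k C +
    layered "product_graph.V T Gs" "product_graph.E T Gs" \<Lambda> pr
  for T :: "'i set" and Gs :: "'i \<Rightarrow> 'a ugraph" and k C \<Lambda> pr
begin

text \<open>The empty set is removed because it is the only common member of \<open>Pow Y\<close>
  and \<open>Pow Y'\<close> for disjoint \<open>Y\<close> and \<open>Y'\<close>; without this,
  blocks of disjoint boxes would overlap.\<close>

definition blk :: "('i \<Rightarrow> 'a) set \<Rightarrow> nat set \<Rightarrow> (('i \<Rightarrow> 'a) set \<times> nat) set" where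
  "blk Y L = (Pow Y - {{}}) \<times> L"

lemma dep_expl:
  assumes "y \<in> Y"
  shows "dep_on (blk Y L) (\<lambda>\<omega>. expl (opn L \<omega>) {y} Y)"
proof (rule dep_onI)
  fix \<omega> \<omega>' :: "('i \<Rightarrow> 'a) set \<times> nat \<Rightarrow> bool" assume eq: "\<And>i. i \<in> blk Y L \<Longrightarrow> \<omega> i = \<omega>' i"
  show "expl (opn L \<omega>) {y} Y = expl (opn L \<omega>') {y} Y"
  proof (rule expl_cong)
    fix u v assume "u \<in> {y} \<union> Y" "v \<in> Y"
    then have "({u, v}, l) \<in> blk Y L" if "l \<in> L" for l using that assms by (auto simp: blk_def)
    then show "({u, v} \<in> opn L \<omega>) = ({u, v} \<in> opn L \<omega>')" using eq by (auto simp: opn_def)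
  qed
qed

lemma blk_disjoint: "Y \<inter> Y' = {} \<Longrightarrow> blk Y L \<inter> blk Y' L' = {}"
  by (auto simp: blk_def)

text \<open>The coordinate \<open>j\<close> is frozen in all these boxes, and only the box belonging
  to \<open>j\<close> has the changed value there.\<close>

lemma boxes_disjoint:
  assumes v: "v \<in> V" and J: "J \<subseteq> T" "K \<inter> J = {}"
  shows "j \<in> J \<Longrightarrow> j' \<in> J \<Longrightarrow> j \<noteq> j' \<Longrightarrow> box (v(j := nb j (v j))) K \<inter> box (v(j' := nb j' (v j'))) K = {}"
    and "j \<in> J \<Longrightarrow> box v K \<inter> box (v(j := nb j (v j))) K = {}"
proof -
  have n: "nb j (v j) \<noteq> v j" if "j \<in> J" for j using nb_V(3)[of j v] that v J by auto
  { fix y assume j: "j \<in> J" "j' \<in> J" "j \<noteq> j'"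
    assume y: "y \<in> box (v(j := nb j (v j))) K" "y \<in> box (v(j' := nb j' (v j'))) K"
    have "j \<in> T - K" using j J by auto
    then have "y j = (v(j := nb j (v j))) j" "y j = (v(j' := nb j' (v j'))) j" using y unfolding box_def by blast+
    then have False using n[OF j(1)] j(3) by simp }
  then show "j \<in> J \<Longrightarrow> j' \<in> J \<Longrightarrow> j \<noteq> j' \<Longrightarrow> box (v(j := nb j (v j))) K \<inter> box (v(j' := nb j' (v j'))) K = {}"
    by blast
  { fix y assume j: "j \<in> J" and y: "y \<in> box v K" "y \<in> box (v(j := nb j (v j))) K"
    have "j \<in> T - K" using j J by auto
    then have "y j = (v(j := nb j (v j))) j" "y j = v j" using y unfolding box_def by blast+
    then have False using n[OF j] by simp }
  then show "j \<in> J \<Longrightarrow> box v K \<inter> box (v(j := nb j (v j))) K = {}" by blast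
qed

lemma box_self: "x \<in> V \<Longrightarrow> x \<in> box x K" by (auto simp: box_def)

lemma box_sub: "box x K \<subseteq> V" by (auto simp: box_def)

lemma finite_box: "finite (box x K)" by (rule finite_subset[OF box_sub finite_V])

lemma box_mono: "K \<subseteq> K' \<Longrightarrow> box x K \<subseteq> box x K'" by (auto simp: box_def)

lemma box_upd_sub: "j \<in> I \<Longrightarrow> K \<subseteq> I \<Longrightarrow> box (x(j := a)) K \<subseteq> box x I" by (auto simp: box_def)

lemma cluster_box_lower:
  assumes "0 \<in> \<Lambda>" "0 \<le> \<theta>" "(1 - pr 0 * (1 - exp (- \<theta>))) ^ D \<le> exp (- \<theta>)"
    and "K \<subseteq> T" "D + m \<le> (\<Sum>j\<in>K. k j)" "y \<in> V" "y \<in> box x K"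
  shows "1 - exp (- \<theta>) \<le> prb M (\<lambda>\<omega>. m \<le> card (expl (opn {0} \<omega>) {y} (box x K)))"
proof (rule cluster_lower[where D = D])
  show "(1 - pL {0} * (1 - exp (- \<theta>))) ^ D \<le> exp (- \<theta>)" using assms(3) by (simp add: pL_def)
  fix v assume "v \<in> box x K"
  then show "D + m \<le> card {u \<in> box x K. {v, u} \<in> E}"
    using card_nbrs_box[OF assms(4), of v x] assms(5) by simp
qed (use assms box_sub in auto)

text \<open>A cluster with at least \<open>m\<close> vertices in layer 0 of the box with the coordinates \<open>J\<close> frozen sends
  a layer 1 edge into each of the \<open>card J\<close> neighbouring boxes with constant probability, and there it
  meets another cluster of size \<open>m\<close> with probability \<open>\<rho>\<close>.\<close>

lemma growth:
  assumes \<Lambda>: "{0, 1} \<subseteq> \<Lambda>" and \<theta>: "0 \<le> \<theta>" and key: "(1 - pr 0 * (1 - exp (- \<theta>))) ^ D \<le> exp (- \<theta>)"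
    and J: "J \<subseteq> I" and I: "I \<subseteq> T" and D: "D + m \<le> (\<Sum>j\<in>I - J. k j)" and x: "x \<in> V"
  defines "\<rho> \<equiv> 1 - exp (- \<theta>)"
  defines "q \<equiv> \<rho> * (1 - exp (- (pr 1 / 2) * real m))"
  shows "\<rho> - exp (z - q / 2 * real (card J)) \<le>
    prb M (\<lambda>\<omega>. z * real m \<le> real (card (expl (opn {0, 1} \<omega>) {x} (box x I))))"
proof -
  define b0 where "b0 = box x (I - J)"
  define b where "b = (\<lambda>j. box (x(j := nb j (x j))) (I - J))"
  define up where "up = (\<lambda>j y. y(j := nb j (x j)))"
  \<comment> \<open>The set \<open>K\<close> is a parameter, so that the success of box
    \<open>j\<close> can be analysed for a fixed set before the random seed cluster
    \<open>K0\<close> is inserted.\<close>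
  define sc where "sc = (\<lambda>K j \<omega>. \<exists>y\<in>K. \<omega> ({y, up j y}, 1) \<and> m \<le> card (expl (opn {0} \<omega>) {up j y} (b j)))"
  define K0 where "K0 = (\<lambda>\<omega>. expl (opn {0} \<omega>) {x} b0)"
  \<comment> \<open>The coordinates read by \<open>sc K j\<close> for
    \<open>K \<subseteq> b0\<close>: layer 0 inside box \<open>j\<close> and the layer 1 matching
    from \<open>b0\<close> into that box. For different \<open>j\<close> they are disjoint.\<close>
  define Bl where "Bl = (\<lambda>j. blk (b j) {0} \<union> {({y, up j y}, 1) |y. y \<in> b0})"
  have JT: "J \<subseteq> T" and disj: "(I - J) \<inter> J = {}" using J I by auto
  have finJ: "finite J" using JT finT finite_subset by auto
  have finb0: "finite b0" unfolding b0_def by (rule finite_box)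
  have \<rho>0: "0 \<le> \<rho>" using \<theta> by (simp add: \<rho>_def)
  have xb0: "x \<in> b0" using x by (simp add: b0_def box_self)
  have K0sub: "K0 \<omega> \<subseteq> b0" for \<omega> using expl_sub[of "opn {0} \<omega>" "{x}" b0] xb0 by (auto simp: K0_def)
  have dj1: "b j \<inter> b j' = {}" if "j \<in> J" "j' \<in> J" "j \<noteq> j'" for j j'
    unfolding b_def by (rule boxes_disjoint(1)[OF x JT disj that])
  have dj0: "b0 \<inter> b j = {}" if "j \<in> J" for j
    unfolding b_def b0_def by (rule boxes_disjoint(2)[OF x JT disj that])
  have up: "up j y \<in> b j" "{y, up j y} \<in> E" "up j y \<in> V" if "y \<in> b0" "j \<in> J" for j y
  proof -
    have yV: "y \<in> V" and jT: "j \<in> T" using that JT by (auto simp: b0_def box_def)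
    have "y j = x j" using that JT by (auto simp: b0_def box_def)
    then have u: "up j y = y(j := nb j (y j))" by (simp add: up_def)
    show "{y, up j y} \<in> E" "up j y \<in> V" unfolding u using nb_V[OF jT yV] by auto
    then show "up j y \<in> b j" using that(1) unfolding b_def b0_def box_def by (auto simp: up_def)
  qed
  have dep: "dep_on (Bl j) (sc K j)" if "j \<in> J" "K \<subseteq> b0" for j K
  proof (rule dep_onI)
    fix \<omega> \<omega>' :: "('i \<Rightarrow> 'a) set \<times> nat \<Rightarrow> bool" assume eq: "\<And>i. i \<in> Bl j \<Longrightarrow> \<omega> i = \<omega>' i"
    have "\<omega> ({y, up j y}, 1) = \<omega>' ({y, up j y}, 1)" if "y \<in> K" for y
      using \<open>K \<subseteq> b0\<close> that by (intro eq) (auto simp: Bl_def)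
    moreover have "expl (opn {0} \<omega>) {up j y} (b j) = expl (opn {0} \<omega>') {up j y} (b j)" if "y \<in> K" for y
      by (rule dep_onD[OF dep_expl]) (use \<open>K \<subseteq> b0\<close> that up(1)[of y j] \<open>j \<in> J\<close> eq in \<open>auto simp: Bl_def\<close>)
    ultimately show "sc K j \<omega> = sc K j \<omega>'" unfolding sc_def by (intro bex_cong refl) simp
  qed
  have Bdisj: "Bl j \<inter> Bl j' = {}" if jj: "j \<in> J" "j' \<in> J" "j \<noteq> j'" for j j'
  proof -
    have "{y, up j y} \<noteq> {y', up j' y'}" if y: "y \<in> b0" "y' \<in> b0" for y y'
    proof
      assume "{y, up j y} = {y', up j' y'}"
      then have "y = up j' y' \<or> up j y = up j' y'" by (auto simp: doubleton_eq_iff)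
      moreover have "up j y \<in> b j" "up j' y' \<in> b j'" using up(1)[OF y(1) jj(1)] up(1)[OF y(2) jj(2)] by auto
      ultimately show False using dj1[OF jj] dj0[OF jj(2)] y by auto
    qed
    then show ?thesis using blk_disjoint[OF dj1[OF jj], of "{0}" "{0}"] unfolding Bl_def blk_def by auto
  qed
  have q: "q \<le> prb M (sc K j)" if j: "j \<in> J" and K: "K \<subseteq> b0" "m \<le> card K" for K j
  proof -
    \<comment> \<open>Layer 1 is revealed first. If a matching edge is open at some
      \<open>y \<in> K\<close>, the fresh layer 0 gives its other end a cluster of size
      \<open>m\<close> with probability at least \<rho>.\<close>
    let ?B = "UNIV \<times> {0::nat}"
    have finK: "finite K" using K finb0 finite_subset by auto
    have "\<rho> * prb M (\<lambda>\<omega>. \<exists>y\<in>K. \<omega> ({y, up j y}, 1)) \<le> mean M (\<lambda>\<omega>. prb M (\<lambda>\<omega>'. sc K j (override_on \<omega> \<omega>' ?B)))"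
      unfolding prb_def[of M "\<lambda>\<omega>. \<exists>y\<in>K. \<omega> ({y, up j y}, 1)"] mean_cmult[symmetric]
    proof (rule mean_mono)
      fix \<omega>
      show "\<rho> * of_bool (\<exists>y\<in>K. \<omega> ({y, up j y}, 1)) \<le> prb M (\<lambda>\<omega>'. sc K j (override_on \<omega> \<omega>' ?B))"
      proof (cases "\<exists>y\<in>K. \<omega> ({y, up j y}, 1)")
        case True
        then obtain y where y: "y \<in> K" "\<omega> ({y, up j y}, 1)" by blast
        have yb: "y \<in> b0" using y K by auto
        have "\<rho> \<le> prb M (\<lambda>\<omega>'. m \<le> card (expl (opn {0} \<omega>') {up j y} (b j)))"
          unfolding \<rho>_def b_def
          by (rule cluster_box_lower[OF _ \<theta> key _ D]) (use \<Lambda> I up[OF yb j] in \<open>auto simp: b_def\<close>)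
        also have "\<dots> \<le> prb M (\<lambda>\<omega>'. sc K j (override_on \<omega> \<omega>' ?B))"
        proof (rule prb_mono)
          fix \<omega>' assume m: "m \<le> card (expl (opn {0} \<omega>') {up j y} (b j))"
          have "opn {0} (override_on \<omega> \<omega>' ?B) = opn {0} \<omega>'" by (auto simp: opn_def)
          then show "sc K j (override_on \<omega> \<omega>' ?B)"
            unfolding sc_def using m y by (intro bexI[of _ y]) auto
        qed
        finally show ?thesis using True by simp
      qed (use prb_nonneg in auto)
    qed
    also have "\<dots> = prb M (sc K j)" by (rule prb_resample[symmetric])
    finally have 1: "\<rho> * prb M (\<lambda>\<omega>. \<exists>y\<in>K. \<omega> ({y, up j y}, 1)) \<le> prb M (sc K j)" .
    have "prb M (\<lambda>\<omega>. \<not> (\<exists>y\<in>K. \<omega> ({y, up j y}, 1))) \<le> prb M (\<lambda>\<omega>. real (card {y\<in>K. \<omega> ({y, up j y}, 1)}) \<le> 0)"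
    proof (rule prb_mono)
      fix \<omega> :: "('i \<Rightarrow> 'a) set \<times> nat \<Rightarrow> bool"
      assume "\<not> (\<exists>y\<in>K. \<omega> ({y, up j y}, 1))"
      then have "{y\<in>K. \<omega> ({y, up j y}, 1)} = {}" by blast
      then show "real (card {y\<in>K. \<omega> ({y, up j y}, 1)}) \<le> 0" by (metis card.empty of_nat_0 order_refl)
    qed
    also have "\<dots> \<le> exp (0 - pr 1 / 2 * real (card K))"
    proof (rule count_indep_le[where B = "\<lambda>y. {({y, up j y}, 1)}"])
      show "{({y, up j y}, 1)} \<inter> {({y', up j y'}, 1)} = {}" if "y \<in> K" "y' \<in> K" "y \<noteq> y'" for y y'
        using that K up(1)[of y j] up(1)[of y' j] dj0[OF j] j by (auto simp: doubleton_eq_iff)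
      show "pr 1 \<le> prb M (\<lambda>\<omega>. \<omega> ({y, up j y}, 1))" if "y \<in> K" for y
        using prb_coord[of "{y, up j y}" 1] up(2)[of y j] j that K \<Lambda> by auto
    qed (use finK in \<open>auto intro!: dep_onI\<close>)
    also have "\<dots> \<le> exp (- (pr 1 / 2) * real m)"
      using K pr[of 1] by (auto intro!: mult_left_mono)
    finally have "1 - exp (- (pr 1 / 2) * real m) \<le> prb M (\<lambda>\<omega>. \<exists>y\<in>K. \<omega> ({y, up j y}, 1))"
      unfolding prb_not[OF finM] by simp
    then have "q \<le> \<rho> * prb M (\<lambda>\<omega>. \<exists>y\<in>K. \<omega> ({y, up j y}, 1))"
      unfolding q_def using \<rho>0 by (intro mult_left_mono)
    with 1 show ?thesis by linarith
  qed
  have "prb M (\<lambda>\<omega>. \<not> (z * real m \<le> real (card (expl (opn {0, 1} \<omega>) {x} (box x I)))))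
     \<le> prb M (\<lambda>\<omega>. \<not> m \<le> card (K0 \<omega>) \<or> (m \<le> card (K0 \<omega>) \<and> real (card {j\<in>J. sc (K0 \<omega>) j \<omega>}) \<le> z))"
  proof (rule prb_mono)
    fix \<omega> assume neg: "\<not> (z * real m \<le> real (card (expl (opn {0, 1} \<omega>) {x} (box x I))))"
    let ?R = "expl (opn {0, 1} \<omega>) {x} (box x I)"
    show "\<not> m \<le> card (K0 \<omega>) \<or> (m \<le> card (K0 \<omega>) \<and> real (card {j\<in>J. sc (K0 \<omega>) j \<omega>}) \<le> z)"
    proof (rule ccontr)
      assume "\<not> ?thesis"
      then have gt: "z < real (card {j\<in>J. sc (K0 \<omega>) j \<omega>})" by auto
      let ?J = "{j\<in>J. sc (K0 \<omega>) j \<omega>}"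
      have "\<forall>j\<in>?J. \<exists>y. y \<in> K0 \<omega> \<and> \<omega> ({y, up j y}, 1) \<and> m \<le> card (expl (opn {0} \<omega>) {up j y} (b j))"
        unfolding sc_def by blast
      then obtain Y where Y: "\<And>j. j \<in> ?J \<Longrightarrow> Y j \<in> K0 \<omega> \<and> \<omega> ({Y j, up j (Y j)}, 1) \<and>
          m \<le> card (expl (opn {0} \<omega>) {up j (Y j)} (b j))" by metis
      let ?D = "\<lambda>j. expl (opn {0} \<omega>) {up j (Y j)} (b j)"
      have Dsub: "?D j \<subseteq> b j" if "j \<in> ?J" for j
        using expl_sub[of "opn {0} \<omega>" "{up j (Y j)}" "b j"] up(1)[of "Y j" j] Y[OF that] that K0sub by auto
      have DR: "?D j \<subseteq> ?R" if "j \<in> ?J" for j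
      proof -
        have Yb: "Y j \<in> b0" and jJ: "j \<in> J" using Y[OF that] K0sub that by auto
        have "K0 \<omega> \<subseteq> ?R" unfolding K0_def b0_def
          by (intro expl_mono opn_mono box_mono) auto
        then have YR: "Y j \<in> ?R" using Y[OF that] by auto
        have bsub: "b j \<subseteq> box x I" unfolding b_def using jJ J by (intro box_upd_sub) auto
        have "{Y j, up j (Y j)} \<in> opn {0, 1} \<omega>" using up(2)[OF Yb jJ] Y[OF that] by (auto simp: opn_def)
        then have "up j (Y j) \<in> ?R" using YR bsub up(1)[OF Yb jJ] by (auto intro: expl_step)
        moreover have "opn {0} \<omega> \<subseteq> opn {0, 1} \<omega>" by (rule opn_mono) auto
        ultimately show ?thesis using bsub by (intro expl_least) (auto intro: expl_step)
      qed
      have "z * real m \<le> real (card ?J) * real m" using gt by (intro mult_right_mono) auto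
      also have "\<dots> = (\<Sum>j\<in>?J. real m)" by simp
      also have "\<dots> \<le> (\<Sum>j\<in>?J. real (card (?D j)))" using Y by (intro sum_mono) auto
      also have "\<dots> = real (card (\<Union>j\<in>?J. ?D j))"
      proof (subst card_UN_disjoint)
        show "\<forall>j\<in>?J. finite (?D j)" by (auto intro!: finite_expl finite_box simp: b_def)
        show "\<forall>i\<in>?J. \<forall>j\<in>?J. i \<noteq> j \<longrightarrow> ?D i \<inter> ?D j = {}" using Dsub dj1 by fast
      qed (use finJ in auto)
      also have "\<dots> \<le> real (card ?R)"
        using DR by (intro of_nat_mono card_mono finite_expl finite_box) auto
      finally show False using neg by simp
    qed
  qed
  also have "\<dots> \<le> prb M (\<lambda>\<omega>. \<not> m \<le> card (K0 \<omega>)) + prb M (\<lambda>\<omega>. m \<le> card (K0 \<omega>) \<and> real (card {j\<in>J. sc (K0 \<omega>) j \<omega>}) \<le> z)"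
    by (rule prb_union)
  also have "prb M (\<lambda>\<omega>. \<not> m \<le> card (K0 \<omega>)) \<le> 1 - \<rho>"
  proof -
    have "\<rho> \<le> prb M (\<lambda>\<omega>. m \<le> card (K0 \<omega>))"
      unfolding \<rho>_def K0_def b0_def
      by (rule cluster_box_lower[OF _ \<theta> key _ D]) (use \<Lambda> I x in \<open>auto simp: box_self\<close>)
    then show ?thesis by (simp add: prb_not[OF finM])
  qed
  also have "prb M (\<lambda>\<omega>. m \<le> card (K0 \<omega>) \<and> real (card {j\<in>J. sc (K0 \<omega>) j \<omega>}) \<le> z) \<le> exp (z - q / 2 * real (card J))"
  proof -
    \<comment> \<open>Layer 0 inside \<open>b0\<close> is kept and everything else resampled:
      \<open>K0\<close> becomes a fixed set, and the successes of the boxes do not depend on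
      it.\<close>
    let ?B = "- blk b0 {0}"
    have "prb M (\<lambda>\<omega>. m \<le> card (K0 \<omega>) \<and> real (card {j\<in>J. sc (K0 \<omega>) j \<omega>}) \<le> z) =
      mean M (\<lambda>\<omega>. prb M (\<lambda>\<omega>'. m \<le> card (K0 (override_on \<omega> \<omega>' ?B)) \<and>
         real (card {j\<in>J. sc (K0 (override_on \<omega> \<omega>' ?B)) j (override_on \<omega> \<omega>' ?B)}) \<le> z))"
      by (rule prb_resample)
    also have "\<dots> \<le> exp (z - q / 2 * real (card J))"
    proof (rule mean_le[OF finM])
      fix \<omega>
      have K: "K0 (override_on \<omega> \<omega>' ?B) = K0 \<omega>" for \<omega>'
        unfolding K0_def by (rule dep_onD[OF dep_expl[OF xb0]]) auto
      have S: "sc (K0 \<omega>) j (override_on \<omega> \<omega>' ?B) = sc (K0 \<omega>) j \<omega>'" if "j \<in> J" for j \<omega>'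
      proof (rule dep_onD[OF dep[OF that K0sub]])
        fix i assume "i \<in> Bl j"
        then have "i \<notin> blk b0 {0}"
          using blk_disjoint[OF dj0[OF that], of "{0}" "{0}"] unfolding Bl_def by (auto simp: blk_def)
        then show "override_on \<omega> \<omega>' ?B i = \<omega>' i" by simp
      qed
      have Seq: "{j\<in>J. sc (K0 \<omega>) j (override_on \<omega> \<omega>' ?B)} = {j\<in>J. sc (K0 \<omega>) j \<omega>'}" for \<omega>'
        using S by (intro Collect_cong conj_cong refl) simp
      have "prb M (\<lambda>\<omega>'. m \<le> card (K0 (override_on \<omega> \<omega>' ?B)) \<and>
         real (card {j\<in>J. sc (K0 (override_on \<omega> \<omega>' ?B)) j (override_on \<omega> \<omega>' ?B)}) \<le> z) =
         prb M (\<lambda>\<omega>'. m \<le> card (K0 \<omega>) \<and> real (card {j\<in>J. sc (K0 \<omega>) j \<omega>'}) \<le> z)"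
        unfolding K Seq ..
      also have "\<dots> \<le> exp (z - q / 2 * real (card J))"
      proof (cases "m \<le> card (K0 \<omega>)")
        case True
        then show ?thesis
          using count_indep_le[where B = Bl, OF finJ dep[OF _ K0sub] Bdisj q[OF _ K0sub True], of z] by simp
      qed (simp add: prb_def mean_const finM)
      finally show "prb M (\<lambda>\<omega>'. m \<le> card (K0 (override_on \<omega> \<omega>' ?B)) \<and>
         real (card {j\<in>J. sc (K0 (override_on \<omega> \<omega>' ?B)) j (override_on \<omega> \<omega>' ?B)}) \<le> z) \<le> exp (z - q / 2 * real (card J))" .
    qed
    finally show ?thesis .
  qed
  finally show ?thesis unfolding prb_not[OF finM] by simp
qed

text \<open>Changing one marker coordinate of \<open>v\<close> gives \<open>card J\<close>
  neighbours lying in disjoint boxes. Their clusters inside these boxes are independent, and only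
  such clusters are counted, so the lower tail of \<open>count_indep_le\<close> applies.\<close>

lemma many_neighbours:
  assumes L: "L \<subseteq> \<Lambda>" and J: "J \<subseteq> T" and v: "v \<in> V"
    and r: "\<And>x. x \<in> V \<Longrightarrow> r \<le> prb M (\<lambda>\<omega>. h \<le> card (expl (opn L \<omega>) {x} (box x (T - J))))"
  shows "prb M (\<lambda>\<omega>. real (card {u \<in> V. {v, u} \<in> E \<and> u \<in> big h (opn L \<omega>)}) \<le> z) \<le> exp (z - r / 2 * real (card J))"
proof -
  let ?u = "\<lambda>j. v(j := nb j (v j))"
  have uV: "?u j \<in> V" "{v, ?u j} \<in> E" if "j \<in> J" for j using nb_V[of j v] that v J by auto
  have finJ: "finite J" using J finT finite_subset by auto
  let ?ev = "\<lambda>j \<omega>. h \<le> card (expl (opn L \<omega>) {?u j} (box (?u j) (T - J)))"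
  have "prb M (\<lambda>\<omega>. real (card {u \<in> V. {v, u} \<in> E \<and> u \<in> big h (opn L \<omega>)}) \<le> z) \<le>
     prb M (\<lambda>\<omega>. real (card {j \<in> J. ?ev j \<omega>}) \<le> z)"
  proof (rule prb_mono)
    fix \<omega> assume z: "real (card {u \<in> V. {v, u} \<in> E \<and> u \<in> big h (opn L \<omega>)}) \<le> z"
    have "inj_on ?u J"
    proof (rule inj_onI, rule ccontr)
      fix i j assume "i \<in> J" "j \<in> J" "?u i = ?u j" "i \<noteq> j"
      then have "nb i (v i) = v i" by (metis fun_upd_other fun_upd_same)
      then show False using nb_V(3)[of i v] \<open>i \<in> J\<close> J v by auto
    qed
    then have "card {j \<in> J. ?ev j \<omega>} = card (?u ` {j \<in> J. ?ev j \<omega>})"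
      by (intro card_image[symmetric]) (auto simp: inj_on_def)
    also have "\<dots> \<le> card {u \<in> V. {v, u} \<in> E \<and> u \<in> big h (opn L \<omega>)}"
    proof (rule card_mono)
      show "?u ` {j \<in> J. ?ev j \<omega>} \<subseteq> {u \<in> V. {v, u} \<in> E \<and> u \<in> big h (opn L \<omega>)}"
      proof safe
        fix j assume j: "j \<in> J" "?ev j \<omega>"
        show "?u j \<in> V" "{v, ?u j} \<in> E" using uV j by auto
        have "card (expl (opn L \<omega>) {?u j} (box (?u j) (T - J))) \<le> card (expl (opn L \<omega>) {?u j} V)"
          by (intro card_mono finite_expl finite_V expl_mono box_sub) auto
        then show "?u j \<in> big h (opn L \<omega>)" using j uV by (auto simp: big_def)
      qed
    qed (use finite_V in auto)
    finally show "real (card {j \<in> J. ?ev j \<omega>}) \<le> z" using z by linarith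
  qed
  also have "\<dots> \<le> exp (z - r / 2 * real (card J))"
  proof (rule count_indep_le[where B = "\<lambda>j. blk (box (?u j) (T - J)) L"])
    show "dep_on (blk (box (?u j) (T - J)) L) (?ev j)" if "j \<in> J" for j
      by (rule dep_on_comp[OF dep_expl]) (rule box_self[OF uV(1)[OF that]])
    show "blk (box (?u j) (T - J)) L \<inter> blk (box (?u j') (T - J)) L = {}" if "j \<in> J" "j' \<in> J" "j \<noteq> j'" for j j'
      by (intro blk_disjoint boxes_disjoint(1)[OF v J _ that]) auto
    show "r \<le> prb M (?ev j)" if "j \<in> J" for j using uV that by (intro r) auto
  qed (use finJ in auto)
  finally show ?thesis .
qed

lemma card_touching:
  assumes "X \<subseteq> V"
  shows "card {e \<in> E. e \<inter> X \<noteq> {}} \<le> card X * deg"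
proof -
  have finX: "finite X" using assms finite_V finite_subset by auto
  have "{e \<in> E. e \<inter> X \<noteq> {}} \<subseteq> (\<lambda>(u, v). {u, v}) ` (SIGMA u:X. {v \<in> V. {u, v} \<in> E})"
  proof
    fix e assume e: "e \<in> {e \<in> E. e \<inter> X \<noteq> {}}"
    then obtain u v where uv: "e = {u, v}" "u \<in> X" using E_simple[of e] unfolding card_2_iff by blast
    then have "v \<in> V" using E_simple[of e] e by auto
    with e uv show "e \<in> (\<lambda>(u, v). {u, v}) ` (SIGMA u:X. {v \<in> V. {u, v} \<in> E})"
      by (intro image_eqI[of _ _ "(u, v)"]) auto
  qed
  moreover have fin: "finite (SIGMA u:X. {v \<in> V. {u, v} \<in> E})"
    using finX finite_V by auto
  ultimately have "card {e \<in> E. e \<inter> X \<noteq> {}} \<le> card ((\<lambda>(u, v). {u, v}) ` (SIGMA u:X. {v \<in> V. {u, v} \<in> E}))"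
    by (intro card_mono finite_imageI)
  also have "\<dots> \<le> card (SIGMA u:X. {v \<in> V. {u, v} \<in> E})"
    using fin by (rule card_image_le)
  also have "\<dots> = (\<Sum>u\<in>X. card {v \<in> V. {u, v} \<in> E})"
    using finX finite_V by (simp add: card_SigmaI)
  also have "\<dots> = card X * deg"
    using assms card_nbrs by (simp add: subset_iff)
  finally show ?thesis .
qed

text \<open>Exponential Markov inequality for the upper tail: an open edge contributes the factor 1
  + (e - 1) \<open>pL L\<close>, at most exp (2 \<open>pL L\<close>), and at most
  \<open>card X * deg\<close> edges meet \<open>X\<close>.\<close>

lemma prb_touching:
  assumes L: "L \<subseteq> \<Lambda>" and X: "X \<subseteq> V"
  shows "prb M (\<lambda>\<omega>. z \<le> real (card {e \<in> opn L \<omega>. e \<inter> X \<noteq> {}})) \<le> exp (2 * pL L * real (card X * deg) - z)"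
proof -
  let ?J = "{e \<in> E. e \<inter> X \<noteq> {}}"
  have finJ: "finite ?J" using finE by auto
  have c: "real (card {e \<in> opn L \<omega>. e \<inter> X \<noteq> {}}) = (\<Sum>e\<in>?J. of_bool (e \<in> opn L \<omega>))" for \<omega>
  proof -
    have "{e \<in> opn L \<omega>. e \<inter> X \<noteq> {}} = ?J \<inter> {e. e \<in> opn L \<omega>}" using opn_sub by auto
    then show ?thesis using finJ by (simp add: of_bool_def sum.If_cases)
  qed
  have "prb M (\<lambda>\<omega>. z \<le> real (card {e \<in> opn L \<omega>. e \<inter> X \<noteq> {}})) \<le>
      mean M (\<lambda>\<omega>. exp (- z) * exp (real (card {e \<in> opn L \<omega>. e \<inter> X \<noteq> {}})))"
    unfolding prb_def by (intro mean_mono) (auto simp flip: exp_add)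
  also have "\<dots> = exp (- z) * mean M (\<lambda>\<omega>. \<Prod>e\<in>?J. exp (of_bool (e \<in> opn L \<omega>)))"
    unfolding c mean_cmult by (simp only: exp_sum[OF finJ])
  also have "mean M (\<lambda>\<omega>. \<Prod>e\<in>?J. exp (of_bool (e \<in> opn L \<omega>))) = (\<Prod>e\<in>?J. mean M (\<lambda>\<omega>. exp (of_bool (e \<in> opn L \<omega>))))"
  proof (rule mean_prod_blocks[where B = "\<lambda>e. {e} \<times> L"])
    show "dep_on ({e} \<times> L) (\<lambda>\<omega>. exp (of_bool (e \<in> opn L \<omega>)) :: real)" for e
      by (rule dep_on_comp[OF dep_opn])
  qed (use finJ in auto)
  also have "\<dots> \<le> (\<Prod>e\<in>?J. exp (2 * pL L))"
  proof (intro prod_mono conjI)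
    fix e assume e: "e \<in> ?J"
    show "0 \<le> mean M (\<lambda>\<omega>. exp (of_bool (e \<in> opn L \<omega>)))" by (rule mean_nonneg) simp
    have "mean M (\<lambda>\<omega>. exp (of_bool (e \<in> opn L \<omega>))) = mean M (\<lambda>\<omega>. 1 + (exp 1 - 1) * of_bool (e \<in> opn L \<omega>))"
      by (intro mean_cong) auto
    also have "\<dots> = 1 + (exp 1 - 1) * pL L"
      using e L by (simp add: mean_add mean_cmult mean_const[OF finM] prb_opn flip: prb_def)
    also have "\<dots> \<le> 1 + 2 * pL L"
      using exp_le pL_bounds[OF L] by (intro add_left_mono mult_right_mono) auto
    also have "\<dots> \<le> exp (2 * pL L)" by (rule exp_ge_add_one_self)
    finally show "mean M (\<lambda>\<omega>. exp (of_bool (e \<in> opn L \<omega>))) \<le> exp (2 * pL L)" .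
  qed
  also have "\<dots> = exp (real (card ?J) * (2 * pL L))"
    by (simp add: exp_of_nat_mult)
  also have "\<dots> \<le> exp (real (card X * deg) * (2 * pL L))"
    using card_touching[OF X] pL_bounds[OF L] by (auto intro!: mult_right_mono simp del: of_nat_mult)
  finally show ?thesis by (simp add: algebra_simps flip: exp_add)
qed

end

text \<open>Give a subset \<open>X\<close> the weight a^|X|: every counted set weighs at least a^m,
  while all subsets together weigh (1 + a)^|A|.\<close>

lemma card_small_subsets:
  assumes "finite A" "0 < a" "a \<le> 1" "0 \<le> m"
  shows "real (card {X. X \<subseteq> A \<and> real (card X) \<le> m}) \<le> exp (a * real (card A) + m * ln (1 / a))"
proof -
  let ?F = "{X. X \<subseteq> A \<and> real (card X) \<le> m}"
  have finF: "finite ?F" by (rule finite_subset[of _ "Pow A"]) (use assms in auto)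
  have "real (card ?F) * a powr m = (\<Sum>X\<in>?F. a powr m)" by simp
  also have "\<dots> \<le> (\<Sum>X\<in>?F. a ^ card X)"
  proof (rule sum_mono)
    fix X assume "X \<in> ?F"
    then have "a powr m \<le> a powr real (card X)" using assms by (intro powr_mono') auto
    then show "a powr m \<le> a ^ card X" using assms by (simp add: powr_realpow)
  qed
  also have "\<dots> \<le> (\<Sum>X\<in>Pow A. a ^ card X)"
    using assms by (intro sum_mono2) auto
  also have "\<dots> = (1 + a) ^ card A" using prod_add[of A "\<lambda>_. a" "\<lambda>_. 1"] assms(1) by (simp add: add.commute)
  also have "\<dots> \<le> exp a ^ card A"
    using assms exp_ge_add_one_self[of a] by (intro power_mono) auto
  also have "\<dots> = exp (a * real (card A))" by (simp add: exp_of_nat2_mult)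
  finally have "real (card ?F) \<le> exp (a * real (card A)) * a powr (- m)"
    using assms by (simp add: powr_minus field_simps)
  also have "a powr (- m) = exp (m * ln (1 / a))"
    using assms by (simp add: powr_def ln_div)
  finally show ?thesis by (simp add: exp_add)
qed

section \<open>Sprinkling across a cut\<close>

context percolated_product
begin

text \<open>One end of a sprinkled path: either \<open>v\<close> already lies in the given side or a
  single edge of layer \<open>l\<close> leads there.\<close>

definition att :: "('i \<Rightarrow> 'a) set \<Rightarrow> nat \<Rightarrow> ('i \<Rightarrow> 'a) \<Rightarrow> (('i \<Rightarrow> 'a) set \<times> nat \<Rightarrow> bool) \<Rightarrow> bool" where
  "att A l v \<omega> \<longleftrightarrow> v \<in> A \<or> (\<exists>a\<in>A. {v, a} \<in> E \<and> \<omega> ({v, a}, l))"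

text \<open>Empty for \<open>v \<in> A\<close>, where attachment is certain. For
  \<open>v \<notin> A\<close> the pair \<open>{v, a}\<close> determines \<open>v\<close>, as its
  other element is in \<open>A\<close>; so blocks of different vertices never overlap.\<close>

definition attblk :: "('i \<Rightarrow> 'a) set \<Rightarrow> nat \<Rightarrow> ('i \<Rightarrow> 'a) \<Rightarrow> (('i \<Rightarrow> 'a) set \<times> nat) set" where
  "attblk A l v = (if v \<in> A then {} else {({v, a}, l) |a. a \<in> A})"

lemma dep_att: "dep_on (attblk A l v) (att A l v)"
proof (rule dep_onI)
  fix \<omega> \<omega>' :: "('i \<Rightarrow> 'a) set \<times> nat \<Rightarrow> bool" assume eq: "\<And>i. i \<in> attblk A l v \<Longrightarrow> \<omega> i = \<omega>' i"
  show "att A l v \<omega> = att A l v \<omega>'"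
  proof (cases "v \<in> A")
    case False
    then have "\<omega> ({v, a}, l) = \<omega>' ({v, a}, l)" if "a \<in> A" for a using that by (intro eq) (auto simp: attblk_def)
    then show ?thesis by (auto simp: att_def)
  qed (simp add: att_def)
qed

lemma attblk_disjoint: "v \<noteq> v' \<Longrightarrow> attblk A l v \<inter> attblk A l v' = {}"
  by (auto simp: attblk_def doubleton_eq_iff)

lemma attblk_layers: "l \<noteq> l' \<Longrightarrow> attblk A l v \<inter> attblk B l' v' = {}"
  by (auto simp: attblk_def)

lemma prb_att:
  assumes "l \<in> \<Lambda>" "A \<subseteq> V" "h \<le> card {a \<in> A. {v, a} \<in> E}"
  shows "1 - exp (- (pr l / 2) * real h) \<le> prb M (att A l v)"
proof (cases "v \<in> A")
  case True
  then have "prb M (att A l v) = 1" by (simp add: att_def prb_def mean_const finM)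
  then show ?thesis by simp
next
  case False
  let ?J = "{a \<in> A. {v, a} \<in> E}"
  have finJ: "finite ?J" by (rule finite_subset[OF _ finite_V]) (use assms(2) in auto)
  have "prb M (\<lambda>\<omega>. \<not> att A l v \<omega>) \<le> prb M (\<lambda>\<omega>. real (card {a\<in>?J. \<omega> ({v, a}, l)}) \<le> 0)"
  proof (rule prb_mono)
    fix \<omega> assume "\<not> att A l v \<omega>"
    then have "{a\<in>?J. \<omega> ({v, a}, l)} = {}" unfolding att_def by blast
    then show "real (card {a\<in>?J. \<omega> ({v, a}, l)}) \<le> 0" by (metis card.empty of_nat_0 order_refl)
  qed
  also have "\<dots> \<le> exp (0 - pr l / 2 * real (card ?J))"
  proof (rule count_indep_le[where B = "\<lambda>a. {({v, a}, l)}"])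
    show "{({v, a}, l)} \<inter> {({v, a'}, l)} = {}" if "a \<in> ?J" "a' \<in> ?J" "a \<noteq> a'" for a a'
      using that by (auto simp: doubleton_eq_iff)
    show "pr l \<le> prb M (\<lambda>\<omega>. \<omega> ({v, a}, l))" if "a \<in> ?J" for a
      using prb_coord[of "{v, a}" l] assms(1) that by auto
  qed (use finJ in \<open>auto intro!: dep_onI\<close>)
  also have "\<dots> \<le> exp (- (pr l / 2) * real h)"
    using assms(3) pr[of l] by (auto intro!: mult_left_mono)
  finally show ?thesis by (simp add: prb_not[OF finM])
qed

text \<open>This treats bridges of two sprinkled edges through \<open>v\<close>. Its two attachments
  read different layers, hence the square of \<open>q\<close>, and different vertices read disjoint
  blocks.\<close>

lemma prb_both_att:
  assumes l: "l \<in> \<Lambda>" "l' \<in> \<Lambda>" "l \<noteq> l'" and AB: "A \<subseteq> V" "B \<subseteq> V" and Z: "Z \<subseteq> V"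
    and hA: "\<And>v. v \<in> Z \<Longrightarrow> h \<le> card {a \<in> A. {v, a} \<in> E}"
    and hB: "\<And>v. v \<in> Z \<Longrightarrow> h \<le> card {b \<in> B. {v, b} \<in> E}"
    and s: "pr l = s" "pr l' = s"
  defines "q \<equiv> 1 - exp (- (s / 2) * real h)"
  shows "prb M (\<lambda>\<omega>. \<forall>v\<in>Z. \<not> (att A l v \<omega> \<and> att B l' v \<omega>)) \<le> exp (- (q\<^sup>2 / 2) * real (card Z))"
proof -
  have q0: "0 \<le> q" using pr[of l] s by (simp add: q_def)
  have "prb M (\<lambda>\<omega>. \<forall>v\<in>Z. \<not> (att A l v \<omega> \<and> att B l' v \<omega>)) \<le>
      prb M (\<lambda>\<omega>. real (card {v\<in>Z. att A l v \<omega> \<and> att B l' v \<omega>}) \<le> 0)"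
  proof (rule prb_mono)
    fix \<omega> assume "\<forall>v\<in>Z. \<not> (att A l v \<omega> \<and> att B l' v \<omega>)"
    then have "{v\<in>Z. att A l v \<omega> \<and> att B l' v \<omega>} = {}" by blast
    then show "real (card {v\<in>Z. att A l v \<omega> \<and> att B l' v \<omega>}) \<le> 0" by (metis card.empty of_nat_0 order_refl)
  qed
  also have "\<dots> \<le> exp (0 - q\<^sup>2 / 2 * real (card Z))"
  proof (rule count_indep_le[where B = "\<lambda>v. attblk A l v \<union> attblk B l' v"])
    fix v assume v: "v \<in> Z"
    show "dep_on (attblk A l v \<union> attblk B l' v) (\<lambda>\<omega>. att A l v \<omega> \<and> att B l' v \<omega>)"
      using dep_att[of A l v] dep_att[of B l' v] unfolding dep_on_def by blast
    have "prb M (\<lambda>\<omega>. att A l v \<omega> \<and> att B l' v \<omega>) = prb M (att A l v) * prb M (att B l' v)"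
      unfolding prb_def of_bool_conj
      by (rule mean_indep[OF dep_on_comp[OF dep_att] dep_on_comp[OF dep_att] attblk_layers[OF l(3)]])
    moreover have "q * q \<le> prb M (att A l v) * prb M (att B l' v)"
      using prb_att[OF l(1) AB(1) hA[OF v]] prb_att[OF l(2) AB(2) hB[OF v]] q0 s
      by (intro mult_mono) (auto simp: q_def prb_nonneg)
    ultimately show "q\<^sup>2 \<le> prb M (\<lambda>\<omega>. att A l v \<omega> \<and> att B l' v \<omega>)" by (simp add: power2_eq_square)
  next
    fix v v' :: "'i \<Rightarrow> 'a" assume "v \<noteq> v'"
    then show "(attblk A l v \<union> attblk B l' v) \<inter> (attblk A l v' \<union> attblk B l' v') = {}"
      using attblk_disjoint attblk_layers[of l l'] attblk_layers[of l' l] l(3) by blast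
  qed (use Z finite_V finite_subset in auto)
  finally show ?thesis by simp
qed

text \<open>Layer \<open>l3\<close> is averaged out first, then \<open>l1\<close>, then \<open>l2\<close>; each time the exponent is a weighted
  sum of independent indicators to which \<open>exp_indep_le\<close> applies.\<close>

lemma prb_three_path:
  assumes l: "l1 \<in> \<Lambda>" "l2 \<in> \<Lambda>" "l3 \<in> \<Lambda>" "l1 \<noteq> l2" "l1 \<noteq> l3" "l2 \<noteq> l3" and AB: "A \<subseteq> V" "B \<subseteq> V"
    and Z: "Z \<subseteq> V" "Z' \<subseteq> V" "Z \<inter> Z' = {}"
    and hA: "\<And>v. v \<in> Z \<Longrightarrow> h \<le> card {a \<in> A. {v, a} \<in> E}"
    and hB: "\<And>v. v \<in> Z' \<Longrightarrow> h \<le> card {b \<in> B. {v, b} \<in> E}"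
    and s: "pr l1 = s" "pr l2 = s" "pr l3 = s" "s * real deg \<le> 1"
  defines "q \<equiv> 1 - exp (- (s / 2) * real h)"
  shows "prb M (\<lambda>\<omega>. \<forall>u\<in>Z. \<forall>w\<in>Z'. {u, w} \<in> E \<and> att A l1 u \<omega> \<and> att B l2 w \<omega> \<longrightarrow> \<not> \<omega> ({u, w}, l3))
    \<le> exp (- (q\<^sup>2 * s / 8) * (\<Sum>u\<in>Z. real (card {w \<in> Z'. {u, w} \<in> E})))"
proof -
  have s0: "0 \<le> s" using pr[of l1] s by simp
  have q0: "0 \<le> q" "q \<le> 1" using s0 by (simp_all add: q_def)
  have finZ: "finite Z" "finite Z'" using finite_subset[OF Z(1) finite_V] finite_subset[OF Z(2) finite_V] by auto
  define Pr where "Pr = (\<lambda>\<omega>. {(u, w) \<in> Z \<times> Z'. {u, w} \<in> E \<and> att A l1 u \<omega> \<and> att B l2 w \<omega>})"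
  define Wt where "Wt = (\<lambda>\<omega> u. real (card {w \<in> Z'. {u, w} \<in> E \<and> att B l2 w \<omega>}))"
  define Wt' where "Wt' = (\<lambda>w. real (card {u \<in> Z. {u, w} \<in> E}))"
  have finPr: "finite (Pr \<omega>)" for \<omega>
    by (rule finite_subset[of _ "Z \<times> Z'"]) (use finZ in \<open>auto simp: Pr_def\<close>)
  have att3: "att A l1 u (override_on \<omega> \<omega>' (UNIV \<times> {l3})) = att A l1 u \<omega>"
    "att B l2 u (override_on \<omega> \<omega>' (UNIV \<times> {l3})) = att B l2 u \<omega>" for u \<omega> \<omega>'
    using l by (auto simp: att_def)
  have "prb M (\<lambda>\<omega>. \<forall>u\<in>Z. \<forall>w\<in>Z'. {u, w} \<in> E \<and> att A l1 u \<omega> \<and> att B l2 w \<omega> \<longrightarrow> \<not> \<omega> ({u, w}, l3))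
     = mean M (\<lambda>\<omega>. prb M (\<lambda>\<omega>'. \<forall>u\<in>Z. \<forall>w\<in>Z'. {u, w} \<in> E \<and> att A l1 u \<omega> \<and> att B l2 w \<omega> \<longrightarrow> \<not> \<omega>' ({u, w}, l3)))"
    by (subst prb_resample[where B = "UNIV \<times> {l3}"]) (simp add: att3)
  also have "\<dots> \<le> mean M (\<lambda>\<omega>. exp (- (\<Sum>u\<in>Z. (s / 2 * Wt \<omega> u) * of_bool (att A l1 u \<omega>))))"
  proof (rule mean_mono)
    fix \<omega>
    have "prb M (\<lambda>\<omega>'. \<forall>u\<in>Z. \<forall>w\<in>Z'. {u, w} \<in> E \<and> att A l1 u \<omega> \<and> att B l2 w \<omega> \<longrightarrow> \<not> \<omega>' ({u, w}, l3))
       \<le> prb M (\<lambda>\<omega>'. real (card {p\<in>Pr \<omega>. \<omega>' ({fst p, snd p}, l3)}) \<le> 0)"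
    proof (rule prb_mono)
      fix \<omega>' :: "('i \<Rightarrow> 'a) set \<times> nat \<Rightarrow> bool"
      assume "\<forall>u\<in>Z. \<forall>w\<in>Z'. {u, w} \<in> E \<and> att A l1 u \<omega> \<and> att B l2 w \<omega> \<longrightarrow> \<not> \<omega>' ({u, w}, l3)"
      then have "{p\<in>Pr \<omega>. \<omega>' ({fst p, snd p}, l3)} = {}" unfolding Pr_def by auto
      then show "real (card {p\<in>Pr \<omega>. \<omega>' ({fst p, snd p}, l3)}) \<le> 0" by (metis card.empty of_nat_0 order_refl)
    qed
    also have "\<dots> \<le> exp (0 - s / 2 * real (card (Pr \<omega>)))"
    proof (rule count_indep_le[where B = "\<lambda>p. {({fst p, snd p}, l3)}"])
      \<comment> \<open>Disjointness of \<open>Z\<close> and \<open>Z'\<close> makes the unordered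
        edge determine the ordered pair.\<close>
      show "{({fst p, snd p}, l3)} \<inter> {({fst p', snd p'}, l3)} = {}" if "p \<in> Pr \<omega>" "p' \<in> Pr \<omega>" "p \<noteq> p'" for p p'
        using that Z(3) by (auto simp: Pr_def doubleton_eq_iff)
      show "s \<le> prb M (\<lambda>\<omega>. \<omega> ({fst p, snd p}, l3))" if "p \<in> Pr \<omega>" for p
        using prb_coord[of "{fst p, snd p}" l3] l(3) s(3) that by (auto simp: Pr_def)
    qed (use finPr in \<open>auto intro!: dep_onI\<close>)
    also have "real (card (Pr \<omega>)) = (\<Sum>u\<in>Z. Wt \<omega> u * of_bool (att A l1 u \<omega>))"
    proof -
      have "Pr \<omega> = (SIGMA u:Z. {w \<in> Z'. {u, w} \<in> E \<and> att A l1 u \<omega> \<and> att B l2 w \<omega>})"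
        by (auto simp: Pr_def)
      then have "card (Pr \<omega>) = (\<Sum>u\<in>Z. card {w \<in> Z'. {u, w} \<in> E \<and> att A l1 u \<omega> \<and> att B l2 w \<omega>})"
        using finZ by simp
      then show ?thesis unfolding Wt_def by (auto intro!: sum.cong)
    qed
    finally show "prb M (\<lambda>\<omega>'. \<forall>u\<in>Z. \<forall>w\<in>Z'. {u, w} \<in> E \<and> att A l1 u \<omega> \<and> att B l2 w \<omega> \<longrightarrow> \<not> \<omega>' ({u, w}, l3))
       \<le> exp (- (\<Sum>u\<in>Z. (s / 2 * Wt \<omega> u) * of_bool (att A l1 u \<omega>)))"
      by (simp add: sum_distrib_left mult.assoc)
  qed
  also have "\<dots> = mean M (\<lambda>\<omega>. mean M (\<lambda>\<omega>'. exp (- (\<Sum>u\<in>Z. (s / 2 * Wt \<omega> u) * of_bool (att A l1 u \<omega>')))))"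
  proof -
    have "att A l1 u (override_on \<omega> \<omega>' (UNIV \<times> {l1})) = att A l1 u \<omega>'"
      "att B l2 u (override_on \<omega> \<omega>' (UNIV \<times> {l1})) = att B l2 u \<omega>" for u \<omega> \<omega>'
      using l by (auto simp: att_def)
    then show ?thesis by (subst mean_resample[where B = "UNIV \<times> {l1}"]) (simp add: Wt_def)
  qed
  also have "\<dots> \<le> mean M (\<lambda>\<omega>. exp (- (q / 2) * (\<Sum>u\<in>Z. s / 2 * Wt \<omega> u)))"
  proof (rule mean_mono, rule exp_indep_le[where B = "attblk A l1"])
    fix u \<omega> assume u: "u \<in> Z"
    show "q \<le> prb M (att A l1 u)" using prb_att[OF l(1) AB(1) hA[OF u]] s by (simp add: q_def)
    have "card {w \<in> Z'. {u, w} \<in> E \<and> att B l2 w \<omega>} \<le> card {w \<in> V. {u, w} \<in> E}"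
      using Z finite_V by (intro card_mono) auto
    then have "Wt \<omega> u \<le> real deg" using card_nbrs[of u] u Z by (auto simp: Wt_def)
    \<comment> \<open>A vertex has at most \<open>deg\<close> candidate middle edges, so
      \<open>s * deg \<le> 1\<close> brings the weights into [0, 1] as \<open>exp_indep_le\<close>
      demands.\<close>
    then have "s * Wt \<omega> u \<le> s * real deg" using s0 by (intro mult_left_mono)
    then show "0 \<le> s / 2 * Wt \<omega> u \<and> s / 2 * Wt \<omega> u \<le> 1" using s s0 by (auto simp: Wt_def)
  qed (use finZ dep_att attblk_disjoint in auto)
  also have "\<dots> = mean M (\<lambda>\<omega>. exp (- (\<Sum>w\<in>Z'. (q * s / 4 * Wt' w) * of_bool (att B l2 w \<omega>))))"
  proof -
    \<comment> \<open>Double counting moves the sum to the other side of the cut, where only the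
      attachments in layer \<open>l2\<close> are still random.\<close>
    have "(\<Sum>u\<in>Z. Wt \<omega> u) = (\<Sum>w\<in>Z'. Wt' w * of_bool (att B l2 w \<omega>))" for \<omega>
    proof -
      have "(\<Sum>u\<in>Z. Wt \<omega> u) = (\<Sum>u\<in>Z. \<Sum>w\<in>Z'. of_bool ({u, w} \<in> E \<and> att B l2 w \<omega>))"
        unfolding Wt_def using finZ by (intro sum.cong) (auto simp: of_bool_def sum.If_cases Int_def)
      also have "\<dots> = (\<Sum>w\<in>Z'. \<Sum>u\<in>Z. of_bool ({u, w} \<in> E \<and> att B l2 w \<omega>))" by (rule sum.swap)
      also have "\<dots> = (\<Sum>w\<in>Z'. Wt' w * of_bool (att B l2 w \<omega>))"
        unfolding Wt'_def using finZ by (intro sum.cong) (auto simp: of_bool_def sum.If_cases Int_def)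
      finally show ?thesis .
    qed
    then have "- (q / 2) * (\<Sum>u\<in>Z. s / 2 * Wt \<omega> u) = - (\<Sum>w\<in>Z'. (q * s / 4 * Wt' w) * of_bool (att B l2 w \<omega>))" for \<omega>
      unfolding sum_distrib_left[symmetric] mult.assoc by simp
    then show ?thesis by simp
  qed
  also have "\<dots> \<le> exp (- (q / 2) * (\<Sum>w\<in>Z'. q * s / 4 * Wt' w))"
  proof (rule exp_indep_le[where B = "attblk B l2"])
    fix w assume w: "w \<in> Z'"
    show "q \<le> prb M (att B l2 w)" using prb_att[OF l(2) AB(2) hB[OF w]] s by (simp add: q_def)
    have "card {u \<in> Z. {u, w} \<in> E} \<le> card {u \<in> V. {w, u} \<in> E}"
      using Z finite_V by (intro card_mono) (auto simp: insert_commute)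
    then have "Wt' w \<le> real deg" using card_nbrs[of w] w Z by (auto simp: Wt'_def)
    then have "s * Wt' w \<le> 1" using s0 s(4) mult_left_mono[of "Wt' w" "real deg" s] by linarith
    then have "q * (s * Wt' w) \<le> 1 * 1" using q0 s0 by (intro mult_mono) (auto simp: Wt'_def)
    then show "0 \<le> q * s / 4 * Wt' w \<and> q * s / 4 * Wt' w \<le> 1" using q0 s0 by (auto simp: Wt'_def mult.assoc)
  qed (use finZ dep_att attblk_disjoint in auto)
  also have "\<dots> = exp (- (q\<^sup>2 * s / 8) * (\<Sum>u\<in>Z. real (card {w \<in> Z'. {u, w} \<in> E})))"
  proof -
    have "(\<Sum>w\<in>Z'. Wt' w) = (\<Sum>w\<in>Z'. \<Sum>u\<in>Z. of_bool ({u, w} \<in> E))"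
      unfolding Wt'_def using finZ by (intro sum.cong) (auto simp: of_bool_def sum.If_cases Int_def)
    also have "\<dots> = (\<Sum>u\<in>Z. \<Sum>w\<in>Z'. of_bool ({u, w} \<in> E))" by (rule sum.swap)
    also have "\<dots> = (\<Sum>u\<in>Z. real (card {w \<in> Z'. {u, w} \<in> E}))"
      using finZ by (intro sum.cong) (auto simp: of_bool_def sum.If_cases Int_def)
    finally have "(\<Sum>w\<in>Z'. Wt' w) = (\<Sum>u\<in>Z. real (card {w \<in> Z'. {u, w} \<in> E}))" .
    moreover have "(\<Sum>w\<in>Z'. q * s / 4 * Wt' w) = q * s / 4 * (\<Sum>w\<in>Z'. Wt' w)"
      by (rule sum_distrib_left[symmetric])
    ultimately show ?thesis by (simp add: power2_eq_square)
  qed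
  finally show ?thesis .
qed

lemma sum_nbrs_swap:
  assumes "A \<subseteq> V"
  shows "(\<Sum>v\<in>V. card {a \<in> A. {v, a} \<in> E}) = deg * card A"
proof -
  have finA: "finite A" using assms finite_V finite_subset by auto
  have "(\<Sum>v\<in>V. card {a \<in> A. {v, a} \<in> E}) = (\<Sum>v\<in>V. \<Sum>a\<in>A. of_bool ({v, a} \<in> E))"
    using finA by (intro sum.cong) (auto simp: of_bool_def sum.If_cases Int_def)
  also have "\<dots> = (\<Sum>a\<in>A. \<Sum>v\<in>V. of_bool ({v, a} \<in> E))" by (rule sum.swap)
  also have "\<dots> = (\<Sum>a\<in>A. card {v \<in> V. {a, v} \<in> E})"
    using finite_V by (intro sum.cong) (auto simp: of_bool_def sum.If_cases Int_def insert_commute)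
  also have "\<dots> = (\<Sum>a\<in>A. deg)" using assms by (intro sum.cong) (auto simp: card_nbrs)
  finally show ?thesis by simp
qed

text \<open>Double counting of the edges at \<open>A\<close>: a vertex with at least
  \<open>h\<close> neighbours in \<open>A\<close>, or lying in \<open>X\<close>, receives at most
  \<open>deg\<close> of them, and every other vertex fewer than \<open>h\<close>.\<close>

lemma card_many_nbrs_ge:
  assumes A: "A \<subseteq> V" and X: "X \<subseteq> V"
  shows "deg * card A \<le> deg * card {v \<in> V - X. h \<le> card {a \<in> A. {v, a} \<in> E}} + deg * card X + h * card V"
proof -
  let ?A' = "{v \<in> V - X. h \<le> card {a \<in> A. {v, a} \<in> E}}"
  have finA: "finite A" using A finite_V finite_subset by auto
  have le: "card {a \<in> A. {v, a} \<in> E} \<le> deg" if "v \<in> V" for v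
    unfolding card_nbrs[OF that, symmetric] using A finite_V by (intro card_mono) auto
  have "deg * card A = (\<Sum>v\<in>V. card {a \<in> A. {v, a} \<in> E})" by (rule sum_nbrs_swap[OF A, symmetric])
  also have "\<dots> \<le> (\<Sum>v\<in>V. deg * of_bool (v \<in> ?A') + deg * of_bool (v \<in> X) + h)"
  proof (rule sum_mono)
    fix v assume v: "v \<in> V"
    show "card {a \<in> A. {v, a} \<in> E} \<le> deg * of_bool (v \<in> ?A') + deg * of_bool (v \<in> X) + h"
      using le[OF v] v by (auto intro: trans_le_add1)
  qed
  also have "\<dots> = deg * card ?A' + deg * card X + h * card V"
  proof -
    have c: "(\<Sum>v\<in>V. of_bool (v \<in> S)) = card S" if "S \<subseteq> V" for S
      using that finite_V by (simp add: of_bool_def sum.If_cases Int_absorb1)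
    have "(\<Sum>v\<in>V. of_bool (v \<in> ?A')) = card ?A'" "(\<Sum>v\<in>V. of_bool (v \<in> X)) = card X"
      by (intro c; use X in auto)+
    then show ?thesis by (simp only: sum.distrib sum_distrib_left[symmetric] sum_constant mult.commute of_nat_id)
  qed
  finally show ?thesis .
qed

text \<open>The vertex boundary of \<open>S\<close> need not equal \<open>X\<close>, only lie in it,
  which suits a union bound over \<open>X\<close>. For \<open>X = {}\<close> and subsets of
  \<open>V\<close> these are the unions of clusters.\<close>

definition closedX :: "('i \<Rightarrow> 'a) set set \<Rightarrow> ('i \<Rightarrow> 'a) set \<Rightarrow> ('i \<Rightarrow> 'a) set \<Rightarrow> bool" where
  "closedX F S X \<longleftrightarrow> (\<forall>y\<in>S. \<forall>v. {y, v} \<in> F \<longrightarrow> v \<in> S \<union> X)"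

text \<open>Let A' and B' be the vertices outside \<open>X\<close> with at least \<open>h\<close>
  neighbours in \<open>A\<close> and in \<open>B\<close>. If they overlap substantially, two-edge
  bridges in layers 2 and 3 suffice. Otherwise isoperimetry for A' yields many boundary edges, and
  since by \<open>ex\<close> few vertices lie outside A' and B', most of the guaranteed edges enter
  B' - A' and can serve as layer 4 middle edges.\<close>

lemma sprinkle:
  assumes \<Lambda>: "{2, 3, 4} \<subseteq> \<Lambda>" and A: "A \<subseteq> V" and B: "B \<subseteq> V" and X: "X \<subseteq> V"
    and disj: "B \<inter> X = {}"
    and s: "pr 2 = s" "pr 3 = s" "pr 4 = s" "s * real deg \<le> 1"
    and g: "0 < g" "g \<le> real (card A)" "g \<le> real (card B)" "real (card X) \<le> g / 4"
      "real h * real (card V) \<le> real deg * g / 4" and deg0: "0 < deg"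
    and ex: "real deg * real (card {v \<in> V. \<not> (v \<notin> X \<and> h \<le> card {a \<in> A. {v, a} \<in> E}) \<and>
        \<not> (v \<notin> X \<and> h \<le> card {b \<in> B. {v, b} \<in> E})}) \<le> g\<^sup>2 / (32 * real C * real (card V))"
  defines "q \<equiv> 1 - exp (- (s / 2) * real h)"
  shows "prb M (\<lambda>\<omega>. \<exists>S. A \<subseteq> S \<and> S \<inter> B = {} \<and> S \<inter> X = {} \<and> closedX (opn {2, 3, 4} \<omega>) S X)
    \<le> exp (- (q\<^sup>2 * s / 8) * (g\<^sup>2 / (16 * real C * real (card V))))"
proof -
  let ?n = "real (card V)"
  define A' where "A' = {v \<in> V - X. h \<le> card {a \<in> A. {v, a} \<in> E}}"
  define B' where "B' = {v \<in> V - X. h \<le> card {b \<in> B. {v, b} \<in> E}}"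
  have s0: "0 \<le> s" "s \<le> 1" using pr[of 2] s by auto
  have npos: "0 < ?n" using V_pos by simp
  have finA'B': "finite A'" "finite B'" using finite_V by (auto simp: A'_def B'_def)
  have sub: "A' \<subseteq> V" "B' \<subseteq> V" by (auto simp: A'_def B'_def)
  have Cpos: "0 < real C"
  proof -
    obtain j where "j \<in> T" using deg0 unfolding deg_def by (metis ex_in_conv less_irrefl sum.empty)
    then show ?thesis using k_pos[of j] by linarith
  qed
  \<comment> \<open>From \<open>card A \<ge> g\<close> at most g / 4 is lost to \<open>X\<close> and
    g / 4 to vertices with fewer than \<open>h\<close> neighbours in \<open>A\<close>.\<close>
  have big': "g / 2 \<le> real (card {v \<in> V - X. h \<le> card {a \<in> A. {v, a} \<in> E}})" if "A \<subseteq> V" "g \<le> real (card A)" for A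
  proof -
    let ?c = "real (card {v \<in> V - X. h \<le> card {a \<in> A. {v, a} \<in> E}})"
    have "real deg * real (card A) \<le> real deg * ?c + real deg * real (card X) + real h * ?n"
      using card_many_nbrs_ge[OF that(1) X, of h] by (simp flip: of_nat_mult of_nat_add)
    also have "\<dots> \<le> real deg * ?c + real deg * (g / 4) + real deg * g / 4"
      using g by (intro add_mono mult_left_mono) auto
    finally have "real deg * real (card A) \<le> real deg * (?c + g / 2)" by (simp add: algebra_simps)
    then have "real (card A) \<le> ?c + g / 2" using deg0 by simp
    then show ?thesis using that by linarith
  qed
  have A'g: "g / 2 \<le> real (card A')" unfolding A'_def by (rule big'[OF A g(2)])
  have B'g: "g / 2 \<le> real (card B')" unfolding B'_def by (rule big'[OF B g(3)])
  have attS: "att A 2 u \<omega> \<Longrightarrow> u \<notin> X \<Longrightarrow> u \<in> S" "att B 3 w \<omega> \<Longrightarrow> w \<notin> S"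
    if "A \<subseteq> S" "S \<inter> B = {}" "S \<inter> X = {}" "closedX (opn {2, 3, 4} \<omega>) S X" for u w \<omega> S
  proof -
    assume u: "att A 2 u \<omega>" "u \<notin> X"
    show "u \<in> S"
    proof (cases "u \<in> A")
      case False
      then obtain a where "a \<in> A" "{u, a} \<in> E" "\<omega> ({u, a}, 2)" using u by (auto simp: att_def)
      then have "{a, u} \<in> opn {2, 3, 4} \<omega>" "a \<in> S" using that(1) by (auto simp: opn_def insert_commute)
      then show ?thesis using that(4) u(2) unfolding closedX_def by blast
    qed (use that in auto)
  next
    assume w: "att B 3 w \<omega>"
    show "w \<notin> S"
    proof
      assume wS: "w \<in> S"
      then have "w \<notin> B" using that by auto
      then obtain b where "b \<in> B" "{w, b} \<in> E" "\<omega> ({w, b}, 3)" using w by (auto simp: att_def)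
      then have "{w, b} \<in> opn {2, 3, 4} \<omega>" by (auto simp: opn_def)
      then have "b \<in> S \<union> X" using that(4) wS unfolding closedX_def by blast
      then show False using that(2) disj \<open>b \<in> B\<close> by auto
    qed
  qed
  show ?thesis
  proof (cases "g / 4 \<le> real (card (A' \<inter> B'))")
    case True
    have "prb M (\<lambda>\<omega>. \<exists>S. A \<subseteq> S \<and> S \<inter> B = {} \<and> S \<inter> X = {} \<and> closedX (opn {2, 3, 4} \<omega>) S X)
      \<le> prb M (\<lambda>\<omega>. \<forall>v\<in>A' \<inter> B'. \<not> (att A 2 v \<omega> \<and> att B 3 v \<omega>))"
    proof (rule prb_mono, clarify)
      fix \<omega> S v assume S: "A \<subseteq> S" "S \<inter> B = {}" "S \<inter> X = {}" "closedX (opn {2, 3, 4} \<omega>) S X"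
        and v: "v \<in> A'" "att A 2 v \<omega>" "att B 3 v \<omega>"
      show False using attS(1)[OF S v(2)] attS(2)[OF S v(3)] v(1) by (auto simp: A'_def)
    qed
    also have "\<dots> \<le> exp (- (q\<^sup>2 / 2) * real (card (A' \<inter> B')))"
      unfolding q_def by (rule prb_both_att) (use \<Lambda> A B sub s in \<open>auto simp: A'_def B'_def\<close>)
    also have "\<dots> \<le> exp (- (q\<^sup>2 / 2) * (g / 4))"
      using mult_left_mono[OF True, of "q\<^sup>2 / 2"] by simp
    \<comment> \<open>The two-edge bound is stronger; s \<le> 1 and g \<le> n weaken it to the
      common form.\<close>
    also have "\<dots> \<le> exp (- (q\<^sup>2 * s / 8) * (g\<^sup>2 / (16 * real C * ?n)))"
    proof -
      have gn: "g \<le> ?n" using g(2) card_mono[OF finite_V A] by linarith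
      have "1 \<le> real C" using Cpos by (simp add: Suc_le_eq)
      have "g\<^sup>2 / (16 * real C * ?n) \<le> g"
      proof -
        have "g * g \<le> g * ?n" using gn g by (intro mult_left_mono) auto
        also have "\<dots> \<le> g * (16 * real C * ?n)"
          using g(1) npos \<open>1 \<le> real C\<close> by (intro mult_left_mono) auto
        finally show ?thesis using npos Cpos by (simp add: power2_eq_square field_simps)
      qed
      then have "s * (g\<^sup>2 / (16 * real C * ?n)) \<le> 1 * g"
        using s0 g npos Cpos by (intro mult_mono) auto
      then have "q\<^sup>2 / 8 * (s * (g\<^sup>2 / (16 * real C * ?n))) \<le> q\<^sup>2 / 8 * g"
        by (intro mult_left_mono) auto
      then show ?thesis by (simp add: algebra_simps)
    qed
    finally show ?thesis .
  next
    case False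
    let ?Z = "A'" and ?Z' = "B' - A'"
    let ?rest = "V - A' - B'"
    have "prb M (\<lambda>\<omega>. \<exists>S. A \<subseteq> S \<and> S \<inter> B = {} \<and> S \<inter> X = {} \<and> closedX (opn {2, 3, 4} \<omega>) S X)
      \<le> prb M (\<lambda>\<omega>. \<forall>u\<in>?Z. \<forall>w\<in>?Z'. {u, w} \<in> E \<and> att A 2 u \<omega> \<and> att B 3 w \<omega> \<longrightarrow> \<not> \<omega> ({u, w}, 4))"
    proof (rule prb_mono, clarify)
      fix \<omega> S u w assume S: "A \<subseteq> S" "S \<inter> B = {}" "S \<inter> X = {}" "closedX (opn {2, 3, 4} \<omega>) S X"
        and uw: "u \<in> A'" "w \<in> B'" "{u, w} \<in> E" "att A 2 u \<omega>" "att B 3 w \<omega>" "\<omega> ({u, w}, 4)"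
      have "u \<in> S" "w \<notin> S" using attS(1)[OF S uw(4)] attS(2)[OF S uw(5)] uw(1) by (auto simp: A'_def)
      moreover have "{u, w} \<in> opn {2, 3, 4} \<omega>" using uw by (auto simp: opn_def)
      ultimately have "w \<in> X" using S(4) unfolding closedX_def by blast
      then show False using uw(2) by (auto simp: B'_def)
    qed
    also have "\<dots> \<le> exp (- (q\<^sup>2 * s / 8) * (\<Sum>u\<in>?Z. real (card {w \<in> ?Z'. {u, w} \<in> E})))"
      unfolding q_def by (rule prb_three_path) (use \<Lambda> A B sub s in \<open>auto simp: A'_def B'_def\<close>)
    also have "\<dots> \<le> exp (- (q\<^sup>2 * s / 8) * (g\<^sup>2 / (16 * real C * ?n)))"
    proof -
      let ?e = "\<Sum>u\<in>A'. real (card {w \<in> ?Z'. {u, w} \<in> E})"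
      let ?f = "\<Sum>u\<in>A'. real (card {w \<in> ?rest. {u, w} \<in> E})"
      have "real (card B') = real (card (B' - A')) + real (card (A' \<inter> B'))"
        using card_Diff_subset_Int[of B' A'] finA'B' by (simp add: Int_commute card_mono of_nat_diff)
      then have "g / 4 \<le> real (card (B' - A'))" using B'g False by linarith
      also have "\<dots> \<le> real (card (V - A'))" using sub finite_V by (intro of_nat_mono card_mono) auto
      finally have VA: "g / 4 \<le> real (card (V - A'))" .
      have "g / 2 * (g / 4) \<le> real (card A') * real (card (V - A'))"
        using A'g VA g by (intro mult_mono) auto
      also have "\<dots> \<le> real C * ?n * (\<Sum>u\<in>A'. real (card {v \<in> V - A'. {u, v} \<in> E}))"
        by (rule isoperimetry[OF sub(1)])
      \<comment> \<open>Only \<open>?e\<close> counts usable middle edges. The edges to the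
        remaining vertices, \<open>?f\<close>, are bounded through \<open>ex\<close>, and 1/8 - 1/32
        exceeds 1/16.\<close>
      also have "(\<Sum>u\<in>A'. real (card {v \<in> V - A'. {u, v} \<in> E})) = ?e + ?f"
        unfolding sum.distrib[symmetric]
      proof (rule sum.cong)
        fix u assume "u \<in> A'"
        have eq: "{v \<in> V - A'. {u, v} \<in> E} = {w \<in> ?Z'. {u, w} \<in> E} \<union> {w \<in> ?rest. {u, w} \<in> E}"
          using sub by auto
        have "card ({w \<in> ?Z'. {u, w} \<in> E} \<union> {w \<in> ?rest. {u, w} \<in> E}) =
            card {w \<in> ?Z'. {u, w} \<in> E} + card {w \<in> ?rest. {u, w} \<in> E}"
          using finite_V finA'B' by (intro card_Un_disjoint) auto
        then show "real (card {v \<in> V - A'. {u, v} \<in> E}) = real (card {w \<in> ?Z'. {u, w} \<in> E}) + real (card {w \<in> ?rest. {u, w} \<in> E})"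
          unfolding eq by linarith
      qed simp
      finally have 1: "g\<^sup>2 / (8 * real C * ?n) \<le> ?e + ?f"
        using Cpos npos by (simp add: field_simps power2_eq_square)
      have "(\<Sum>u\<in>A'. card {w \<in> ?rest. {u, w} \<in> E}) \<le> (\<Sum>u\<in>V. card {w \<in> ?rest. {u, w} \<in> E})"
        using sub finite_V by (intro sum_mono2) auto
      also have "\<dots> = deg * card ?rest" by (rule sum_nbrs_swap) auto
      finally have f: "?f \<le> real deg * real (card ?rest)" by (simp flip: of_nat_sum of_nat_mult)
      have "?rest = {v \<in> V. \<not> (v \<notin> X \<and> h \<le> card {a \<in> A. {v, a} \<in> E}) \<and>
        \<not> (v \<notin> X \<and> h \<le> card {b \<in> B. {v, b} \<in> E})}" unfolding A'_def B'_def by blast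
      with f ex have "?f \<le> g\<^sup>2 / (32 * real C * ?n)" by simp
      with 1 have "g\<^sup>2 / (8 * real C * ?n) - g\<^sup>2 / (32 * real C * ?n) \<le> ?e" by linarith
      moreover have "g\<^sup>2 / (16 * real C * ?n) \<le> g\<^sup>2 / (8 * real C * ?n) - g\<^sup>2 / (32 * real C * ?n)"
        using Cpos npos by (simp add: field_simps)
      ultimately have "g\<^sup>2 / (16 * real C * ?n) \<le> ?e" by linarith
      then have "q\<^sup>2 * s / 8 * (g\<^sup>2 / (16 * real C * ?n)) \<le> q\<^sup>2 * s / 8 * ?e"
        using s0 by (intro mult_left_mono) auto
      then show ?thesis by simp
    qed
    finally show ?thesis .
  qed
qed

end

text \<open>A closed set is a union of components of \<open>U\<close>, each of which meets
  \<open>R\<close>; hence its trace on \<open>R\<close> determines it.\<close>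

lemma card_closed_le:
  assumes U: "finite U" "R \<subseteq> U"
    and cover: "\<And>v. v \<in> U \<Longrightarrow> \<exists>r\<in>R. r \<in> expl F {v} U"
  shows "card {A. A \<subseteq> U \<and> (\<forall>y\<in>A. \<forall>v\<in>U. {y, v} \<in> F \<longrightarrow> v \<in> A)} \<le> 2 ^ card R"
proof -
  let ?F = "{A. A \<subseteq> U \<and> (\<forall>y\<in>A. \<forall>v\<in>U. {y, v} \<in> F \<longrightarrow> v \<in> A)}"
  have finR: "finite R" using U finite_subset by auto
  have closed: "expl F {v} U \<subseteq> A" if "A \<in> ?F" "v \<in> A" for A v
    using that by (intro expl_least) auto
  have sub: "A \<subseteq> A'" if "A \<in> ?F" "A' \<in> ?F" "A \<inter> R = A' \<inter> R" for A A'
  proof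
    fix v assume v: "v \<in> A"
    then have vU: "v \<in> U" using that by auto
    then obtain r where r: "r \<in> R" "r \<in> expl F {v} U" using cover by blast
    then have "r \<in> A'" using closed[OF that(1) v] that(3) by auto
    then show "v \<in> A'" using closed[OF that(2)] expl_sym[OF vU r(2)] by auto
  qed
  have "inj_on (\<lambda>A. A \<inter> R) ?F"
  proof (rule inj_onI)
    fix A A' assume AA: "A \<in> ?F" "A' \<in> ?F" "A \<inter> R = A' \<inter> R"
    then show "A = A'" using sub[OF AA] sub[OF AA(2,1) AA(3)[symmetric]] by (rule_tac subset_antisym)
  qed
  then have "card ?F = card ((\<lambda>A. A \<inter> R) ` ?F)" by (rule card_image[symmetric])
  also have "\<dots> \<le> card (Pow R)" using finR by (intro card_mono) auto
  also have "\<dots> = 2 ^ card R" using finR by (rule card_Pow)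
  finally show ?thesis .
qed

context percolated_product
begin

lemma big_closed: "F \<subseteq> E \<Longrightarrow> y \<in> big h F \<Longrightarrow> {y, v} \<in> F \<Longrightarrow> v \<in> big h F"
proof -
  assume F: "F \<subseteq> E" and y: "y \<in> big h F" and e: "{y, v} \<in> F"
  have v: "v \<in> V" using F e E_iff by blast
  have "v \<in> expl F {y} V" using e v expl_base[of "{y}" F V] by (auto intro: expl_step[of y])
  then have "expl F {v} V = expl F {y} V" using y by (intro expl_eq) (auto simp: big_def)
  then show ?thesis using y v by (simp add: big_def)
qed

lemma card_clusters:
  assumes "0 < h"
  shows "real h * real (card ((\<lambda>v. expl F {v} V) ` big h F)) \<le> real (card V)"
proof -
  let ?K = "(\<lambda>v. expl F {v} V) ` big h F"
  have fin: "finite ?K" using finite_big by auto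
  have sub: "c \<subseteq> V" if "c \<in> ?K" for c using that expl_sub[of F _ V] by (force simp: big_def)
  have "h * card ?K = (\<Sum>c\<in>?K. h)" by simp
  also have "\<dots> \<le> (\<Sum>c\<in>?K. card c)" by (intro sum_mono) (auto simp: big_def)
  also have "\<dots> = card (\<Union>?K)"
  proof (rule card_Union_disjoint[symmetric])
    show "pairwise disjnt ?K"
    proof (rule pairwiseI)
      fix c c' assume c: "c \<in> ?K" "c' \<in> ?K" "c \<noteq> c'"
      then obtain v v' where v: "v \<in> V" "v' \<in> V" "c = expl F {v} V" "c' = expl F {v'} V"
        using big_sub by blast
      show "disjnt c c'"
      proof (rule ccontr)
        assume "\<not> disjnt c c'"
        then obtain y where "y \<in> c" "y \<in> c'" unfolding disjnt_def by blast
        then have "expl F {y} V = c" "expl F {y} V = c'" using expl_eq[of v V y F] expl_eq[of v' V y F] v by auto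
        then show False using c(3) by simp
      qed
    qed
    show "finite c" if "c \<in> ?K" for c using finite_subset[OF sub[OF that] finite_V] .
  qed
  also have "\<dots> \<le> card V" using sub finite_V by (intro card_mono) auto
  finally show ?thesis by (simp flip: of_nat_mult)
qed

text \<open>A closed subset of \<open>big h F - X\<close> is determined by its trace on a set \<open>R\<close> that meets every
  piece: a piece not adjacent to \<open>X\<close> is a whole cluster, the others are charged to edges at \<open>X\<close>.\<close>

lemma card_closed_pieces:
  assumes F: "F \<subseteq> E" and X: "X \<subseteq> V" and h: "0 < h" and z: "real (card {e \<in> F. e \<inter> X \<noteq> {}}) \<le> z"
  shows "real (card {A. A \<subseteq> big h F - X \<and> (\<forall>y\<in>A. \<forall>v\<in>big h F - X. {y, v} \<in> F \<longrightarrow> v \<in> A)})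
    \<le> exp (real (card V) / real h + z)"
proof -
  let ?W = "big h F" and ?U = "big h F - X"
  define rep where "rep = (\<lambda>c::('i \<Rightarrow> 'a) set. SOME u. u \<in> c)"
  let ?K = "(\<lambda>v. expl F {v} V) ` ?W"
  let ?T = "{e \<in> F. e \<inter> X \<noteq> {}}"
  \<comment> \<open>An edge at \<open>X\<close> is charged to its endpoint outside \<open>X\<close>.
    If both ends lie in \<open>X\<close> the choice is arbitrary, and \<open>R\<close> keeps only
    points of \<open>?U\<close>.\<close>
  define R1 where "R1 = (\<lambda>e. SOME y. y \<in> e - X) ` ?T"
  define R where "R = (R1 \<union> rep ` ?K) \<inter> ?U"
  have finT': "finite ?T" using finite_subset[OF F finE] by auto
  have finU: "finite ?U" using finite_big by auto
  have cR: "card R \<le> card ?T + card ?K"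
  proof -
    have "card R \<le> card (R1 \<union> rep ` ?K)" unfolding R_def R1_def using finT' finite_big by (intro card_mono) auto
    also have "\<dots> \<le> card R1 + card (rep ` ?K)" by (rule card_Un_le)
    also have "\<dots> \<le> card ?T + card ?K" unfolding R1_def using finT' finite_big by (intro add_mono card_image_le) auto
    finally show ?thesis .
  qed
  have cover: "\<exists>r\<in>R. r \<in> expl F {v} ?U" if v: "v \<in> ?U" for v
  proof (rule ccontr)
    assume "\<not> ?thesis"
    then have no: "r \<notin> R" if "r \<in> expl F {v} ?U" for r using that by blast
    let ?Q = "expl F {v} ?U"
    have Qsub: "?Q \<subseteq> ?U" using expl_sub[of F "{v}" ?U] v by auto
    \<comment> \<open>A piece that avoids \<open>R1\<close> has no edge to \<open>X\<close>, so it
      is a full cluster; but then it contains its representative, which belongs to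
      \<open>R\<close>.\<close>
    have "expl F {v} V \<subseteq> ?Q"
    proof (rule expl_least[OF expl_base])
      fix y w assume y: "y \<in> ?Q" and e: "{y, w} \<in> F" and "w \<in> V"
      have yU: "y \<in> ?U" using y Qsub by auto
      then have wW: "w \<in> ?W" using big_closed[OF F _ e] by auto
      have "w \<notin> X"
      proof
        assume wX: "w \<in> X"
        have "y \<noteq> w" using wX yU by auto
        then have "{y, w} - X = {y}" using wX yU by auto
        then have "(SOME y'. y' \<in> {y, w} - X) = y" by simp
        then have "y = (\<lambda>e. SOME y'. y' \<in> e - X) {y, w}" by (simp only:)
        moreover have "{y, w} \<in> ?T" using e wX by auto
        ultimately have "y \<in> R1" unfolding R1_def by (rule image_eqI)
        then show False using no[OF y] yU by (auto simp: R_def)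
      qed
      then show "w \<in> ?Q" using y e wW by (auto intro: expl_step)
    qed
    moreover have "rep (expl F {v} V) \<in> expl F {v} V"
      unfolding rep_def by (rule someI[of _ v]) (use expl_base[of "{v}" F V] in auto)
    ultimately have "rep (expl F {v} V) \<in> ?Q" by auto
    moreover from this have "rep (expl F {v} V) \<in> R" using v Qsub by (auto simp: R_def)
    ultimately show False using no by blast
  qed
  have "card {A. A \<subseteq> ?U \<and> (\<forall>y\<in>A. \<forall>v\<in>?U. {y, v} \<in> F \<longrightarrow> v \<in> A)} \<le> 2 ^ card R"
    by (rule card_closed_le[OF finU _ cover]) (auto simp: R_def)
  then have "real (card {A. A \<subseteq> ?U \<and> (\<forall>y\<in>A. \<forall>v\<in>?U. {y, v} \<in> F \<longrightarrow> v \<in> A)}) \<le> real (2 ^ card R)"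
    by (simp only: of_nat_le_iff)
  also have "real (2 ^ card R) = 2 ^ card R" by simp
  also have "\<dots> \<le> exp 1 ^ card R" using exp_ge_add_one_self[of 1] by (intro power_mono) auto
  also have "\<dots> = exp (real (card R))" by (simp add: exp_of_nat_mult[symmetric])
  also have "\<dots> \<le> exp (real (card V) / real h + z)"
  proof -
    have "real (card ?K) \<le> real (card V) / real h"
      using card_clusters[OF h, of F] h by (simp add: field_simps)
    then show ?thesis using cR z by simp
  qed
  finally show ?thesis .
qed

section \<open>Excluding balanced cuts by a union bound\<close>

definition Wh :: "nat \<Rightarrow> (('i \<Rightarrow> 'a) set \<times> nat \<Rightarrow> bool) \<Rightarrow> ('i \<Rightarrow> 'a) set" where
  "Wh h \<omega> = big h (opn {0, 1} \<omega>)"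

definition poor :: "nat \<Rightarrow> real \<Rightarrow> (('i \<Rightarrow> 'a) set \<times> nat \<Rightarrow> bool) \<Rightarrow> ('i \<Rightarrow> 'a) set" where
  "poor h z \<omega> = {v \<in> V. real (card {u \<in> V. {v, u} \<in> E \<and> u \<in> Wh h \<omega>}) \<le> z}"

definition sparse_touch :: "real \<Rightarrow> real \<Rightarrow> (('i \<Rightarrow> 'a) set \<times> nat \<Rightarrow> bool) \<Rightarrow> bool" where
  "sparse_touch m z \<omega> \<longleftrightarrow>
    (\<forall>X. X \<subseteq> V \<and> real (card X) \<le> m \<longrightarrow> real (card {e \<in> opn {0, 1} \<omega>. e \<inter> X \<noteq> {}}) \<le> z)"

text \<open>Balance is required only of the trace on \<open>Wh h \<omega>\<close>: this trace is
  what can be enumerated from layers 0 and 1, while \<open>S\<close> itself also depends on the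
  sprinkled layers.\<close>

definition bad_cut :: "nat \<Rightarrow> real \<Rightarrow> real \<Rightarrow> (('i \<Rightarrow> 'a) set \<times> nat \<Rightarrow> bool) \<Rightarrow> bool" where
  "bad_cut h m g \<omega> \<longleftrightarrow> (\<exists>X S. X \<subseteq> V \<and> real (card X) \<le> m \<and> S \<subseteq> V \<and> S \<inter> X = {} \<and>
     closedX (opn {0, 1, 2, 3, 4} \<omega>) S X \<and>
     g \<le> real (card (S \<inter> Wh h \<omega>)) \<and> g \<le> real (card (Wh h \<omega> - S - X)))"

text \<open>Given layers 0 and 1, a bad cut yields a pair \<open>(X, A)\<close> with
  \<open>A\<close> = \<open>S \<inter> Wh H \<omega>\<close>, closed in
  \<open>Wh H \<omega> - X\<close>, which layers 2 to 4 fail to bridge. The three factors bound the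
  choices of \<open>X\<close>, the choices of \<open>A\<close> for given \<open>X\<close>, and the
  failure probability from \<open>sprinkle\<close> for a fixed pair.\<close>

lemma prb_bad_cut:
  assumes \<Lambda>: "{0, 1, 2, 3, 4} \<subseteq> \<Lambda>" and H: "0 < H" and h: "0 < h"
    and s: "pr 2 = s" "pr 3 = s" "pr 4 = s" "s * real deg \<le> 1"
    and g: "0 < g" "m \<le> g / 4" "real h * real (card V) \<le> real deg * g / 4" and deg0: "0 < deg"
    and m: "0 \<le> m" and a: "0 < a" "a \<le> 1"
    and ex: "real deg * (m + e1 + real deg * m / (2 * real h)) \<le> g\<^sup>2 / (32 * real C * real (card V))"
  defines "q \<equiv> 1 - exp (- (s / 2) * real h)"
  shows "prb M (\<lambda>\<omega>. real (card (poor H (4 * real h) \<omega>)) \<le> e1 \<and> sparse_touch m z \<omega> \<and> bad_cut H m g \<omega>)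
    \<le> exp (a * real (card V) + m * ln (1 / a)) * exp (real (card V) / real H + z)
      * exp (- (q\<^sup>2 * s / 8) * (g\<^sup>2 / (16 * real C * real (card V))))"
proof -
  let ?n = "real (card V)"
  let ?B = "UNIV \<times> {2, 3, 4::nat}"
  let ?good = "\<lambda>\<omega>. real (card (poor H (4 * real h) \<omega>)) \<le> e1 \<and> sparse_touch m z \<omega>"
  let ?b1 = "exp (a * ?n + m * ln (1 / a))" and ?b2 = "exp (?n / real H + z)"
  let ?b3 = "exp (- (q\<^sup>2 * s / 8) * (g\<^sup>2 / (16 * real C * ?n)))"
  define Xs where "Xs = {X. X \<subseteq> V \<and> real (card X) \<le> m}"
  define As where "As = (\<lambda>\<omega> X. {A. A \<subseteq> Wh H \<omega> - X \<and> (\<forall>y\<in>A. \<forall>v\<in>Wh H \<omega> - X. {y, v} \<in> opn {0, 1} \<omega> \<longrightarrow> v \<in> A)})"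
  define Fam where "Fam = (\<lambda>\<omega>. {(X, A). X \<in> Xs \<and> A \<in> As \<omega> X \<and> g \<le> real (card A) \<and> g \<le> real (card (Wh H \<omega> - X - A))})"
  define NP where "NP = (\<lambda>p \<omega> \<omega>'. case p of (X, A) \<Rightarrow> \<exists>S. A \<subseteq> S \<and> S \<inter> (Wh H \<omega> - X - A) = {} \<and> S \<inter> X = {} \<and>
      closedX (opn {2, 3, 4} \<omega>') S X)"
  have Wsub: "Wh H \<omega> \<subseteq> V" for \<omega> by (auto simp: Wh_def big_def)
  have finXs: "finite Xs" unfolding Xs_def using finite_V by auto
  have finAs: "finite (As \<omega> X)" for \<omega> X
    unfolding As_def by (rule finite_subset[of _ "Pow V"]) (use Wsub finite_V in auto)
  have Famsub: "Fam \<omega> \<subseteq> Sigma Xs (As \<omega>)" for \<omega> by (auto simp: Fam_def)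
  have finFam: "finite (Fam \<omega>)" for \<omega> using finite_subset[OF Famsub] finXs finAs by auto
  have ov: "opn {0, 1} (override_on \<omega> \<omega>' ?B) = opn {0, 1} \<omega>"
    "opn {2, 3, 4} (override_on \<omega> \<omega>' ?B) = opn {2, 3, 4} \<omega>'" for \<omega> \<omega>'
    by (auto simp: opn_def)
  have ovW: "Wh H (override_on \<omega> \<omega>' ?B) = Wh H \<omega>" for \<omega> \<omega>' by (simp only: Wh_def ov)
  have ovgood: "?good (override_on \<omega> \<omega>' ?B) = ?good \<omega>" for \<omega> \<omega>'
    by (simp only: poor_def sparse_touch_def ovW ov)
  have step: "\<exists>p\<in>Fam \<omega>. NP p \<omega> \<omega>'" if bad: "bad_cut H m g (override_on \<omega> \<omega>' ?B)" for \<omega> \<omega>'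
  proof -
    let ?o = "override_on \<omega> \<omega>' ?B"
    obtain X S where XS: "X \<subseteq> V" "real (card X) \<le> m" "S \<subseteq> V" "S \<inter> X = {}"
      "closedX (opn {0, 1, 2, 3, 4} ?o) S X"
      "g \<le> real (card (S \<inter> Wh H \<omega>))" "g \<le> real (card (Wh H \<omega> - S - X))"
      using bad unfolding bad_cut_def ovW by blast
    let ?A = "S \<inter> Wh H \<omega>"
    have "opn {0, 1} \<omega> \<subseteq> opn {0, 1, 2, 3, 4} ?o" "opn {2, 3, 4} \<omega>' \<subseteq> opn {0, 1, 2, 3, 4} ?o"
      unfolding ov[of \<omega> \<omega>', symmetric] by (intro opn_mono; auto)+
    then have cl: "closedX (opn {0, 1} \<omega>) S X" "closedX (opn {2, 3, 4} \<omega>') S X"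
      using XS(5) unfolding closedX_def by blast+
    have "?A \<in> As \<omega> X" using cl(1) XS(4) unfolding As_def closedX_def by blast
    moreover have eq: "Wh H \<omega> - X - ?A = Wh H \<omega> - S - X" by auto
    ultimately have "(X, ?A) \<in> Fam \<omega>" using XS by (simp add: Fam_def Xs_def eq)
    moreover have "NP (X, ?A) \<omega> \<omega>'" unfolding NP_def prod.case eq
      using cl(2) XS(4) by (intro exI[of _ S]) auto
    ultimately show ?thesis by blast
  qed
  have "prb M (\<lambda>\<omega>. real (card (poor H (4 * real h) \<omega>)) \<le> e1 \<and> sparse_touch m z \<omega> \<and> bad_cut H m g \<omega>)
    = prb M (\<lambda>\<omega>. ?good \<omega> \<and> bad_cut H m g \<omega>)" by (simp add: conj_assoc)
  also have "\<dots> = mean M (\<lambda>\<omega>. prb M (\<lambda>\<omega>'. ?good \<omega> \<and> bad_cut H m g (override_on \<omega> \<omega>' ?B)))"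
    by (subst prb_resample[where B = ?B]) (simp only: ovgood)
  also have "\<dots> \<le> ?b1 * ?b2 * ?b3"
  proof (rule mean_le[OF finM])
    fix \<omega>
    show "prb M (\<lambda>\<omega>'. ?good \<omega> \<and> bad_cut H m g (override_on \<omega> \<omega>' ?B)) \<le> ?b1 * ?b2 * ?b3"
    proof (cases "?good \<omega>")
      case False
      then have "prb M (\<lambda>\<omega>'. ?good \<omega> \<and> bad_cut H m g (override_on \<omega> \<omega>' ?B)) = prb M (\<lambda>_. False)"
        by (intro prb_cong) blast
      then show ?thesis by (simp add: prb_def mean_def)
    next
      case True
      have "prb M (\<lambda>\<omega>'. ?good \<omega> \<and> bad_cut H m g (override_on \<omega> \<omega>' ?B)) \<le> prb M (\<lambda>\<omega>'. \<exists>p\<in>Fam \<omega>. NP p \<omega> \<omega>')"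
        by (rule prb_mono) (use step in blast)
      also have "\<dots> \<le> (\<Sum>p\<in>Fam \<omega>. prb M (NP p \<omega>))" by (rule prb_Union[OF finFam])
      also have "\<dots> \<le> (\<Sum>p\<in>Fam \<omega>. ?b3)"
      proof (rule sum_mono)
        fix p assume "p \<in> Fam \<omega>"
        then obtain X A where p: "p = (X, A)" and XA: "X \<subseteq> V" "real (card X) \<le> m" "A \<subseteq> Wh H \<omega> - X"
          "g \<le> real (card A)" "g \<le> real (card (Wh H \<omega> - X - A))"
          by (auto simp: Fam_def Xs_def As_def)
        let ?Bs = "Wh H \<omega> - X - A"
        let ?bad = "{v \<in> V. \<not> (v \<notin> X \<and> h \<le> card {a \<in> A. {v, a} \<in> E}) \<and> \<not> (v \<notin> X \<and> h \<le> card {b \<in> ?Bs. {v, b} \<in> E})}"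
        let ?EX = "{v \<in> V. 2 * h \<le> card {x \<in> X. {v, x} \<in> E}}"
        have fin: "finite X" "finite A" "finite (Wh H \<omega>)" "finite (poor H (4 * real h) \<omega>)"
          using finite_subset[OF XA(1) finite_V] finite_subset[OF Wsub finite_V] XA(3)
          by (auto simp: poor_def finite_V intro: finite_subset)
        \<comment> \<open>The threshold 4h is 2h + h + h: a vertex with more than 4h neighbours in
          \<open>Wh\<close> and fewer than 2h in \<open>X\<close> must have at least h in
          \<open>A\<close> or in \<open>?Bs\<close>.\<close>
        have "?bad \<subseteq> X \<union> poor H (4 * real h) \<omega> \<union> ?EX"
        proof
          fix v assume v: "v \<in> ?bad"
          show "v \<in> X \<union> poor H (4 * real h) \<omega> \<union> ?EX"
          proof (rule ccontr)
            assume n: "v \<notin> X \<union> poor H (4 * real h) \<omega> \<union> ?EX"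
            then have "v \<notin> X" "v \<in> V" "4 * h < card {u \<in> V. {v, u} \<in> E \<and> u \<in> Wh H \<omega>}"
              "card {x \<in> X. {v, x} \<in> E} < 2 * h" using v by (auto simp: poor_def not_le)
            moreover have "card {a \<in> A. {v, a} \<in> E} < h" "card {b \<in> ?Bs. {v, b} \<in> E} < h" using v \<open>v \<notin> X\<close> by auto
            moreover have "card {u \<in> V. {v, u} \<in> E \<and> u \<in> Wh H \<omega>} \<le>
                card ({x \<in> X. {v, x} \<in> E} \<union> {a \<in> A. {v, a} \<in> E} \<union> {b \<in> ?Bs. {v, b} \<in> E})"
              using fin by (intro card_mono) auto
            moreover have "\<dots> \<le> card {x \<in> X. {v, x} \<in> E} + card {a \<in> A. {v, a} \<in> E} + card {b \<in> ?Bs. {v, b} \<in> E}"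
              by (meson add_right_mono card_Un_le le_trans)
            ultimately show False by linarith
          qed
        qed
        then have "card ?bad \<le> card (X \<union> poor H (4 * real h) \<omega> \<union> ?EX)"
          using fin finite_V by (intro card_mono) auto
        also have "\<dots> \<le> card X + card (poor H (4 * real h) \<omega>) + card ?EX"
          by (meson add_right_mono card_Un_le le_trans)
        finally have c1: "real (card ?bad) \<le> real (card X) + real (card (poor H (4 * real h) \<omega>)) + real (card ?EX)" by linarith
        \<comment> \<open>Only O(deg * m / h) vertices can have \<open>2 * h\<close> neighbours in
          \<open>X\<close>, by counting the edges at \<open>X\<close>.\<close>
        have "2 * h * card ?EX = (\<Sum>v\<in>?EX. 2 * h)" by simp
        also have "\<dots> \<le> (\<Sum>v\<in>?EX. card {x \<in> X. {v, x} \<in> E})" by (intro sum_mono) auto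
        also have "\<dots> \<le> (\<Sum>v\<in>V. card {x \<in> X. {v, x} \<in> E})" using finite_V by (intro sum_mono2) auto
        also have "\<dots> = deg * card X" by (rule sum_nbrs_swap[OF XA(1)])
        finally have "real (2 * h * card ?EX) \<le> real (deg * card X)" by (simp only: of_nat_le_iff)
        then have "2 * real h * real (card ?EX) \<le> real deg * real (card X)" by simp
        also have "\<dots> \<le> real deg * m" using XA by (intro mult_left_mono) auto
        finally have "real (card ?EX) \<le> real deg * m / (2 * real h)" using h by (simp add: field_simps)
        then have "real (card ?bad) \<le> m + e1 + real deg * m / (2 * real h)" using c1 True XA by linarith
        then have ex': "real deg * real (card ?bad) \<le> g\<^sup>2 / (32 * real C * ?n)"
          using ex mult_left_mono[of "real (card ?bad)" _ "real deg"] by fastforce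
        have "prb M (\<lambda>\<omega>'. \<exists>S. A \<subseteq> S \<and> S \<inter> ?Bs = {} \<and> S \<inter> X = {} \<and> closedX (opn {2, 3, 4} \<omega>') S X) \<le> ?b3"
          unfolding q_def
          by (rule sprinkle) (use \<Lambda> XA Wsub s g deg0 ex' in auto)
        then show "prb M (NP p \<omega>) \<le> ?b3" unfolding NP_def p prod.case .
      qed
      also have "\<dots> = real (card (Fam \<omega>)) * ?b3" by simp
      also have "\<dots> \<le> (?b1 * ?b2) * ?b3"
      proof (rule mult_right_mono)
        have "card (Fam \<omega>) \<le> card (Sigma Xs (As \<omega>))"
          using finXs finAs by (intro card_mono Famsub) auto
        also have "\<dots> = (\<Sum>X\<in>Xs. card (As \<omega> X))" using finXs finAs by simp
        finally have "real (card (Fam \<omega>)) \<le> (\<Sum>X\<in>Xs. real (card (As \<omega> X)))" by (simp flip: of_nat_sum)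
        also have "\<dots> \<le> (\<Sum>X\<in>Xs. ?b2)"
        proof (rule sum_mono)
          fix X assume X: "X \<in> Xs"
          show "real (card (As \<omega> X)) \<le> ?b2"
            unfolding As_def Wh_def
            by (rule card_closed_pieces[OF opn_sub _ H]) (use X True in \<open>auto simp: Xs_def sparse_touch_def\<close>)
        qed
        also have "\<dots> = real (card Xs) * ?b2" by simp
        also have "\<dots> \<le> ?b1 * ?b2"
          unfolding Xs_def by (intro mult_right_mono card_small_subsets finite_V a m) auto
        finally show "real (card (Fam \<omega>)) \<le> ?b1 * ?b2" .
      qed simp
      finally show ?thesis .
    qed
  qed
  finally show ?thesis .
qed

lemma prb_not_sparse_touch:
  assumes \<Lambda>: "{0, 1} \<subseteq> \<Lambda>" and m: "0 \<le> m" and a: "0 < a" "a \<le> 1"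
  shows "prb M (\<lambda>\<omega>. \<not> sparse_touch m z \<omega>) \<le>
    exp (a * real (card V) + m * ln (1 / a)) * exp (2 * pL {0, 1} * (m * real deg) - z)"
proof -
  let ?Xs = "{X. X \<subseteq> V \<and> real (card X) \<le> m}"
  have finXs: "finite ?Xs" using finite_V by auto
  have "prb M (\<lambda>\<omega>. \<not> sparse_touch m z \<omega>) \<le> prb M (\<lambda>\<omega>. \<exists>X\<in>?Xs. z \<le> real (card {e \<in> opn {0, 1} \<omega>. e \<inter> X \<noteq> {}}))"
    by (rule prb_mono) (auto simp: sparse_touch_def intro: less_imp_le)
  also have "\<dots> \<le> (\<Sum>X\<in>?Xs. prb M (\<lambda>\<omega>. z \<le> real (card {e \<in> opn {0, 1} \<omega>. e \<inter> X \<noteq> {}})))"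
    by (rule prb_Union[OF finXs])
  also have "\<dots> \<le> (\<Sum>X\<in>?Xs. exp (2 * pL {0, 1} * (m * real deg) - z))"
  proof (rule sum_mono)
    fix X assume X: "X \<in> ?Xs"
    have "prb M (\<lambda>\<omega>. z \<le> real (card {e \<in> opn {0, 1} \<omega>. e \<inter> X \<noteq> {}})) \<le> exp (2 * pL {0, 1} * real (card X * deg) - z)"
      using X by (intro prb_touching \<Lambda>) auto
    also have "\<dots> \<le> exp (2 * pL {0, 1} * (m * real deg) - z)"
      using X pL_bounds[OF \<Lambda>] by (auto intro!: mult_left_mono mult_right_mono)
    finally show "prb M (\<lambda>\<omega>. z \<le> real (card {e \<in> opn {0, 1} \<omega>. e \<inter> X \<noteq> {}})) \<le> exp (2 * pL {0, 1} * (m * real deg) - z)" .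
  qed
  also have "\<dots> = real (card ?Xs) * exp (2 * pL {0, 1} * (m * real deg) - z)" by simp
  also have "\<dots> \<le> exp (a * real (card V) + m * ln (1 / a)) * exp (2 * pL {0, 1} * (m * real deg) - z)"
    by (intro mult_right_mono card_small_subsets finite_V a m) auto
  finally show ?thesis .
qed

end

section \<open>The law of the union of layers and its components\<close>

context percolated_product
begin

text \<open>In both models the edges are present independently with probability \<open>p\<close>,
  and \<open>prb_random_subset\<close> shows that this determines the law of the edge set.\<close>

lemma percolation_eq_layers:
  assumes p: "pL L = p" "0 \<le> p" "p \<le> 1" and L: "L \<subseteq> \<Lambda>"
  shows "percolation (cartesian_product T Gs) p = map_pmf (\<lambda>\<omega>. \<lparr>verts = V, edges = opn L \<omega>\<rparr>) M"
proof -
  interpret fl: fin_product E False "\<lambda>_. bernoulli_pmf p"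
    by unfold_locales (use finE in auto)
  have "map_pmf (\<lambda>\<omega>. {e \<in> E. \<omega> e}) fl.M = map_pmf (opn L) M"
  proof (rule pmf_eqI)
    fix F
    have "prb fl.M (\<lambda>\<omega>. {e\<in>E. \<omega> e} = F) = (if F \<subseteq> E then \<Prod>e\<in>E. if e \<in> F then p else 1 - p else 0)"
    proof (rule fl.prb_random_subset[where B = "\<lambda>e. {e}"])
      fix e assume e: "e \<in> E"
      have "prb fl.M (\<lambda>\<omega>. \<omega> e) = mean (map_pmf (\<lambda>\<omega>. \<omega> e) fl.M) of_bool"
        by (simp add: mean_map[OF fl.finM] prb_def)
      also have "map_pmf (\<lambda>\<omega>. \<omega> e) fl.M = bernoulli_pmf p"
        using e finE by (subst Pi_pmf_component) auto
      finally show "prb fl.M (\<lambda>\<omega>. \<omega> e) = p" using p by (simp add: mean_bernoulli)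
    qed (use finE in \<open>auto intro!: dep_onI\<close>)
    also have "\<dots> = prb M (\<lambda>\<omega>. {e\<in>E. e \<in> opn L \<omega>} = F)"
      by (rule prb_random_subset[where B = "\<lambda>e. {e} \<times> L", symmetric])
        (use finE dep_opn prb_opn[OF _ L] p in auto)
    also have "\<dots> = prb M (\<lambda>\<omega>. opn L \<omega> = F)"
      using opn_sub by (intro prb_cong) (metis Collect_mem_eq Collect_conj_eq inf.absorb2)
    finally show "pmf (map_pmf (\<lambda>\<omega>. {e \<in> E. \<omega> e}) fl.M) F = pmf (map_pmf (opn L) M) F"
      unfolding fl.pmf_map_prb pmf_map_prb .
  qed
  then have "map_pmf (\<lambda>F. \<lparr>verts = V, edges = F\<rparr>) (map_pmf (\<lambda>\<omega>. {e \<in> E. \<omega> e}) fl.M) =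
      map_pmf (\<lambda>F. \<lparr>verts = V, edges = F\<rparr>) (map_pmf (opn L) M)" by (rule arg_cong)
  moreover have "verts (cartesian_product T Gs) = V" "edges (cartesian_product T Gs) = E"
    by (simp_all add: V_def E_def cartesian_product_def)
  ultimately show ?thesis unfolding percolation_def by (simp add: pmf.map_comp o_def)
qed

lemma component_eq:
  assumes "F \<subseteq> E" "v \<in> V"
  shows "{u \<in> V. reachable \<lparr>verts = V, edges = F\<rparr> v u} = expl F {v} V"
proof -
  have "(\<lambda>u v. {u, v} \<in> F) = (\<lambda>u v. {u, v} \<in> F \<and> v \<in> V)"
    using assms(1) E_iff by (intro ext) blast
  then have "reachable \<lparr>verts = V, edges = F\<rparr> v u \<longleftrightarrow> u \<in> expl F {v} V" for u
    by (simp add: reachable_def expl_def)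
  then show ?thesis using expl_sub[of F "{v}" V] assms(2) by auto
qed

section \<open>Extracting the expander\<close>

text \<open>Take a smallest union of components containing at least \<open>g\<close> vertices of
  \<open>W\<close>. Outside it fewer than \<open>g\<close> remain by \<open>nocut\<close>, and after
  removing one of its components fewer than \<open>g\<close> remain inside by minimality; so that
  component carries the rest of \<open>W\<close>.\<close>

lemma exists_dominating_component:
  assumes F: "F \<subseteq> E" and W: "W \<subseteq> V" and g: "0 < g" "g \<le> real (card W)"
    and nocut: "\<And>S. S \<subseteq> V \<Longrightarrow> closedX F S {} \<Longrightarrow> g \<le> real (card (S \<inter> W)) \<Longrightarrow> real (card (W - S)) < g"
  shows "\<exists>v\<in>V. real (card W) - 2 * g \<le> real (card (expl F {v} V))"
proof -
  let ?P = "\<lambda>S. S \<subseteq> V \<and> closedX F S {} \<and> g \<le> real (card (S \<inter> W))"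
  have "V \<inter> W = W" using W by auto
  moreover have "closedX F V {}" using F E_iff unfolding closedX_def by blast
  ultimately have "?P V" using g by simp
  then obtain S where S: "?P S" and min: "\<And>S'. ?P S' \<Longrightarrow> card S \<le> card S'"
    using ex_has_least_nat[of ?P V card] by blast
  have finS: "finite S" using S finite_V finite_subset by blast
  have finW: "finite W" using W finite_V finite_subset by blast
  have "S \<noteq> {}" using S g by auto
  then obtain v where v: "v \<in> S" by auto
  then have vV: "v \<in> V" using S by auto
  let ?c = "expl F {v} V"
  have cS: "?c \<subseteq> S"
    by (rule expl_least) (use v S in \<open>auto simp: closedX_def\<close>)
  have vc: "v \<in> ?c" using expl_base[of "{v}" F V] by auto
  have "closedX F (S - ?c) {}"
    unfolding closedX_def
  proof (intro ballI allI impI)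
    fix y w assume y: "y \<in> S - ?c" and e: "{y, w} \<in> F"
    have "w \<in> S" using S y e unfolding closedX_def by blast
    moreover have "w \<notin> ?c"
    proof
      assume "w \<in> ?c"
      moreover have "{w, y} \<in> F" "y \<in> V" using e y S by (auto simp: insert_commute)
      ultimately have "y \<in> ?c" by (rule expl_step)
      then show False using y by auto
    qed
    ultimately show "w \<in> S - ?c \<union> {}" by auto
  qed
  moreover have "card (S - ?c) < card S" using finS vc v by (intro psubset_card_mono) auto
  ultimately have less: "real (card ((S - ?c) \<inter> W)) < g" using min[of "S - ?c"] S by force
  have "card W \<le> card ((W - S) \<union> ((S - ?c) \<inter> W) \<union> ?c)"
    using finW finS cS by (intro card_mono) (auto intro: finite_subset)
  also have "\<dots> \<le> card (W - S) + card ((S - ?c) \<inter> W) + card ?c"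
    by (meson add_right_mono card_Un_le le_trans)
  finally have "real (card W) \<le> real (card (W - S)) + real (card ((S - ?c) \<inter> W)) + real (card ?c)" by linarith
  then show ?thesis using less nocut[of S] S vV by (intro bexI[of _ v]) auto
qed

text \<open>Let Z be a largest non-expanding set of size at most \<gamma>. If S failed in the graph
  without Z, then Z \<union> S would be non-expanding too, hence larger than \<gamma>; as S is at
  most half of the rest, Z \<union> S is balanced, so its boundary exceeds m, and m \<ge> \<alpha> n
  gives a contradiction. The bound on \<gamma> allows for \<open>g\<close>, the deleted boundary and
  the vertices outside \<open>Wh H \<omega>\<close>.\<close>

lemma expanding_subgraph:
  assumes F: "F = opn {0, 1, 2, 3, 4} \<omega>" and nb: "\<not> bad_cut H m g \<omega>" and K: "K \<le> H"
    and w: "w \<le> real (card (Wh H \<omega>))" and y: "real (card (big K F)) \<le> y"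
    and g: "0 < g" "g \<le> w" and m: "0 \<le> m" and K2: "real K \<le> w - 2 * g"
    and \<gamma>: "0 \<le> \<gamma>" "g + m + (y - w) \<le> \<gamma>" "3 * \<gamma> \<le> w - 2 * g"
    and \<alpha>: "0 \<le> \<alpha>" "\<alpha> * real (card V) \<le> m"
    and L1: "largest_component \<lparr>verts = V, edges = F\<rparr> L1"
  shows "\<exists>Hg. is_subgraph Hg L1 \<and> w - 2 * g - \<gamma> \<le> real (card (verts Hg)) \<and>
    (\<forall>S. S \<subseteq> verts Hg \<and> real (card S) \<le> real (card (verts Hg)) / 2 \<longrightarrow>
      \<alpha> * real (card S) \<le> real (card (nbhd Hg S)))"
proof -
  let ?G = "\<lparr>verts = V, edges = F\<rparr>"
  let ?W = "Wh H \<omega>"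
  have FE: "F \<subseteq> E" unfolding F by (rule opn_sub)
  have WV: "?W \<subseteq> V" by (auto simp: Wh_def big_def)
  have finW: "finite ?W" using WV finite_V finite_subset by blast
  obtain v0 where v0: "v0 \<in> V" and L1v: "L1 = induced_subgraph ?G (expl F {v0} V)"
    using L1 component_eq[OF FE] unfolding largest_component_def graph_components_def by auto
  define c0 where "c0 = expl F {v0} V"
  have L1eq: "L1 = \<lparr>verts = c0, edges = {e \<in> F. e \<subseteq> c0}\<rparr>"
    unfolding L1v induced_subgraph_def c0_def by simp
  have max: "card (expl F {v} V) \<le> card c0" if "v \<in> V" for v
  proof -
    have "induced_subgraph ?G (expl F {v} V) \<in> graph_components ?G"
      using that component_eq[OF FE that] unfolding graph_components_def by (auto intro!: image_eqI[of _ _ v])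
    then have "card (verts (induced_subgraph ?G (expl F {v} V))) \<le> card (verts L1)"
      using L1 unfolding largest_component_def by blast
    then show ?thesis by (simp add: L1eq induced_subgraph_def)
  qed
  have c0V: "c0 \<subseteq> V" using expl_sub[of F "{v0}" V] v0 by (auto simp: c0_def)
  have finc0: "finite c0" using c0V finite_V finite_subset by blast
  have c0closed: "v \<in> c0" if "u \<in> c0" "{u, v} \<in> F" for u v
    using that FE E_iff unfolding c0_def by (blast intro: expl_step)
  have cut: False if "X \<subseteq> V" "real (card X) \<le> m" "S \<subseteq> V" "S \<inter> X = {}" "closedX F S X"
     "g \<le> real (card (S \<inter> ?W))" "g \<le> real (card (?W - S - X))" for X S
    using nb that unfolding bad_cut_def F by blast
  have "\<exists>v\<in>V. real (card ?W) - 2 * g \<le> real (card (expl F {v} V))"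
  proof (rule exists_dominating_component[OF FE WV g(1)])
    show "g \<le> real (card ?W)" using g w by linarith
    fix S assume "S \<subseteq> V" "closedX F S {}" "g \<le> real (card (S \<inter> ?W))"
    then show "real (card (?W - S)) < g" using cut[of "{}" S] m by (auto simp: not_le[symmetric])
  qed
  then have c0w: "w - 2 * g \<le> real (card c0)" using max w by force
  \<comment> \<open>Both sets lie in \<open>big K F\<close>: the first by \<open>K \<le> H\<close>,
    the component by its size. Hence the upper bound \<open>y\<close> limits the part of the
    component outside \<open>?W\<close> to y - w.\<close>
  have sub: "?W \<union> c0 \<subseteq> big K F"
  proof
    fix u assume "u \<in> ?W \<union> c0"
    then show "u \<in> big K F"
    proof
      assume "u \<in> ?W"
      moreover have "big H (opn {0, 1} \<omega>) \<subseteq> big K F"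
        unfolding F using K by (intro big_mono opn_mono) auto
      ultimately show ?thesis unfolding Wh_def by auto
    next
      assume u: "u \<in> c0"
      then have "expl F {u} V = c0" unfolding c0_def by (intro expl_eq v0)
      moreover have "K \<le> card c0" using c0w K2 by linarith
      ultimately show ?thesis using u c0V by (auto simp: big_def)
    qed
  qed
  have "card (c0 - ?W) \<le> card (big K F - ?W)" using sub finite_big by (intro card_mono) auto
  also have "\<dots> = card (big K F) - card ?W" using sub finW by (intro card_Diff_subset) auto
  finally have "card (c0 - ?W) + card ?W \<le> card (big K F)"
    using card_mono[OF finite_big, of ?W K F] sub by auto
  then have c0W: "real (card (c0 - ?W)) \<le> y - w" using y w by linarith
  have inter: "real (card A) - (y - w) \<le> real (card (A \<inter> ?W))" if "A \<subseteq> c0" for A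
  proof -
    have finA: "finite A" using that finc0 finite_subset by blast
    have "card A \<le> card ((A \<inter> ?W) \<union> (c0 - ?W))" using that finc0 finA by (intro card_mono) auto
    also have "\<dots> \<le> card (A \<inter> ?W) + card (c0 - ?W)" by (rule card_Un_le)
    finally show ?thesis using c0W by linarith
  qed
  have expand: "m < real (card (nbhd L1 S))" if S: "S \<subseteq> c0" "\<gamma> \<le> real (card S)" "\<gamma> \<le> real (card (c0 - S))" for S
  proof (rule ccontr)
    let ?X = "nbhd L1 S"
    assume "\<not> m < real (card ?X)"
    then have Xm: "real (card ?X) \<le> m" by simp
    have X: "?X \<subseteq> c0" "S \<inter> ?X = {}" by (auto simp: nbhd_def L1eq)
    have finX: "finite ?X" using X finc0 finite_subset by blast
    have cl: "closedX F S ?X"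
      unfolding closedX_def
    proof (intro ballI allI impI)
      fix y v assume y: "y \<in> S" and e: "{y, v} \<in> F"
      then have "v \<in> c0" using c0closed S(1) by blast
      then show "v \<in> S \<union> ?X" using y e S(1) unfolding nbhd_def L1eq by auto
    qed
    have "card ((c0 - S) \<inter> ?W) \<le> card ((?W - S - ?X) \<union> ?X)"
      using finW finX by (intro card_mono) auto
    also have "\<dots> \<le> card (?W - S - ?X) + card ?X" by (rule card_Un_le)
    finally have "real (card ((c0 - S) \<inter> ?W)) \<le> real (card (?W - S - ?X)) + m" using Xm by linarith
    moreover have "\<gamma> - (y - w) \<le> real (card ((c0 - S) \<inter> ?W))" using inter[of "c0 - S"] S(3) by auto
    moreover have "\<gamma> - (y - w) \<le> real (card (S \<inter> ?W))" using inter[OF S(1)] S(2) by auto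
    ultimately have "g \<le> real (card (S \<inter> ?W))" "g \<le> real (card (?W - S - ?X))" using \<gamma> m by linarith+
    then show False using cut[OF _ Xm _ X(2) cl] X(1) S(1) c0V by auto
  qed
  let ?P = "\<lambda>Z. Z \<subseteq> c0 \<and> real (card Z) \<le> \<gamma> \<and> real (card (nbhd L1 Z)) \<le> \<alpha> * real (card Z)"
  have "?P {}" using \<gamma> by (simp add: nbhd_def)
  moreover have "\<forall>Z. ?P Z \<longrightarrow> card Z < Suc (card c0)" using finc0 by (auto simp: less_Suc_eq_le card_mono)
  ultimately obtain Z where Z: "?P Z" and Zmax: "\<And>Z'. ?P Z' \<Longrightarrow> card Z' \<le> card Z"
    using ex_has_greatest_nat[of ?P "{}" card "Suc (card c0)"] by (metis less_imp_le)
  have finZ: "finite Z" using Z finc0 finite_subset by blast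
  let ?H = "\<lparr>verts = c0 - Z, edges = {e \<in> F. e \<subseteq> c0 - Z}\<rparr>"
  have cH: "real (card (c0 - Z)) = real (card c0) - real (card Z)"
    using Z finZ finc0 by (simp add: card_Diff_subset card_mono of_nat_diff)
  have "is_subgraph ?H L1"
    unfolding is_subgraph_def simple_graph_def L1eq using finc0 FE E_simple by auto
  moreover have "w - 2 * g - \<gamma> \<le> real (card (verts ?H))" using cH c0w Z by auto
  moreover have "\<alpha> * real (card S) \<le> real (card (nbhd ?H S))"
    if S: "S \<subseteq> c0 - Z" "real (card S) \<le> real (card (c0 - Z)) / 2" for S
  proof (rule ccontr)
    assume "\<not> ?thesis"
    then have less: "real (card (nbhd ?H S)) < \<alpha> * real (card S)" by simp
    have finS: "finite S" using S finc0 finite_subset by blast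
    have cZS: "card (Z \<union> S) = card Z + card S" using S finZ finS by (intro card_Un_disjoint) auto
    have fin: "finite (nbhd L1 Z)" "finite (nbhd ?H S)" using finc0 by (auto simp: nbhd_def L1eq)
    have "nbhd L1 (Z \<union> S) \<subseteq> nbhd L1 Z \<union> nbhd ?H S"
      using S(1) unfolding nbhd_def L1eq by auto
    then have "card (nbhd L1 (Z \<union> S)) \<le> card (nbhd L1 Z \<union> nbhd ?H S)" using fin by (intro card_mono) auto
    also have "\<dots> \<le> card (nbhd L1 Z) + card (nbhd ?H S)" by (rule card_Un_le)
    finally have "real (card (nbhd L1 (Z \<union> S))) \<le> \<alpha> * real (card Z) + \<alpha> * real (card S)"
      using Z less by linarith
    then have nZS: "real (card (nbhd L1 (Z \<union> S))) \<le> \<alpha> * real (card (Z \<union> S))"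
      unfolding cZS by (simp add: algebra_simps)
    have ZSc: "Z \<union> S \<subseteq> c0" using Z S by auto
    have "S \<noteq> {}" using less by (auto simp: nbhd_def)
    then have "card Z < card (Z \<union> S)" using cZS finS by (simp add: card_gt_0_iff)
    then have "\<gamma> < real (card (Z \<union> S))" using Zmax[of "Z \<union> S"] nZS ZSc by force
    \<comment> \<open>At least half of \<open>c0 - Z\<close> survives, that is at least (3\<gamma> -
      \<gamma>) / 2; this is the reason for the factor 3 in the hypothesis on \<gamma>.\<close>
    moreover have "\<gamma> \<le> real (card (c0 - (Z \<union> S)))"
    proof -
      have "real (card (c0 - (Z \<union> S))) = real (card c0) - real (card (Z \<union> S))"
        using ZSc finZ finS finc0 by (simp add: card_Diff_subset card_mono of_nat_diff)
      then show ?thesis using cZS S(2) cH c0w \<gamma>(3) Z by auto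
    qed
    ultimately have "m < real (card (nbhd L1 (Z \<union> S)))" by (intro expand ZSc) auto
    also note nZS
    also have "\<alpha> * real (card (Z \<union> S)) \<le> \<alpha> * real (card V)"
      using \<alpha> ZSc c0V finite_V by (intro mult_left_mono of_nat_mono card_mono) auto
    also note \<alpha>(2)
    finally show False by simp
  qed
  ultimately show ?thesis by (intro exI[of _ ?H]) auto
qed

end

section \<open>The supercritical regime\<close>

text \<open>(1 - x + x^2 / 2) (1 + x + x^2 / 2) = 1 + x^4 / 4 \<ge> 1, and the second factor is at
  most exp x.\<close>

lemma exp_minus_upper: "0 \<le> x \<Longrightarrow> exp (- x) \<le> 1 - x + x\<^sup>2 / 2" for x :: real
proof -
  assume x: "0 \<le> x"
  have "1 + x + x\<^sup>2 / 2 \<le> exp x" by (rule exp_lower_Taylor_quadratic[OF x])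
  moreover have pos: "0 < 1 - x + x\<^sup>2 / 2" using sum_power2_gt_zero_iff[of "1 - x" 1] by (simp add: power2_eq_square algebra_simps)
  ultimately have "(1 - x + x\<^sup>2 / 2) * (1 + x + x\<^sup>2 / 2) \<le> (1 - x + x\<^sup>2 / 2) * exp x"
    by (intro mult_left_mono) auto
  moreover have "(1 - x + x\<^sup>2 / 2) * (1 + x + x\<^sup>2 / 2) = 1 + x ^ 4 / 4"
    by (simp add: algebra_simps power2_eq_square power4_eq_xxxx)
  ultimately have "1 \<le> (1 - x + x\<^sup>2 / 2) * exp x" by (simp add: order_trans[rotated])
  then show ?thesis by (simp add: exp_minus divide_simps)
qed

text \<open>The difference vanishes at 0, and \<open>exp_minus_upper\<close> says that its
  derivative is nonnegative.\<close>

lemma exp_minus_lower: "0 \<le> x \<Longrightarrow> 1 - x + x\<^sup>2 / 2 - x ^ 3 / 6 \<le> exp (- x)" for x :: real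
proof -
  assume x: "0 \<le> x"
  define f where "f = (\<lambda>x::real. exp (- x) - (1 - x + x\<^sup>2 / 2 - x ^ 3 / 6))"
  have "f 0 \<le> f x"
  proof (rule DERIV_nonneg_imp_nondecreasing[OF x])
    fix y :: real assume y: "0 \<le> y" "y \<le> x"
    have "(f has_real_derivative (1 - y + y\<^sup>2 / 2 - exp (- y))) (at y)"
      unfolding f_def by (auto intro!: derivative_eq_intros simp: power2_eq_square)
    then show "\<exists>D. (f has_real_derivative D) (at y) \<and> 0 \<le> D" using exp_minus_upper[OF y(1)] by auto
  qed
  then show ?thesis by (simp add: f_def)
qed

lemma one_minus_power_le: "0 \<le> y \<Longrightarrow> y \<le> 1 \<Longrightarrow> (1 - y) ^ D \<le> exp (- (real D * y))" for y :: real
proof -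
  assume "0 \<le> y" "y \<le> 1"
  then have "(1 - y) ^ D \<le> exp (- y) ^ D" using exp_ge_add_one_self[of "- y"] by (intro power_mono) auto
  then show ?thesis by (simp flip: exp_of_nat_mult)
qed

locale supercritical = product_graph T Gs k C
  for T :: "'i set" and Gs :: "'i \<Rightarrow> 'a ugraph" and k C +
  fixes \<epsilon> :: real
  assumes eps: "0 < \<epsilon>" "\<epsilon> \<le> 1 / 1000" and deg2: "2 \<le> deg"
begin

definition d :: real where "d = real deg"
definition n :: real where "n = real (card V)"
text \<open>\<open>pr 0\<close> solves \<open>1 - (1 - pr 0) * (1 - s) ^ 4 = p\<close>, so that the union of the five layers has
  density \<open>p\<close>.\<close>

definition p :: real where "p = (1 + \<epsilon>) / d"
definition s :: real where "s = \<epsilon> / 1000 / d"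
definition pr :: "nat \<Rightarrow> real" where "pr l = (if l = 0 then 1 - (1 - p) / (1 - s) ^ 4 else s)"

lemma d_ge: "2 \<le> d" using deg2 by (simp add: d_def)

lemma n_pos: "0 < n" using V_pos by (simp add: n_def)

lemma s_bounds: "0 < s" "s < 1" "s * d = \<epsilon> / 1000"
  using d_ge eps by (auto simp: s_def field_simps)

lemma p_bounds: "0 \<le> p" "p < 1" "p * d = 1 + \<epsilon>"
  using d_ge eps by (auto simp: p_def field_simps)

lemma pr0: "(1 + 996 / 1000 * \<epsilon>) / d \<le> pr 0" "pr 0 \<le> p"
proof -
  have "(1 - s) ^ 4 \<le> 1" "0 < (1 - s) ^ 4" using s_bounds by (auto intro: power_le_one)
  then have "1 - p \<le> (1 - p) / (1 - s) ^ 4"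
    using p_bounds mult_left_le[of "(1 - s) ^ 4" "1 - p"] by (simp add: pos_le_divide_eq)
  then show "pr 0 \<le> p" by (simp add: pr_def)
  have "1 - 4 * s \<le> (1 - s) ^ 4" using Bernoulli_inequality[of "- s" 4] s_bounds by simp
  \<comment> \<open>996 / 1000 = 1 - 4 / 1000: the four sprinkled layers cost at most
    \<open>4 * s\<close> of the density.\<close>
  have q: "(1 + 996 / 1000 * \<epsilon>) / d = p - 4 * s" using d_ge by (simp add: p_def s_def field_simps)
  have "4 * s * d \<le> p * d" using s_bounds(3) p_bounds(3) eps by (simp add: mult.assoc)
  then have ps: "4 * s \<le> p" using d_ge by simp
  have "1 - p \<le> (1 - 4 * s) * (1 - p + 4 * s)"
  proof -
    have "(1 - 4 * s) * (1 - p + 4 * s) = (1 - p) + 4 * s * (p - 4 * s)" by (simp add: algebra_simps)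
    moreover have "0 \<le> 4 * s * (p - 4 * s)" using ps s_bounds by (intro mult_nonneg_nonneg) auto
    ultimately show ?thesis by linarith
  qed
  also have "\<dots> \<le> (1 - s) ^ 4 * (1 - p + 4 * s)"
    using \<open>1 - 4 * s \<le> (1 - s) ^ 4\<close> p_bounds s_bounds by (intro mult_right_mono) auto
  finally have "(1 - p) / (1 - s) ^ 4 \<le> 1 - p + 4 * s"
    using \<open>0 < (1 - s) ^ 4\<close> by (simp add: field_simps)
  then show "(1 + 996 / 1000 * \<epsilon>) / d \<le> pr 0" unfolding q by (simp add: pr_def)
qed

lemma pr_bounds: "0 \<le> pr l" "pr l \<le> 1"
proof -
  have nn: "0 \<le> (1 + 996 / 1000 * \<epsilon>) / d" using d_ge eps by simp
  have "pr l = pr 0 \<or> pr l = s" by (auto simp: pr_def)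
  then have "0 \<le> pr l \<and> pr l \<le> 1"
    using nn pr0 p_bounds s_bounds by (elim disjE) linarith+
  then show "0 \<le> pr l" "pr l \<le> 1" by auto
qed

sublocale percolated_product T Gs k C "{0, 1, 2, 3, 4}" pr
  by unfold_locales (use finite_V E_simple pr_bounds in auto)

lemma pr_s: "pr 1 = s" "pr (Suc 0) = s" "pr 2 = s" "pr 3 = s" "pr 4 = s" by (simp_all add: pr_def)

lemma pL_all: "pL {0, 1, 2, 3, 4} = p"
proof -
  have "(1 - s) ^ 4 \<noteq> 0" using s_bounds by simp
  then show ?thesis by (simp add: pL_def pr_def power4_eq_xxxx)
qed

lemma pL_01: "pL {0, 1} \<le> 2 / d"
proof -
  have "pL {0, 1} = pr 0 + s - pr 0 * s" by (simp add: pL_def pr_s algebra_simps)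
  also have "\<dots> \<le> p + s" using pr0(2) mult_nonneg_nonneg[of "pr 0" s] pr_bounds[of 0] s_bounds by linarith
  also have "\<dots> = (1 + \<epsilon> + \<epsilon> / 1000) / d" by (simp add: p_def s_def add_divide_distrib)
  also have "\<dots> \<le> 2 / d" using d_ge eps by (intro divide_right_mono) auto
  finally show ?thesis .
qed

lemma sum_pr: "(\<Sum>l\<in>{0, 1, 2, 3, 4}. pr l) \<le> 2 / d"
proof -
  have "(\<Sum>l\<in>{0, 1, 2, 3, 4}. pr l) = pr 0 + 4 * s" by (simp add: pr_s numeral_eq_Suc) (simp add: pr_def)
  also have "\<dots> \<le> p + 4 * s" using pr0 by simp
  also have "\<dots> = (1 + \<epsilon> + 4 * \<epsilon> / 1000) / d" by (simp add: p_def s_def add_divide_distrib)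
  also have "\<dots> \<le> 2 / d" using d_ge eps by (intro divide_right_mono) auto
  finally show ?thesis .
qed

lemma vari_big_le: "vari M (\<lambda>\<omega>. real (card (big h (opn L \<omega>)))) \<le> 8 * (real h)\<^sup>2 * n"
proof -
  have "real (card E) * (\<Sum>l\<in>{0, 1, 2, 3, 4}. pr l) \<le> (n * d) * (2 / d)"
    using card_E sum_pr pr_bounds n_pos d_ge
    by (intro mult_mono sum_nonneg) (auto simp: n_def d_def simp flip: of_nat_mult)
  also have "\<dots> = 2 * n" using d_ge by simp
  finally have "4 * (real h)\<^sup>2 * (real (card E) * (\<Sum>l\<in>{0, 1, 2, 3, 4}. pr l)) \<le> 4 * (real h)\<^sup>2 * (2 * n)"
    by (intro mult_left_mono) auto
  then show ?thesis using vari_big[of h L] by linarith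
qed

lemma mean_big: "mean M (\<lambda>\<omega>. real (card (big h (opn L \<omega>)))) = (\<Sum>v\<in>V. prb M (\<lambda>\<omega>. h \<le> card (expl (opn L \<omega>) {v} V)))"
proof -
  have "real (card (big h F)) = (\<Sum>v\<in>V. of_bool (h \<le> card (expl F {v} V)))" for F
    unfolding big_def using finite_V by (simp add: of_bool_def sum.If_cases Int_def)
  then show ?thesis by (simp add: mean_sum prb_def)
qed

lemma big_concentration:
  assumes "0 < a"
  shows "prb M (\<lambda>\<omega>. a * n \<le> \<bar>real (card (big h (opn L \<omega>))) - mean M (\<lambda>\<omega>. real (card (big h (opn L \<omega>))))\<bar>)
    \<le> 8 * (real h)\<^sup>2 / (a\<^sup>2 * n)"
proof -
  have "prb M (\<lambda>\<omega>. a * n \<le> \<bar>real (card (big h (opn L \<omega>))) - mean M (\<lambda>\<omega>. real (card (big h (opn L \<omega>))))\<bar>)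
     \<le> vari M (\<lambda>\<omega>. real (card (big h (opn L \<omega>)))) / (a * n)\<^sup>2"
    using assms n_pos by (intro prb_chebyshev finM) auto
  also have "\<dots> \<le> 8 * (real h)\<^sup>2 * n / (a * n)\<^sup>2"
    by (intro divide_right_mono vari_big_le) auto
  also have "\<dots> = 8 * (real h)\<^sup>2 / (a\<^sup>2 * n)"
    using n_pos assms by (simp add: power2_eq_square field_simps)
  finally show ?thesis .
qed

text \<open>The gap from 1.95 to 1.90 is a Chebyshev deviation of 0.05 \<epsilon> n, and 3200 = 8 /
  0.05^2.\<close>

lemma prb_W_small:
  assumes "\<And>x. x \<in> V \<Longrightarrow> 195 / 100 * \<epsilon> \<le> prb M (\<lambda>\<omega>. H \<le> card (expl (opn {0, 1} \<omega>) {x} V))"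
  shows "prb M (\<lambda>\<omega>. real (card (Wh H \<omega>)) < 190 / 100 * \<epsilon> * n) \<le> 3200 * (real H)\<^sup>2 / (\<epsilon>\<^sup>2 * n)"
proof -
  let ?f = "\<lambda>\<omega>. real (card (big H (opn {0, 1} \<omega>)))"
  have "(\<Sum>x\<in>V. 195 / 100 * \<epsilon>) \<le> mean M ?f"
    unfolding mean_big by (intro sum_mono assms)
  then have m: "195 / 100 * \<epsilon> * n \<le> mean M ?f" by (simp add: n_def mult_ac)
  have "prb M (\<lambda>\<omega>. real (card (Wh H \<omega>)) < 190 / 100 * \<epsilon> * n) \<le> prb M (\<lambda>\<omega>. (5 / 100 * \<epsilon>) * n \<le> \<bar>?f \<omega> - mean M ?f\<bar>)"
  proof (rule prb_mono)
    fix \<omega> assume "real (card (Wh H \<omega>)) < 190 / 100 * \<epsilon> * n"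
    then have "?f \<omega> < 190 / 100 * \<epsilon> * n" by (simp add: Wh_def)
    then show "(5 / 100 * \<epsilon>) * n \<le> \<bar>?f \<omega> - mean M ?f\<bar>" using m by (simp add: algebra_simps)
  qed
  also have "\<dots> \<le> 8 * (real H)\<^sup>2 / ((5 / 100 * \<epsilon>)\<^sup>2 * n)" by (rule big_concentration) (use eps in simp)
  also have "\<dots> = 3200 * (real H)\<^sup>2 / (\<epsilon>\<^sup>2 * n)" by (simp add: power2_eq_square)
  finally show ?thesis .
qed

text \<open>Here the deviation is 0.04 \<epsilon> n, from 2.06 to 2.10, and 5000 = 8 /
  0.04^2.\<close>

lemma prb_big_large:
  assumes "\<And>x. x \<in> V \<Longrightarrow> prb M (\<lambda>\<omega>. K \<le> card (expl (opn {0, 1, 2, 3, 4} \<omega>) {x} V)) \<le> 206 / 100 * \<epsilon>"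
  shows "prb M (\<lambda>\<omega>. 210 / 100 * \<epsilon> * n < real (card (big K (opn {0, 1, 2, 3, 4} \<omega>)))) \<le> 5000 * (real K)\<^sup>2 / (\<epsilon>\<^sup>2 * n)"
proof -
  let ?f = "\<lambda>\<omega>. real (card (big K (opn {0, 1, 2, 3, 4} \<omega>)))"
  have "mean M ?f \<le> (\<Sum>x\<in>V. 206 / 100 * \<epsilon>)"
    unfolding mean_big by (intro sum_mono assms)
  then have m: "mean M ?f \<le> 206 / 100 * \<epsilon> * n" by (simp add: n_def mult_ac)
  have "prb M (\<lambda>\<omega>. 210 / 100 * \<epsilon> * n < ?f \<omega>) \<le> prb M (\<lambda>\<omega>. (4 / 100 * \<epsilon>) * n \<le> \<bar>?f \<omega> - mean M ?f\<bar>)"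
  proof (rule prb_mono)
    fix \<omega> assume "210 / 100 * \<epsilon> * n < ?f \<omega>"
    then show "(4 / 100 * \<epsilon>) * n \<le> \<bar>?f \<omega> - mean M ?f\<bar>" using m by (simp add: algebra_simps)
  qed
  also have "\<dots> \<le> 8 * (real K)\<^sup>2 / ((4 / 100 * \<epsilon>)\<^sup>2 * n)" by (rule big_concentration) (use eps in simp)
  also have "\<dots> = 5000 * (real K)\<^sup>2 / (\<epsilon>\<^sup>2 * n)" by (simp add: power2_eq_square)
  finally show ?thesis .
qed

text \<open>The effective mean offspring is at least \<lambda> = 1 + 0.99 \<epsilon>, and
  \<open>growth\<close> accepts \<theta> once \<lambda> (1 - exp (- \<theta>)) \<ge> \<theta>. To
  second order this means \<theta> \<le> 1.98 \<epsilon>, whence the choice 1.97 \<epsilon>.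
  \<open>J\<close> holds the markers spent on growth and \<open>J'\<close> those frozen by the
  caller; together with \<open>m\<close> they cost at most 3 / 1000 of \<epsilon> d.\<close>

lemma survival:
  assumes J: "J \<subseteq> T" "J' \<subseteq> T" "J \<inter> J' = {}"
    and cJ: "real C * real (card J) \<le> \<epsilon> / 1000 * d" "real C * real (card J') \<le> \<epsilon> / 1000 * d"
    and m: "real m \<le> \<epsilon> / 1000 * d" and x: "x \<in> V"
  shows "196 / 100 * \<epsilon> - exp (z - 98 / 100 * \<epsilon> * (1 - exp (- (s / 2) * real m)) * real (card J)) \<le>
    prb M (\<lambda>\<omega>. z * real m \<le> real (card (expl (opn {0, 1} \<omega>) {x} (box x (T - J')))))"
proof -
  let ?\<theta> = "197 / 100 * \<epsilon>"
  let ?I = "T - J'"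
  let ?\<rho> = "1 - exp (- ?\<theta>)"
  have \<theta>: "?\<theta> - ?\<theta>\<^sup>2 / 2 \<le> ?\<rho>" using exp_minus_upper[of ?\<theta>] eps by simp
  have e2: "\<epsilon> * \<epsilon> \<le> \<epsilon> / 1000" using eps mult_left_mono[of \<epsilon> "1/1000" \<epsilon>] by simp
  have "?\<theta>\<^sup>2 / 2 = 38809 / 20000 * (\<epsilon> * \<epsilon>)" by (simp add: power2_eq_square)
  then have \<rho>: "196 / 100 * \<epsilon> \<le> ?\<rho>" using \<theta> e2 eps by linarith
  have sumI: "(\<Sum>j\<in>?I - J. k j) + (C * card J + C * card J') \<ge> deg"
  proof -
    have "deg = (\<Sum>j\<in>(?I - J) \<union> (J \<union> J'). k j)" unfolding deg_def using J by (intro sum.cong) auto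
    also have "\<dots> = (\<Sum>j\<in>?I - J. k j) + (\<Sum>j\<in>J \<union> J'. k j)"
      using J finT by (intro sum.union_disjoint) (auto intro: finite_subset)
    also have "(\<Sum>j\<in>J \<union> J'. k j) = (\<Sum>j\<in>J. k j) + (\<Sum>j\<in>J'. k j)"
      using J finT by (intro sum.union_disjoint) (auto intro: finite_subset)
    also have "\<dots> \<le> C * card J + C * card J'" using J by (intro add_mono sum_k_le)
    finally show ?thesis by linarith
  qed
  define D where "D = deg - (C * card J + C * card J' + m)"
  have lt: "real (C * card J + C * card J' + m) \<le> 3 * (\<epsilon> / 1000 * d)" using cJ m by simp
  also have "\<dots> \<le> d" using d_ge eps by (simp add: mult_left_le_one_le)
  finally have le: "C * card J + C * card J' + m \<le> deg" unfolding d_def by (simp only: of_nat_le_iff)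
  then have Dm: "D + m \<le> (\<Sum>j\<in>?I - J. k j)" using sumI unfolding D_def by linarith
  have "real D = d - real (C * card J + C * card J' + m)" unfolding D_def d_def using le by (simp add: of_nat_diff)
  then have DR: "d * (1 - 3 / 1000 * \<epsilon>) \<le> real D" using lt by (simp add: algebra_simps)
  have key: "(1 - pr 0 * (1 - exp (- ?\<theta>))) ^ D \<le> exp (- ?\<theta>)"
  proof -
    have \<rho>0: "0 \<le> ?\<rho>" "?\<rho> \<le> 1" using \<rho> eps by auto
    have y: "0 \<le> pr 0 * ?\<rho>" "pr 0 * ?\<rho> \<le> 1"
      using \<rho>0 pr_bounds[of 0] by (auto intro: mult_le_one)
    \<comment> \<open>0.996 - 0.003 = 0.993; the gap to 0.99 absorbs the term of order
      \<epsilon>^2.\<close>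
    have "1 + 99 / 100 * \<epsilon> \<le> (1 + 996 / 1000 * \<epsilon>) * (1 - 3 / 1000 * \<epsilon>)"
    proof -
      have "(1 + 996 / 1000 * \<epsilon>) * (1 - 3 / 1000 * \<epsilon>) = 1 + 993 / 1000 * \<epsilon> - 2988 / 1000000 * (\<epsilon> * \<epsilon>)"
        by algebra
      then show ?thesis using e2 eps by linarith
    qed
    also have "\<dots> = (1 + 996 / 1000 * \<epsilon>) / d * (d * (1 - 3 / 1000 * \<epsilon>))" using d_ge by simp
    also have "\<dots> \<le> pr 0 * real D"
      using pr0(1) DR pr_bounds[of 0] d_ge eps by (intro mult_mono) auto
    finally have pD: "1 + 99 / 100 * \<epsilon> \<le> pr 0 * real D" .
    have "?\<theta> \<le> (1 + 99 / 100 * \<epsilon>) * (?\<theta> - ?\<theta>\<^sup>2 / 2)"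
    proof -
      have "1 \<le> (1 + 99 / 100 * \<epsilon>) * (1 - 985 / 1000 * \<epsilon>)"
      proof -
        have "(1 + 99 / 100 * \<epsilon>) * (1 - 985 / 1000 * \<epsilon>) = 1 + 5 / 1000 * \<epsilon> - 97515 / 100000 * (\<epsilon> * \<epsilon>)"
          by algebra
        then show ?thesis using e2 eps by linarith
      qed
      then have "?\<theta> * 1 \<le> ?\<theta> * ((1 + 99 / 100 * \<epsilon>) * (1 - 985 / 1000 * \<epsilon>))" using eps by (intro mult_left_mono) auto
      then show ?thesis by (simp add: algebra_simps power2_eq_square)
    qed
    also have "\<dots> \<le> (1 + 99 / 100 * \<epsilon>) * ?\<rho>" using \<theta> eps by (intro mult_left_mono) auto
    also have "\<dots> \<le> (pr 0 * real D) * ?\<rho>" using pD \<rho>0 by (intro mult_right_mono) auto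
    finally have "- (real D * (pr 0 * ?\<rho>)) \<le> - ?\<theta>" by (simp add: mult_ac)
    then have "exp (- (real D * (pr 0 * ?\<rho>))) \<le> exp (- ?\<theta>)" by simp
    then show ?thesis using one_minus_power_le[OF y, of D] by linarith
  qed
  have "?\<rho> - exp (z - ?\<rho> * (1 - exp (- (pr 1 / 2) * real m)) / 2 * real (card J)) \<le>
    prb M (\<lambda>\<omega>. z * real m \<le> real (card (expl (opn {0, 1} \<omega>) {x} (box x ?I))))"
    by (rule growth[OF _ _ key _ _ Dm x]) (use J eps in auto)
  moreover have "exp (z - ?\<rho> * (1 - exp (- (pr 1 / 2) * real m)) / 2 * real (card J)) \<le>
     exp (z - 98 / 100 * \<epsilon> * (1 - exp (- (s / 2) * real m)) * real (card J))"
  proof -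
    define F where "F = 1 - exp (- (s / 2) * real m)"
    have "0 \<le> F" using s_bounds by (simp add: F_def)
    then have "(196 / 100 * \<epsilon>) * (F / 2 * real (card J)) \<le> ?\<rho> * (F / 2 * real (card J))"
      using \<rho> by (intro mult_right_mono) auto
    then have "98 / 100 * \<epsilon> * F * real (card J) \<le> ?\<rho> * F / 2 * real (card J)" by simp
    then show ?thesis unfolding pr_s F_def[symmetric] by simp
  qed
  ultimately show ?thesis using \<rho> by linarith
qed

text \<open>\<theta> = 2.05 \<epsilon> lies just above the critical exponent 2\<epsilon>. The choice
  \<mu> = \<epsilon> maximises \<epsilon> \<mu> - \<mu>^2 / 2, the second-order gain of (1 +
  \<epsilon>) (1 - exp (- \<mu>)) over \<mu>; of this gain \<epsilon>^2 / 2 the losses leave the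
  rate 3/10 \<epsilon>^2. The final 2.06 is 2.05 from \<theta> plus 0.01 from \<beta>^K.\<close>

lemma cluster_upper_bound:
  assumes x: "x \<in> V" and d: "40 / \<epsilon>\<^sup>2 \<le> d" "real K \<le> 9 / 100 * \<epsilon> * d"
    and K: "exp (- (3 / 10 * \<epsilon>\<^sup>2 * real K)) \<le> 1 / 100 * \<epsilon>"
  shows "prb M (\<lambda>\<omega>. K \<le> card (expl (opn {0, 1, 2, 3, 4} \<omega>) {x} V)) \<le> 206 / 100 * \<epsilon>"
proof -
  let ?\<theta> = "205 / 100 * \<epsilon>" and ?\<beta> = "exp (- (3 / 10 * \<epsilon>\<^sup>2))"
  let ?L = "{0, 1, 2, 3, 4} :: nat set"
  have e2: "\<epsilon> * \<epsilon> \<le> \<epsilon> / 1000" using eps mult_left_mono[of \<epsilon> "1/1000" \<epsilon>] by simp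
  have e3: "\<epsilon> * (\<epsilon> * \<epsilon>) \<le> \<epsilon> * \<epsilon> / 1000" using eps mult_left_mono[OF e2, of \<epsilon>] by simp
  define D where "D = deg - K"
  have "9 / 100 * \<epsilon> * d \<le> 1 * d" using eps d_ge by (intro mult_right_mono) auto
  then have "real K \<le> d" using d(2) by linarith
  then have "K \<le> deg" by (simp add: d_def)
  then have DK: "D + K = deg" "real D = d - real K" by (auto simp: D_def d_def of_nat_diff)
  have key1: "exp (- ?\<theta>) \<le> (1 - pL ?L * (1 - exp (- ?\<theta>))) ^ deg"
  proof -
    define y where "y = p * (1 - exp (- ?\<theta>))"
    have "0 \<le> 1 - exp (- ?\<theta>)" using eps by simp
    then have y0: "0 \<le> y" using p_bounds by (simp add: y_def)
    have "1 - exp (- ?\<theta>) \<le> ?\<theta> - ?\<theta>\<^sup>2 / 2 + ?\<theta> ^ 3 / 6" using exp_minus_lower[of ?\<theta>] eps by simp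
    also have "\<dots> = ?\<theta> * (1 - 1025 / 1000 * \<epsilon> + 205 * 205 / 60000 * (\<epsilon> * \<epsilon>))"
      by (simp add: algebra_simps power2_eq_square power3_eq_cube)
    finally have "(1 + \<epsilon>) * (1 - exp (- ?\<theta>)) \<le> (1 + \<epsilon>) * (?\<theta> * (1 - 1025 / 1000 * \<epsilon> + 205 * 205 / 60000 * (\<epsilon> * \<epsilon>)))"
      using eps by (intro mult_left_mono) auto
    also have "\<dots> = ?\<theta> * ((1 + \<epsilon>) * (1 - 1025 / 1000 * \<epsilon> + 205 * 205 / 60000 * (\<epsilon> * \<epsilon>)))" by (simp only: mult_ac)
    also have "\<dots> \<le> ?\<theta> * (1 - 25 / 1000 * \<epsilon>)"
    proof (rule mult_left_mono)
      have eq: "(1 + \<epsilon>) * (1 - 1025 / 1000 * \<epsilon> + 205 * 205 / 60000 * (\<epsilon> * \<epsilon>)) =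
        1 - 25 / 1000 * \<epsilon> - (1025 / 1000 - 205 * 205 / 60000) * (\<epsilon> * \<epsilon>) + 205 * 205 / 60000 * (\<epsilon> * (\<epsilon> * \<epsilon>))"
        by algebra
      have "0 \<le> \<epsilon> * \<epsilon>" by simp
      then have "41 * (\<epsilon> * (\<epsilon> * \<epsilon>)) \<le> 19 * (\<epsilon> * \<epsilon>)" using e3 by linarith
      then have "205 * 205 / 60000 * (\<epsilon> * (\<epsilon> * \<epsilon>)) \<le> (1025 / 1000 - 205 * 205 / 60000) * (\<epsilon> * \<epsilon>)"
        by simp
      then show "(1 + \<epsilon>) * (1 - 1025 / 1000 * \<epsilon> + 205 * 205 / 60000 * (\<epsilon> * \<epsilon>)) \<le> 1 - 25 / 1000 * \<epsilon>"
        unfolding eq by linarith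
    qed (use eps in simp)
    also have "\<dots> = ?\<theta> - 5125 / 100000 * (\<epsilon> * \<epsilon>)" by algebra
    also have "\<dots> \<le> ?\<theta> - 5 / 100 * (\<epsilon> * \<epsilon>)" using zero_le_square[of \<epsilon>] by linarith
    finally have yd: "d * y \<le> ?\<theta> - 5 / 100 * (\<epsilon> * \<epsilon>)"
      using p_bounds(3) by (simp add: y_def mult.assoc[symmetric] mult.commute)
    also have "\<dots> \<le> 1" using eps zero_le_square[of \<epsilon>] by linarith
    finally have yd1: "d * y \<le> 1" .
    then have y2: "y \<le> 1 / 2" using d_ge y0 mult_right_mono[of 2 d y] by linarith
    \<comment> \<open>Replacing (1 - y)^d by exp (- d y) costs at most 2 d y^2 \<le> 2 / d in the
      exponent; 40 / \<epsilon>^2 \<le> d fits this into the slack 0.05 \<epsilon>^2.\<close>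
    have "2 * (y * y) * d \<le> 5 / 100 * (\<epsilon> * \<epsilon>)"
    proof -
      have "(d * y) * (d * y) \<le> 1 * 1" using yd1 y0 d_ge by (intro mult_mono) auto
      then have "2 * (y * y) * d * d \<le> 2" by (simp add: algebra_simps)
      also have "2 \<le> 5 / 100 * (\<epsilon> * \<epsilon>) * d" using d(1) eps by (simp add: field_simps power2_eq_square)
      finally show ?thesis using d_ge by simp
    qed
    moreover have "d * (- y - 2 * y\<^sup>2) = - (d * y) - 2 * (y * y) * d" by algebra
    ultimately have "- ?\<theta> \<le> d * (- y - 2 * y\<^sup>2)" using yd by linarith
    also have "\<dots> \<le> d * ln (1 - y)"
      using ln_one_minus_pos_lower_bound[OF y0 y2] d_ge by (intro mult_left_mono) auto
    finally have "exp (- ?\<theta>) \<le> exp (real deg * ln (1 - y))" by (simp add: d_def)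
    also have "\<dots> = (1 - y) ^ deg" using y2 by (simp add: exp_of_nat_mult)
    finally show ?thesis unfolding y_def pL_all .
  qed
  have key2: "(1 - pL ?L * (1 - exp (- \<epsilon>))) ^ D \<le> ?\<beta> * exp (- \<epsilon>)"
  proof -
    have f: "\<epsilon> - \<epsilon>\<^sup>2 / 2 \<le> 1 - exp (- \<epsilon>)" "0 \<le> 1 - exp (- \<epsilon>)" "1 - exp (- \<epsilon>) \<le> 1" using exp_minus_upper[of \<epsilon>] eps by auto
    have y: "0 \<le> p * (1 - exp (- \<epsilon>))" "p * (1 - exp (- \<epsilon>)) \<le> 1"
      using f p_bounds by (auto intro: mult_le_one)
    have "d * (1 - 9 / 100 * \<epsilon>) \<le> real D" using DK d(2) by (simp add: algebra_simps)
    then have "p * (d * (1 - 9 / 100 * \<epsilon>)) \<le> p * real D" using p_bounds by (intro mult_left_mono) auto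
    then have "(1 + \<epsilon>) * (1 - 9 / 100 * \<epsilon>) \<le> p * real D" using p_bounds(3) by (simp add: mult.assoc[symmetric])
    moreover have "(1 + \<epsilon>) * (1 - 9 / 100 * \<epsilon>) = 1 + 91 / 100 * \<epsilon> - 9 / 100 * (\<epsilon> * \<epsilon>)"
      by algebra
    ultimately have pD: "1 + 9 / 10 * \<epsilon> \<le> p * real D" using e2 eps by linarith
    have "\<epsilon> + 3 / 10 * \<epsilon>\<^sup>2 \<le> (1 + 9 / 10 * \<epsilon>) * (\<epsilon> - \<epsilon>\<^sup>2 / 2)"
    proof -
      have "(1 + 9 / 10 * \<epsilon>) * (\<epsilon> - \<epsilon>\<^sup>2 / 2) = \<epsilon> + 4 / 10 * (\<epsilon> * \<epsilon>) - 45 / 100 * (\<epsilon> * (\<epsilon> * \<epsilon>))"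
        by algebra
      moreover have "0 \<le> \<epsilon> * \<epsilon>" "\<epsilon>\<^sup>2 = \<epsilon> * \<epsilon>" by (simp_all add: power2_eq_square)
      ultimately show ?thesis using e3 by linarith
    qed
    also have "\<dots> \<le> (p * real D) * (1 - exp (- \<epsilon>))"
      using pD f eps p_bounds by (intro mult_mono) (auto simp: power2_eq_square)
    finally have "- (real D * (p * (1 - exp (- \<epsilon>)))) \<le> - (3 / 10 * \<epsilon>\<^sup>2) + - \<epsilon>" by (simp add: mult_ac)
    then have "exp (- (real D * (p * (1 - exp (- \<epsilon>))))) \<le> ?\<beta> * exp (- \<epsilon>)" by (simp flip: exp_add)
    then show ?thesis using one_minus_power_le[OF y, of D] unfolding pL_all by linarith
  qed
  have "prb M (\<lambda>\<omega>. K \<le> card (expl (opn ?L \<omega>) {x} V)) \<le> 1 - exp (- ?\<theta>) + ?\<beta> ^ K"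
  proof (rule cluster_upper[where \<mu> = \<epsilon> and dd = deg and D = D])
    have "3 / 10 * \<epsilon>\<^sup>2 = 3 / 10 * (\<epsilon> * \<epsilon>)" by (simp add: power2_eq_square)
    then have "- (?\<theta> - \<epsilon>) \<le> - (3 / 10 * \<epsilon>\<^sup>2)" using e2 eps by linarith
    then show "exp (- (?\<theta> - \<epsilon>)) \<le> ?\<beta>" by (simp only: exp_le_cancel_iff)
    show "D + K \<le> card {u \<in> V. {v, u} \<in> E}" "card {u \<in> V. {v, u} \<in> E} \<le> deg" if "v \<in> V" for v
      using card_nbrs[OF that] DK by auto
  qed (use eps key1 key2 x in auto)
  also have "?\<beta> ^ K = exp (- (3 / 10 * \<epsilon>\<^sup>2 * real K))" by (simp add: mult_ac flip: exp_of_nat_mult)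
  also have "1 - exp (- ?\<theta>) + exp (- (3 / 10 * \<epsilon>\<^sup>2 * real K)) \<le> ?\<theta> + 1 / 100 * \<epsilon>"
    using K exp_ge_add_one_self[of "- ?\<theta>"] by (intro add_mono) auto
  finally show ?thesis by simp
qed

text \<open>\<open>many_neighbours\<close> bounds the expected number of poor vertices, and Markov's
  inequality does the rest.\<close>

lemma prb_poor:
  assumes r: "\<And>x. x \<in> V \<Longrightarrow> r \<le> prb M (\<lambda>\<omega>. H \<le> card (expl (opn {0, 1} \<omega>) {x} (box x (T - J))))"
    and J: "J \<subseteq> T" and e1: "0 < e1"
  shows "prb M (\<lambda>\<omega>. \<not> real (card (poor H z \<omega>)) \<le> e1 * n) \<le> exp (z - r / 2 * real (card J)) / e1"
proof -
  let ?f = "\<lambda>\<omega>. real (card (poor H z \<omega>))"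
  let ?Q = "\<lambda>v \<omega>. real (card {u \<in> V. {v, u} \<in> E \<and> u \<in> Wh H \<omega>}) \<le> z"
  have "?f \<omega> = (\<Sum>v\<in>V. of_bool (?Q v \<omega>))" for \<omega>
    unfolding poor_def using finite_V by (simp add: of_bool_def sum.If_cases Int_def)
  then have "mean M ?f = (\<Sum>v\<in>V. prb M (?Q v))" by (simp add: mean_sum prb_def)
  also have "\<dots> \<le> (\<Sum>v\<in>V. exp (z - r / 2 * real (card J)))"
    unfolding Wh_def by (intro sum_mono many_neighbours[OF _ J _ r]) auto
  finally have m: "mean M ?f \<le> n * exp (z - r / 2 * real (card J))" by (simp add: n_def)
  have "prb M (\<lambda>\<omega>. \<not> ?f \<omega> \<le> e1 * n) \<le> prb M (\<lambda>\<omega>. e1 * n \<le> ?f \<omega>)" by (rule prb_mono) auto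
  also have "\<dots> \<le> mean M ?f / (e1 * n)" using e1 n_pos by (intro prb_markov) auto
  also have "\<dots> \<le> n * exp (z - r / 2 * real (card J)) / (e1 * n)" using m e1 n_pos by (intro divide_right_mono) auto
  also have "\<dots> = exp (z - r / 2 * real (card J)) / e1" using n_pos by simp
  finally show ?thesis .
qed

end

lemma nat_floor_bounds:
  fixes x :: real
  assumes "2 \<le> x"
  shows "x / 2 \<le> real (nat \<lfloor>x\<rfloor>)" "real (nat \<lfloor>x\<rfloor>) \<le> x"
  using assms by linarith+

definition expanding_giant :: "real \<Rightarrow> real \<Rightarrow> real \<Rightarrow> real \<Rightarrow> 'v ugraph \<Rightarrow> bool" where
  "expanding_giant \<epsilon> c n d G \<longleftrightarrow> (\<forall>L. largest_component G L \<longrightarrow>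
     (\<exists>H. is_subgraph H L \<and> 3 * \<epsilon> * n / 2 \<le> real (card (verts H)) \<and>
       (\<forall>S. S \<subseteq> verts H \<and> real (card S) \<le> real (card (verts H)) / 2 \<longrightarrow>
          c * real (card S) / (d * ln d) \<le> real (card (nbhd H S)))))"

section \<open>Choice of the constants and the bound for a fixed product\<close>

context supercritical
begin

text \<open>\<open>mark\<close> is the number of marker coordinates, \<open>seed\<close> the cluster size reached in layer 0, and
  \<open>4 * hn\<close> the number of neighbours in large clusters that a vertex outside \<open>poor\<close> has.\<close>

definition \<eta> :: real where "\<eta> = \<epsilon> / 1000"
text \<open>The 32 makes 4 \<eta>' d a quarter of \<epsilon> \<eta> d / (2 C^2), itself a lower
  bound for \<epsilon> times \<open>mark\<close>. So asking for \<open>4 * hn\<close> neighbours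
  stays well below the mean number supplied by \<open>many_neighbours\<close>.\<close>

definition \<eta>' :: real where "\<eta>' = \<epsilon> * \<eta> / (32 * (real C)\<^sup>2)"
text \<open>Dividing by \<open>C\<close> keeps the total degree of the markers, at most
  \<open>C * mark\<close>, below \<eta> d.\<close>

definition mark :: nat where "mark = nat \<lfloor>\<eta> * real (card T) / real C\<rfloor>"
definition seed :: nat where "seed = nat \<lfloor>\<eta> * d\<rfloor>"
definition hn :: nat where "hn = nat \<lfloor>\<eta>' * d\<rfloor>"

lemma C_ge: "2 \<le> real C"
proof -
  obtain j where "j \<in> T" using deg2 unfolding deg_def by (metis ex_in_conv not_numeral_le_zero sum.empty)
  then show ?thesis using card_gt[of j] card_le[of j] by linarith
qed

lemma eta: "0 < \<eta>" "0 < \<eta>'" using eps C_ge by (simp_all add: \<eta>_def \<eta>'_def)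

lemma T_bounds: "real (card T) \<le> d" "d \<le> real C * real (card T)"
  using deg_ge deg_le by (simp_all add: d_def flip: of_nat_mult)

lemma mark_bounds:
  assumes "2 * (real C)\<^sup>2 / \<eta> \<le> d"
  shows "\<eta> * d / (2 * (real C)\<^sup>2) \<le> real mark" "real C * real mark \<le> \<eta> * d" "2 * mark \<le> card T"
proof -
  let ?x = "\<eta> * real (card T) / real C"
  have C: "0 < real C" using C_ge by simp
  have "\<eta> * d / (real C)\<^sup>2 \<le> \<eta> * (real C * real (card T)) / (real C)\<^sup>2"
    using T_bounds eta by (intro divide_right_mono mult_left_mono) auto
  also have "\<dots> = ?x" using C by (simp add: power2_eq_square)
  finally have x: "\<eta> * d / (real C)\<^sup>2 \<le> ?x" .
  have "2 \<le> \<eta> * d / (real C)\<^sup>2" using assms eta C by (simp add: field_simps)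
  with x have "2 \<le> ?x" by linarith
  then have f: "?x / 2 \<le> real mark" "real mark \<le> ?x" unfolding mark_def by (rule nat_floor_bounds)+
  have "\<eta> * d / (2 * (real C)\<^sup>2) = (\<eta> * d / (real C)\<^sup>2) / 2" by simp
  also have "\<dots> \<le> ?x / 2" using x by (intro divide_right_mono) auto
  also note f(1)
  finally show "\<eta> * d / (2 * (real C)\<^sup>2) \<le> real mark" .
  have "real C * real mark \<le> real C * ?x" using f by (intro mult_left_mono) auto
  also have "\<dots> = \<eta> * real (card T)" using C by simp
  also have "\<dots> \<le> \<eta> * d" using T_bounds eta by (intro mult_left_mono) auto
  finally show "real C * real mark \<le> \<eta> * d" .
  have "\<eta> * real (card T) / real C \<le> \<eta> * real (card T) / 1"
    using C_ge eta by (intro divide_left_mono) auto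
  moreover have "\<eta> * real (card T) \<le> 1 / 2 * real (card T)"
    using eps by (intro mult_right_mono) (auto simp: \<eta>_def)
  ultimately have "2 * real mark \<le> real (card T)" using f by linarith
  then show "2 * mark \<le> card T" by linarith
qed

text \<open>2 K / \<eta> successful boxes with \<open>seed\<close> \<ge> \<eta> d / 2 vertices each
  give K d vertices. The hypothesis \<open>big\<close> makes the exponential error in
  \<open>survival\<close> at most \<epsilon> / 100, so 1.96 becomes 1.95. Freezing \<open>J'\<close>
  prepares the use in \<open>many_neighbours\<close>.\<close>

lemma cluster_large:
  assumes d: "2 * (real C)\<^sup>2 / \<eta> \<le> d" "2 / \<eta> \<le> d"
    and big: "2 * real K / \<eta> - ln (\<epsilon> / 100) \<le> 98 / 100 * \<epsilon> * (1 - exp (- (\<eta>\<^sup>2 / 4))) * (\<eta> * d / (2 * (real C)\<^sup>2))"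
    and J': "J' \<subseteq> T" "card J' \<le> mark" and x: "x \<in> V"
  shows "195 / 100 * \<epsilon> \<le> prb M (\<lambda>\<omega>. K * deg \<le> card (expl (opn {0, 1} \<omega>) {x} (box x (T - J'))))"
proof -
  note mk = mark_bounds[OF d(1)]
  have sd: "2 \<le> \<eta> * d" using d(2) eta by (simp add: field_simps)
  have seed: "\<eta> * d / 2 \<le> real seed" "real seed \<le> \<eta> * d"
    unfolding seed_def by (rule nat_floor_bounds[OF sd])+
  have "card (T - J') = card T - card J'" using J' finT by (intro card_Diff_subset) (auto intro: finite_subset)
  then have "mark \<le> card (T - J')" using mk(3) J' by linarith
  \<comment> \<open>Since \<open>2 * mark \<le> card T\<close>, enough markers for growth remain
    outside \<open>J'\<close>.\<close>
  then obtain J where J: "J \<subseteq> T - J'" "card J = mark" by (rule obtain_subset_with_card_n)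
  let ?z = "2 * real K / \<eta>"
  have cJ': "real C * real (card J') \<le> \<epsilon> / 1000 * d"
  proof -
    have "real C * real (card J') \<le> real C * real mark" using J' by (intro mult_left_mono) auto
    then show ?thesis using mk(2) by (simp add: \<eta>_def)
  qed
  have surv: "196 / 100 * \<epsilon> - exp (?z - 98 / 100 * \<epsilon> * (1 - exp (- (s / 2) * real seed)) * real (card J)) \<le>
    prb M (\<lambda>\<omega>. ?z * real seed \<le> real (card (expl (opn {0, 1} \<omega>) {x} (box x (T - J')))))"
    by (rule survival) (use J J' x seed mk(2) cJ' in \<open>auto simp: \<eta>_def\<close>)
  have "prb M (\<lambda>\<omega>. ?z * real seed \<le> real (card (expl (opn {0, 1} \<omega>) {x} (box x (T - J')))))
    \<le> prb M (\<lambda>\<omega>. K * deg \<le> card (expl (opn {0, 1} \<omega>) {x} (box x (T - J'))))"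
  proof (rule prb_mono)
    fix \<omega> assume "?z * real seed \<le> real (card (expl (opn {0, 1} \<omega>) {x} (box x (T - J'))))"
    moreover have "real K * d \<le> ?z * real seed"
    proof -
      have "?z * (\<eta> * d / 2) \<le> ?z * real seed" using seed eta by (intro mult_left_mono) auto
      then show ?thesis using eta by simp
    qed
    ultimately have "real (K * deg) \<le> real (card (expl (opn {0, 1} \<omega>) {x} (box x (T - J'))))" by (simp add: d_def)
    then show "K * deg \<le> card (expl (opn {0, 1} \<omega>) {x} (box x (T - J')))" by (simp only: of_nat_le_iff)
  qed
  moreover have "exp (?z - 98 / 100 * \<epsilon> * (1 - exp (- (s / 2) * real seed)) * real (card J)) \<le> \<epsilon> / 100"
  proof -
    have "\<eta>\<^sup>2 / 4 = s / 2 * (\<eta> * d / 2)" using s_bounds(3) by (simp add: \<eta>_def power2_eq_square)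
    also have "\<dots> \<le> s / 2 * real seed" using seed s_bounds by (intro mult_left_mono) auto
    finally have "1 - exp (- (\<eta>\<^sup>2 / 4)) \<le> 1 - exp (- (s / 2) * real seed)" by simp
    then have "98 / 100 * \<epsilon> * (1 - exp (- (\<eta>\<^sup>2 / 4))) * (\<eta> * d / (2 * (real C)\<^sup>2)) \<le>
        98 / 100 * \<epsilon> * (1 - exp (- (s / 2) * real seed)) * real (card J)"
      using mk(1) J(2) eps d_ge eta s_bounds by (intro mult_mono mult_nonneg_nonneg) auto
    then have "?z - 98 / 100 * \<epsilon> * (1 - exp (- (s / 2) * real seed)) * real (card J) \<le> ln (\<epsilon> / 100)"
      using big by linarith
    then have "exp (?z - 98 / 100 * \<epsilon> * (1 - exp (- (s / 2) * real seed)) * real (card J)) \<le> exp (ln (\<epsilon> / 100))"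
      by (simp only: exp_le_cancel_iff)
    then show ?thesis using eps by simp
  qed
  ultimately show ?thesis using surv by linarith
qed

text \<open>\<open>c1\<close> is half of the room that \<open>prb_bad_cut\<close> leaves for
  exceptional vertices, \<open>q\<close> a lower bound for the attachment probability, and
  \<open>cs\<close> n / d the sprinkling exponent for cuts with sides of 0.04 \<epsilon> n. The
  error terms belong, in order, to \<open>Wh\<close> too small, \<open>big\<close> too large, many
  poor vertices, many edges at a small set, and a bad cut.\<close>

lemma main_bound:
  fixes K Kb :: nat and c cs :: real
  defines "c1 \<equiv> (4 / 100 * \<epsilon>)\<^sup>2 / (64 * real C)"
  defines "q \<equiv> 1 - exp (- (\<eta> * \<eta>' / 4))"
  defines "cs \<equiv> q\<^sup>2 * \<eta> * (4 / 100 * \<epsilon>)\<^sup>2 / (128 * real C)"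
  assumes c: "c = cs / 32" and K: "8 / cs \<le> real K"
    and Kb: "exp (- (3 / 10 * \<epsilon>\<^sup>2 * real Kb)) \<le> 1 / 100 * \<epsilon>"
    and d: "2 * (real C)\<^sup>2 / \<eta> \<le> d" "2 / \<eta> \<le> d" "2 / \<eta>' \<le> d" "40 / \<epsilon>\<^sup>2 \<le> d" "real Kb \<le> 9 / 100 * \<epsilon> * d"
      "100 * c / \<epsilon> \<le> d"
    and big: "2 * real K / \<eta> - ln (\<epsilon> / 100) \<le> 98 / 100 * \<epsilon> * (1 - exp (- (\<eta>\<^sup>2 / 4))) * (\<eta> * d / (2 * (real C)\<^sup>2))"
    and lnd: "16 \<le> ln d" "1 / c \<le> ln d" "c * (1 + 1 / \<eta>') / c1 \<le> ln d"
    and nK: "real Kb \<le> 182 / 100 * \<epsilon> * n"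
  shows "1 - (3200 * (real K * d)\<^sup>2 / (\<epsilon>\<^sup>2 * n) + 5000 * (real Kb)\<^sup>2 / (\<epsilon>\<^sup>2 * n)
      + d / c1 * exp (- (\<epsilon> * \<eta> / (4 * (real C)\<^sup>2) * d)) + exp (- (c / 2 * n / d)) + exp (- (cs / 2 * n / d)))
    \<le> measure_pmf.prob (percolation (cartesian_product T Gs) p) {Gp. expanding_giant \<epsilon> c n d Gp}"
proof -
  have C: "0 < real C" using C_ge by simp
  have q0: "0 < q" "q < 1" using eta by (simp_all add: q_def)
  have cs0: "0 < cs" using q0 eta eps C by (simp add: cs_def)
  have c0: "0 < c" using cs0 c by simp
  have c10: "0 < c1" using eps C by (simp add: c1_def)
  have d0: "0 < d" using d_ge by simp
  have K0: "0 < K" using K cs0 by (metis divide_pos_pos gr0I less_le_trans of_nat_0 of_nat_0_less_iff zero_less_numeral)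
  define H where "H = K * deg"
  define m where "m = c * n / (d * ln d)"
  \<comment> \<open>The weight for \<open>card_small_subsets\<close>: a n \<le> c n / d once c ln d
    \<ge> 1, and ln (1 / a) \<le> 2 ln d cancels the logarithm in \<open>m\<close>.\<close>
  define a where "a = 1 / (d * ln d)"
  \<comment> \<open>Counting the sets \<open>X\<close> costs 3 c n / d and the mean in
    \<open>prb_touching\<close> at most 4 m, which is c n / (4 d); the factor 4 leaves a decay of c
    n / (2 d).\<close>
  define z where "z = 4 * c * n / d"
  define g where "g = 4 / 100 * \<epsilon> * n"
  define e1 where "e1 = c1 / d"
  have HR: "real H = real K * d" by (simp add: H_def d_def)
  have H0: "0 < H" using K0 deg2 by (simp add: H_def)
  have dl: "16 * d \<le> d * ln d" using lnd(1) d0 by simp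
  have dl0: "0 < d * ln d" using dl d0 by linarith
  have m0: "0 \<le> m" using c0 n_pos dl0 by (simp add: m_def)
  have hd: "2 \<le> \<eta>' * d" using d(3) eta by (simp add: field_simps)
  have hn: "\<eta>' * d / 2 \<le> real hn" "real hn \<le> \<eta>' * d"
    unfolding hn_def by (rule nat_floor_bounds[OF hd])+
  have hn0: "0 < real hn" using hn hd by linarith
  have eta'_le: "\<eta>' \<le> \<epsilon> / 100"
  proof -
    have "\<epsilon> * \<eta> \<le> \<epsilon> * 1" using eps by (intro mult_left_mono) (auto simp: \<eta>_def)
    moreover have "100 \<le> 32 * (real C)\<^sup>2" using power_mono[OF C_ge, of 2] by simp
    ultimately show ?thesis unfolding \<eta>'_def using eps by (intro frac_le) auto
  qed
  have "1 \<le> d * ln d" using dl d_ge by linarith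
  then have a01: "0 < a" "a \<le> 1" using dl0 by (simp_all add: a_def)
  have ann: "a * n \<le> c * n / d"
  proof -
    have "1 \<le> c * ln d" using lnd(2) c0 by (simp add: field_simps)
    then have "n * 1 \<le> n * (c * ln d)" using n_pos by (intro mult_left_mono) auto
    moreover have "0 < ln d" using lnd(1) by linarith
    ultimately show ?thesis using d0 n_pos by (simp add: a_def field_simps)
  qed
  have mln: "m * ln (1 / a) \<le> 2 * c * n / d"
  proof -
    have l: "0 < ln d" using lnd(1) by linarith
    have "ln (1 / a) = ln d + ln (ln d)" using d0 l by (simp add: a_def ln_mult)
    also have "\<dots> \<le> 2 * ln d" using ln_le_minus_one[OF l] by linarith
    finally have "m * ln (1 / a) \<le> m * (2 * ln d)" using m0 by (intro mult_left_mono)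
    also have "\<dots> = 2 * c * n / d" using l d0 by (simp add: m_def)
    finally show ?thesis .
  qed
  have mle: "m \<le> c * n / d / 16"
  proof -
    have "m \<le> c * n / (16 * d)" unfolding m_def using c0 n_pos dl d0 by (intro frac_le) auto
    then show ?thesis by (simp add: mult.commute)
  qed
  have mg: "m \<le> g / 4"
  proof -
    have "c / d \<le> \<epsilon> / 100" using d(6) d0 eps by (simp add: field_simps)
    then have "c / d * n \<le> \<epsilon> / 100 * n" using n_pos by (intro mult_right_mono) auto
    then have e: "c * n / d \<le> \<epsilon> / 100 * n" by simp
    have le: "u / 16 \<le> u" if "0 \<le> u" for u :: real using that by simp
    note mle
    also have "c * n / d / 16 \<le> c * n / d" by (rule le) (use c0 n_pos d0 in simp)
    also note e
    also have "\<epsilon> / 100 * n = g / 4" by (simp add: g_def)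
    finally show ?thesis .
  qed
  have g0: "0 < g" using eps n_pos by (simp add: g_def)
  have W: "prb M (\<lambda>\<omega>. real (card (Wh H \<omega>)) < 190 / 100 * \<epsilon> * n) \<le> 3200 * (real K * d)\<^sup>2 / (\<epsilon>\<^sup>2 * n)"
    unfolding HR[symmetric]
  proof (rule prb_W_small)
    fix x assume "x \<in> V"
    then show "195 / 100 * \<epsilon> \<le> prb M (\<lambda>\<omega>. H \<le> card (expl (opn {0, 1} \<omega>) {x} V))"
      using cluster_large[OF d(1,2) big, of "{}" x] by (simp add: H_def)
  qed
  have Y: "prb M (\<lambda>\<omega>. 210 / 100 * \<epsilon> * n < real (card (big Kb (opn {0, 1, 2, 3, 4} \<omega>)))) \<le> 5000 * (real Kb)\<^sup>2 / (\<epsilon>\<^sup>2 * n)"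
    by (rule prb_big_large, rule cluster_upper_bound[OF _ d(4,5) Kb])
  have P: "prb M (\<lambda>\<omega>. \<not> real (card (poor H (4 * real hn) \<omega>)) \<le> e1 * n) \<le> d / c1 * exp (- (\<epsilon> * \<eta> / (4 * (real C)\<^sup>2) * d))"
  proof -
    note mk = mark_bounds[OF d(1)]
    have "mark \<le> card T" using mk(3) by linarith
    then obtain J where J: "J \<subseteq> T" "card J = mark" by (rule obtain_subset_with_card_n)
    have "prb M (\<lambda>\<omega>. \<not> real (card (poor H (4 * real hn) \<omega>)) \<le> e1 * n)
      \<le> exp (4 * real hn - (195 / 100 * \<epsilon>) / 2 * real (card J)) / e1"
    proof (rule prb_poor[OF _ J(1)])
      show "195 / 100 * \<epsilon> \<le> prb M (\<lambda>\<omega>. H \<le> card (expl (opn {0, 1} \<omega>) {x} (box x (T - J))))" if "x \<in> V" for x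
        unfolding H_def by (rule cluster_large[OF d(1,2) big J(1) _ that]) (simp add: J(2))
      show "0 < e1" using c10 d0 by (simp add: e1_def)
    qed
    also have "\<dots> \<le> exp (- (\<epsilon> * \<eta> / (4 * (real C)\<^sup>2) * d)) / e1"
    proof -
      let ?u = "\<epsilon> * (\<eta> * d / (2 * (real C)\<^sup>2))"
      have "?u \<le> \<epsilon> * real (card J)" using mk(1) J(2) eps by (intro mult_left_mono) auto
      moreover have "4 * (\<eta>' * d) = ?u / 4" by (simp add: \<eta>'_def)
      moreover have "\<epsilon> * \<eta> / (4 * (real C)\<^sup>2) * d = ?u / 2" by simp
      moreover have "0 \<le> ?u" using eps eta d0 by simp
      moreover have "4 * h - 195 / 100 * e / 2 * j \<le> - w"
        if "u \<le> e * j" "4 * v = u / 4" "w = u / 2" "0 \<le> u" "h \<le> v" for h e j u v w :: real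
        using that by linarith
      ultimately have "4 * real hn - (195 / 100 * \<epsilon>) / 2 * real (card J) \<le> - (\<epsilon> * \<eta> / (4 * (real C)\<^sup>2) * d)"
        using hn(2) by blast
      then show ?thesis using c10 d0 by (intro divide_right_mono) (auto simp: e1_def)
    qed
    also have "\<dots> = d / c1 * exp (- (\<epsilon> * \<eta> / (4 * (real C)\<^sup>2) * d))" by (simp add: e1_def)
    finally show ?thesis .
  qed
  have nd0: "0 \<le> n / d" using n_pos d0 by simp
  define u where "u = n / d"
  have u: "0 \<le> u" "a * n \<le> c * u" "m * ln (1 / a) \<le> 2 * (c * u)" "m \<le> c * u / 16" "z = 4 * (c * u)"
    "0 \<le> c * u" "c / 2 * n / d = c * u / 2" "cs / 2 * n / d = cs * u / 2"
    using nd0 ann mln mle c0 n_pos d0 by (simp_all add: u_def z_def mult.assoc)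
  have S: "prb M (\<lambda>\<omega>. \<not> sparse_touch m z \<omega>) \<le> exp (- (c / 2 * n / d))"
  proof -
    have "prb M (\<lambda>\<omega>. \<not> sparse_touch m z \<omega>) \<le> exp (a * n + m * ln (1 / a)) * exp (2 * pL {0, 1} * (m * d) - z)"
      using prb_not_sparse_touch[OF _ m0 a01, of z] by (simp add: n_def d_def)
    also have "\<dots> = exp (a * n + m * ln (1 / a) + (2 * pL {0, 1} * (m * d) - z))" by (rule exp_add[symmetric])
    also have "\<dots> \<le> exp (- (c / 2 * n / d))"
    proof -
      have "2 * pL {0, 1} * (m * d) \<le> 2 * (2 / d) * (m * d)" using pL_01 m0 d0 by (intro mult_right_mono) auto
      also have "\<dots> = 4 * m" using d0 by simp
      finally have "2 * pL {0, 1} * (m * d) \<le> 4 * m" .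
      then have "a * n + m * ln (1 / a) + (2 * pL {0, 1} * (m * d) - z) \<le> - (c / 2 * n / d)"
        unfolding u(5,7) using u by linarith
      then show ?thesis by simp
    qed
    finally show ?thesis .
  qed
  have B: "prb M (\<lambda>\<omega>. real (card (poor H (4 * real hn) \<omega>)) \<le> e1 * n \<and> sparse_touch m z \<omega> \<and> bad_cut H m g \<omega>)
    \<le> exp (- (cs / 2 * n / d))"
  proof -
    let ?q = "1 - exp (- (s / 2) * real hn)"
    have "prb M (\<lambda>\<omega>. real (card (poor H (4 * real hn) \<omega>)) \<le> e1 * n \<and> sparse_touch m z \<omega> \<and> bad_cut H m g \<omega>)
      \<le> exp (a * real (card V) + m * ln (1 / a)) * exp (real (card V) / real H + z)
      * exp (- (?q\<^sup>2 * s / 8) * (g\<^sup>2 / (16 * real C * real (card V))))"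
    proof (rule prb_bad_cut)
      show "s * real deg \<le> 1" using s_bounds(3) eps by (simp add: d_def)
      show "real hn * real (card V) \<le> real deg * g / 4"
      proof -
        have "real hn \<le> \<epsilon> / 100 * d" by (rule order_trans[OF hn(2) mult_right_mono[OF eta'_le]]) (use d0 in simp)
        then have "real hn * n \<le> \<epsilon> / 100 * d * n" using n_pos by (intro mult_right_mono) auto
        then show ?thesis by (simp add: g_def n_def d_def mult_ac)
      qed
      show "real deg * (m + e1 * n + real deg * m / (2 * real hn)) \<le> g\<^sup>2 / (32 * real C * real (card V))"
      proof -
        have l: "0 < ln d" using lnd(1) by linarith
        have "d * m / (2 * real hn) \<le> d * m / (\<eta>' * d)"
          using hn(1) hd m0 d0 hn0 by (intro divide_left_mono) auto
        also have "\<dots> = m / \<eta>'" using d0 by simp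
        finally have "d * (m + e1 * n + d * m / (2 * real hn)) \<le> d * (m + e1 * n + m / \<eta>')"
          using d0 by (intro mult_left_mono) auto
        also have "\<dots> = c * (1 + 1 / \<eta>') * (n / ln d) + c1 * n"
          using d0 l eta by (simp add: m_def e1_def field_simps)
        also have "\<dots> \<le> c1 * ln d * (n / ln d) + c1 * n"
          using lnd(3) c10 n_pos l by (intro add_right_mono mult_right_mono) (auto simp: field_simps)
        also have "\<dots> = g\<^sup>2 / (32 * real C * n)"
          using l n_pos C by (simp add: c1_def g_def power2_eq_square field_simps)
        finally show ?thesis by (simp add: n_def d_def)
      qed
    qed (use H0 hn0 pr_s g0 mg m0 a01 deg2 in auto)
    also have "\<dots> = exp (a * n + m * ln (1 / a) + (n / real H + z) - ?q\<^sup>2 * s / 8 * (g\<^sup>2 / (16 * real C * n)))"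
      by (simp add: n_def exp_diff exp_add exp_minus field_simps)
    also have "\<dots> \<le> exp (- (cs / 2 * n / d))"
    proof -
      have "n / real H \<le> cs * u / 8"
      proof -
        have "1 \<le> cs / 8 * real K" using K cs0 by (simp add: field_simps)
        then have "n * 1 \<le> n * (cs / 8 * real K)" using n_pos by (intro mult_left_mono) auto
        then show ?thesis using K0 d0 by (simp add: HR u_def field_simps)
      qed
      moreover have "cs * u \<le> ?q\<^sup>2 * s / 8 * (g\<^sup>2 / (16 * real C * n))"
      proof -
        have sd: "s = \<eta> / d" by (simp add: s_def \<eta>_def)
        have "\<eta> * \<eta>' / 4 = s / 2 * (\<eta>' * d / 2)" using d0 by (simp add: sd)
        also have "\<dots> \<le> s / 2 * real hn" using hn(1) s_bounds by (intro mult_left_mono) auto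
        finally have "q \<le> ?q" by (simp add: q_def)
        then have "q\<^sup>2 \<le> ?q\<^sup>2" using q0 by (intro power_mono) auto
        then have "q\<^sup>2 * (s / 8 * (g\<^sup>2 / (16 * real C * n))) \<le> ?q\<^sup>2 * (s / 8 * (g\<^sup>2 / (16 * real C * n)))"
          using s_bounds C n_pos by (intro mult_right_mono) auto
        moreover have "cs * u = q\<^sup>2 * (s / 8 * (g\<^sup>2 / (16 * real C * n)))"
          using n_pos d0 C by (simp add: cs_def sd g_def u_def power2_eq_square mult_ac)
        ultimately show ?thesis by simp
      qed
      moreover have "c * u = cs * u / 32" by (simp add: c)
      moreover have "0 \<le> cs * u" using cs0 u by simp
      \<comment> \<open>The budget in units of \<open>cs\<close> n / d: \<open>X\<close> and
        \<open>z\<close> cost (3 + 4) / 32 and the clusters 4 / 32, together less than one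
        half.\<close>
      moreover have "x1 + x2 + (x3 + 4 * cu) - x4 \<le> - (csu / 2)"
        if "x1 \<le> cu" "x2 \<le> 2 * cu" "x3 \<le> csu / 8" "csu \<le> x4" "cu = csu / 32" "0 \<le> csu" for x1 x2 x3 x4 cu csu :: real
        using that by linarith
      ultimately have "a * n + m * ln (1 / a) + (n / real H + z) - ?q\<^sup>2 * s / 8 * (g\<^sup>2 / (16 * real C * n)) \<le> - (cs / 2 * n / d)"
        unfolding u(5,8) using u(2,3) by blast
      then show ?thesis by (simp only: exp_le_cancel_iff)
    qed
    finally show ?thesis .
  qed
  let ?Gp = "\<lambda>\<omega>. \<lparr>verts = V, edges = opn {0, 1, 2, 3, 4} \<omega>\<rparr>"
  let ?E1 = "\<lambda>\<omega>. real (card (Wh H \<omega>)) < 190 / 100 * \<epsilon> * n"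
  let ?E2 = "\<lambda>\<omega>. 210 / 100 * \<epsilon> * n < real (card (big Kb (opn {0, 1, 2, 3, 4} \<omega>)))"
  let ?E3 = "\<lambda>\<omega>. \<not> real (card (poor H (4 * real hn) \<omega>)) \<le> e1 * n"
  let ?E4 = "\<lambda>\<omega>. \<not> sparse_touch m z \<omega>"
  let ?E5 = "\<lambda>\<omega>. real (card (poor H (4 * real hn) \<omega>)) \<le> e1 * n \<and> sparse_touch m z \<omega> \<and> bad_cut H m g \<omega>"
  have "prb M (\<lambda>\<omega>. \<not> expanding_giant \<epsilon> c n d (?Gp \<omega>)) \<le> prb M (\<lambda>\<omega>. ?E1 \<omega> \<or> ?E2 \<omega> \<or> ?E3 \<omega> \<or> ?E4 \<omega> \<or> ?E5 \<omega>)"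
  proof (rule prb_mono, rule ccontr)
    fix \<omega> assume ng: "\<not> expanding_giant \<epsilon> c n d (?Gp \<omega>)" and "\<not> (?E1 \<omega> \<or> ?E2 \<omega> \<or> ?E3 \<omega> \<or> ?E4 \<omega> \<or> ?E5 \<omega>)"
    then have g1: "190 / 100 * \<epsilon> * n \<le> real (card (Wh H \<omega>))" and g2: "real (card (big Kb (opn {0, 1, 2, 3, 4} \<omega>))) \<le> 210 / 100 * \<epsilon> * n"
      and g3: "\<not> bad_cut H m g \<omega>" by auto
    have en: "0 < \<epsilon> * n" using eps n_pos by simp
    have KbH: "Kb \<le> H"
    proof -
      have "9 / 100 * \<epsilon> * d \<le> 1 * d" using eps d0 by (intro mult_right_mono) auto
      also have "\<dots> \<le> real K * d" using K0 d0 by (intro mult_right_mono) auto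
      finally show ?thesis using d(5) HR by linarith
    qed
    have "expanding_giant \<epsilon> c n d (?Gp \<omega>)" unfolding expanding_giant_def
    proof (intro allI impI)
      fix L1 assume L1: "largest_component (?Gp \<omega>) L1"
      \<comment> \<open>\<gamma> = 0.25 \<epsilon> n consists of 0.04 for \<open>g\<close>, 0.01 for
        \<open>m\<close> and 0.20 for the gap from 1.90 to 2.10. What remains is 1.90 - 0.08 - 0.25
        = 1.57, above 3/2.\<close>
      have "\<exists>Hg. is_subgraph Hg L1 \<and> 190 / 100 * \<epsilon> * n - 2 * g - 25 / 100 * \<epsilon> * n \<le> real (card (verts Hg)) \<and>
        (\<forall>S. S \<subseteq> verts Hg \<and> real (card S) \<le> real (card (verts Hg)) / 2 \<longrightarrow>
          c / (d * ln d) * real (card S) \<le> real (card (nbhd Hg S)))"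
      proof (rule expanding_subgraph[OF refl g3 KbH g1 g2 g0 _ m0 _ _ _ _ _ _ L1])
        show "c / (d * ln d) * real (card V) \<le> m" by (simp add: m_def n_def)
        show "0 \<le> c / (d * ln d)" using c0 dl0 by simp
        show "real Kb \<le> 190 / 100 * \<epsilon> * n - 2 * g" using nK by (simp add: g_def)
      qed (use en mg in \<open>simp_all add: g_def\<close>)
      moreover have "3 * \<epsilon> * n / 2 \<le> 190 / 100 * \<epsilon> * n - 2 * g - 25 / 100 * \<epsilon> * n"
        using en by (simp add: g_def)
      ultimately show "\<exists>H. is_subgraph H L1 \<and> 3 * \<epsilon> * n / 2 \<le> real (card (verts H)) \<and>
       (\<forall>S. S \<subseteq> verts H \<and> real (card S) \<le> real (card (verts H)) / 2 \<longrightarrow>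
          c * real (card S) / (d * ln d) \<le> real (card (nbhd H S)))"
        unfolding times_divide_eq_left by (blast intro: order_trans)
    qed
    with ng show False by simp
  qed
  also have "\<dots> \<le> prb M ?E1 + (prb M ?E2 + (prb M ?E3 + (prb M ?E4 + prb M ?E5)))"
    by (intro order_trans[OF prb_union] add_left_mono order_refl)
  finally have "prb M (\<lambda>\<omega>. \<not> expanding_giant \<epsilon> c n d (?Gp \<omega>)) \<le> 3200 * (real K * d)\<^sup>2 / (\<epsilon>\<^sup>2 * n) + 5000 * (real Kb)\<^sup>2 / (\<epsilon>\<^sup>2 * n)
      + d / c1 * exp (- (\<epsilon> * \<eta> / (4 * (real C)\<^sup>2) * d)) + exp (- (c / 2 * n / d)) + exp (- (cs / 2 * n / d))"
    using W Y P S B by linarith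
  moreover have "measure_pmf.prob (percolation (cartesian_product T Gs) p) {Gp. expanding_giant \<epsilon> c n d Gp} = prb M (\<lambda>\<omega>. expanding_giant \<epsilon> c n d (?Gp \<omega>))"
  proof -
    have "percolation (cartesian_product T Gs) p = map_pmf ?Gp M"
      by (rule percolation_eq_layers[OF pL_all]) (use p_bounds in auto)
    then show ?thesis unfolding prb_prob[OF finM] by (simp add: vimage_def)
  qed
  ultimately show ?thesis unfolding prb_not[OF finM] by linarith
qed

end

section \<open>Uniform error terms and the limit\<close>

lemma error_tendsto:
  fixes a1 a2 a3 \<kappa> c c' C :: real
  assumes "0 < \<kappa>" "0 < c" "0 < c'" "0 < C"
  shows "(\<lambda>t::nat. a1 * (real t)\<^sup>2 / 2 ^ t + a2 / 2 ^ t + a3 * real t * exp (- (\<kappa> * real t)) +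
    exp (- (c * 2 ^ t / (C * real t))) + exp (- (c' * 2 ^ t / (C * real t)))) \<longlonglongrightarrow> 0"
proof -
  have 1: "(\<lambda>t::nat. (real t)\<^sup>2 / 2 ^ t) \<longlonglongrightarrow> 0" by real_asymp
  have 2: "(\<lambda>t::nat. 1 / 2 ^ t :: real) \<longlonglongrightarrow> 0" by real_asymp
  have 3: "(\<lambda>t::nat. real t * exp (- (\<kappa> * real t))) \<longlonglongrightarrow> 0" using assms by real_asymp
  have 4: "(\<lambda>t::nat. exp (- (b * 2 ^ t / (C * real t)))) \<longlonglongrightarrow> 0" if "0 < b" for b
    using assms(4) that by real_asymp
  have "(\<lambda>t::nat. a1 * ((real t)\<^sup>2 / 2 ^ t) + a2 * (1 / 2 ^ t) + a3 * (real t * exp (- (\<kappa> * real t))) +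
    exp (- (c * 2 ^ t / (C * real t))) + exp (- (c' * 2 ^ t / (C * real t)))) \<longlonglongrightarrow> a1 * 0 + a2 * 0 + a3 * 0 + 0 + 0"
    by (intro tendsto_add tendsto_mult tendsto_const 1 2 3 4 assms)
  then show ?thesis by (simp add: mult.assoc)
qed

text \<open>All constants and the degree threshold \<open>d0\<close> are fixed before the base
  graphs. Uniformity comes from t \<le> d \<le> C t and n \<ge> 2^t, which replace the errors of
  \<open>main_bound\<close> by a function of t alone.\<close>

lemma expanding_giant_whp:
  fixes C :: nat and \<epsilon> :: real
  assumes C1: "1 < C" and \<epsilon>0: "0 < \<epsilon>" and \<epsilon>: "\<epsilon> \<le> 1 / 1000"
  shows "\<exists>c>0. \<forall>(B :: nat \<Rightarrow> nat \<Rightarrow> 'a ugraph) k.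
    (\<forall>t. \<forall>j\<in>{1..t}. simple_graph (B t j) \<and> connected_graph (B t j) \<and>
       regular_graph (k t j) (B t j) \<and> 1 < card (verts (B t j)) \<and> card (verts (B t j)) \<le> C) \<longrightarrow>
    (\<lambda>t. measure_pmf.prob
      (percolation (cartesian_product {1..t} (B t)) ((1 + \<epsilon>) / real (\<Sum>j\<in>{1..t}. k t j)))
      {Gp. expanding_giant \<epsilon> c (real (card (verts (cartesian_product {1..t} (B t))))) (real (\<Sum>j\<in>{1..t}. k t j)) Gp})
    \<longlonglongrightarrow> 1"
proof -
  define \<xi> where "\<xi> = \<epsilon> / 1000"
  define \<zeta> where "\<zeta> = \<epsilon> * \<xi> / (32 * (real C)\<^sup>2)"
  define c1 where "c1 = (4 / 100 * \<epsilon>)\<^sup>2 / (64 * real C)"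
  define q where "q = 1 - exp (- (\<xi> * \<zeta> / 4))"
  define cs where "cs = q\<^sup>2 * \<xi> * (4 / 100 * \<epsilon>)\<^sup>2 / (128 * real C)"
  define c where "c = cs / 32"
  define \<kappa> where "\<kappa> = \<epsilon> * \<xi> / (4 * (real C)\<^sup>2)"
  have C: "0 < real C" using C1 by simp
  have \<xi>0: "0 < \<xi>" "0 < \<zeta>" using \<epsilon>0 C by (simp_all add: \<xi>_def \<zeta>_def)
  have q0: "0 < q" using \<xi>0 by (simp add: q_def)
  have cs0: "0 < cs" using q0 \<xi>0 \<epsilon>0 C by (simp add: cs_def)
  have c0: "0 < c" using cs0 by (simp add: c_def)
  have c10: "0 < c1" using \<epsilon>0 C by (simp add: c1_def)
  have \<kappa>0: "0 < \<kappa>" using \<epsilon>0 \<xi>0 C by (simp add: \<kappa>_def)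
  obtain K :: nat where K: "8 / cs \<le> real K" using real_arch_simple by blast
  obtain Kb :: nat where Kb0: "- ln (1 / 100 * \<epsilon>) / (3 / 10 * \<epsilon>\<^sup>2) \<le> real Kb" using real_arch_simple by blast
  have Kb: "exp (- (3 / 10 * \<epsilon>\<^sup>2 * real Kb)) \<le> 1 / 100 * \<epsilon>"
  proof -
    have "- ln (1 / 100 * \<epsilon>) \<le> 3 / 10 * \<epsilon>\<^sup>2 * real Kb" using Kb0 \<epsilon>0 by (simp add: field_simps)
    then have "exp (- (3 / 10 * \<epsilon>\<^sup>2 * real Kb)) \<le> exp (ln (1 / 100 * \<epsilon>))" by simp
    then show ?thesis using \<epsilon>0 by simp
  qed
  define F where "F = 98 / 100 * \<epsilon> * (1 - exp (- (\<xi>\<^sup>2 / 4))) * (\<xi> / (2 * (real C)\<^sup>2))"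
  have F0: "0 < F" using \<epsilon>0 \<xi>0 C by (simp add: F_def)
  \<comment> \<open>Finitely many lower bounds on the degree, each eventually true; they hold for
    large t because d \<ge> t.\<close>
  define cond where "cond = (\<lambda>x::real. 2 * (real C)\<^sup>2 / \<xi> \<le> x \<and> 2 / \<xi> \<le> x \<and> 2 / \<zeta> \<le> x \<and> 40 / \<epsilon>\<^sup>2 \<le> x \<and>
    real Kb / (9 / 100 * \<epsilon>) \<le> x \<and> 100 * c / \<epsilon> \<le> x \<and> (2 * real K / \<xi> - ln (\<epsilon> / 100)) / F \<le> x \<and>
    16 \<le> ln x \<and> 1 / c \<le> ln x \<and> c * (1 + 1 / \<zeta>) / c1 \<le> ln x)"
  have ln_ev: "eventually (\<lambda>x::real. b \<le> ln x) at_top" for b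
    using ln_at_top by (simp add: filterlim_at_top)
  have "eventually cond at_top"
    unfolding cond_def by (intro eventually_conj eventually_ge_at_top ln_ev)
  then obtain d0 where d0: "\<And>x. d0 \<le> x \<Longrightarrow> cond x" unfolding eventually_at_top_linorder by blast
  show ?thesis
  proof (intro exI[of _ c] conjI allI impI)
    show "0 < c" by (rule c0)
    fix B :: "nat \<Rightarrow> nat \<Rightarrow> 'a ugraph" and k :: "nat \<Rightarrow> nat \<Rightarrow> nat"
    assume hyp: "\<forall>t. \<forall>j\<in>{1..t}. simple_graph (B t j) \<and> connected_graph (B t j) \<and>
            regular_graph (k t j) (B t j) \<and>
            1 < card (verts (B t j)) \<and> card (verts (B t j)) \<le> C"
    define f where "f = (\<lambda>t. measure_pmf.prob
      (percolation (cartesian_product {1..t} (B t)) ((1 + \<epsilon>) / real (\<Sum>j\<in>{1..t}. k t j)))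
      {Gp. expanding_giant \<epsilon> c (real (card (verts (cartesian_product {1..t} (B t))))) (real (\<Sum>j\<in>{1..t}. k t j)) Gp})"
    define err where "err = (\<lambda>t::nat. (3200 * (real K)\<^sup>2 * (real C)\<^sup>2 / \<epsilon>\<^sup>2) * (real t)\<^sup>2 / 2 ^ t +
      (5000 * (real Kb)\<^sup>2 / \<epsilon>\<^sup>2) / 2 ^ t + (real C / c1) * real t * exp (- (\<kappa> * real t)) +
      exp (- (c / 2 * 2 ^ t / (real C * real t))) + exp (- (cs / 2 * 2 ^ t / (real C * real t))))"
    have err0: "err \<longlonglongrightarrow> 0"
      unfolding err_def using \<kappa>0 c0 cs0 C by (intro error_tendsto) auto
    have pow: "eventually (\<lambda>t::nat. real Kb / (182 / 100 * \<epsilon>) \<le> 2 ^ t) sequentially"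
      by (rule eventually_compose_filterlim[OF eventually_ge_at_top]) real_asymp
    have "eventually (\<lambda>t. 1 - err t \<le> f t) sequentially"
      using pow eventually_ge_at_top[of "max 2 (nat \<lceil>d0\<rceil>)"]
    proof eventually_elim
      case (elim t)
      interpret product_graph "{1..t}" "B t" "k t" C
        by unfold_locales (use hyp in auto)
      have t: "2 \<le> t" "d0 \<le> real t" using elim by linarith+
      \<comment> \<open>The reason for t \<ge> 2: the locale \<open>supercritical\<close> assumes
        degree at least 2, which keeps p below 1.\<close>
      have "2 \<le> deg" using deg_ge t by simp
      then interpret supercritical "{1..t}" "B t" "k t" C \<epsilon>
        by unfold_locales (use \<epsilon> \<epsilon>0 in auto)
      have td: "real t \<le> d" "d \<le> real C * real t" using T_bounds by simp_all
      have "cond d" using d0[of d] td t by linarith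
      then have cd: "2 * (real C)\<^sup>2 / \<xi> \<le> d" "2 / \<xi> \<le> d" "2 / \<zeta> \<le> d" "40 / \<epsilon>\<^sup>2 \<le> d"
        "real Kb / (9 / 100 * \<epsilon>) \<le> d" "100 * c / \<epsilon> \<le> d" "(2 * real K / \<xi> - ln (\<epsilon> / 100)) / F \<le> d"
        "16 \<le> ln d" "1 / c \<le> ln d" "c * (1 + 1 / \<zeta>) / c1 \<le> ln d" by (simp_all add: cond_def)
      have n2: "2 ^ t \<le> n"
      proof -
        have "(2::nat) ^ t \<le> card V" using card_V by simp
        then have "real (2 ^ t) \<le> real (card V)" by (simp only: of_nat_le_iff)
        then show ?thesis unfolding n_def by simp
      qed
      have eqs: "\<eta> = \<xi>" "\<eta>' = \<zeta>" unfolding \<eta>_def \<eta>'_def \<xi>_def \<zeta>_def by simp_all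
      have KbD: "real Kb \<le> 9 / 100 * \<epsilon> * d" using cd(5) \<epsilon>0 by (simp add: field_simps)
      have big: "2 * real K / \<xi> - ln (\<epsilon> / 100) \<le> 98 / 100 * \<epsilon> * (1 - exp (- (\<xi>\<^sup>2 / 4))) * (\<xi> * d / (2 * (real C)\<^sup>2))"
      proof -
        have "2 * real K / \<xi> - ln (\<epsilon> / 100) \<le> d * F" using cd(7) F0 by (simp only: pos_divide_le_eq)
        then show ?thesis by (simp add: F_def mult_ac)
      qed
      have nK: "real Kb \<le> 182 / 100 * \<epsilon> * n"
      proof -
        have "real Kb / (182 / 100 * \<epsilon>) \<le> n" using elim(1) n2 by linarith
        then show ?thesis using \<epsilon>0 by (simp add: field_simps)
      qed
      have vG: "real (card (verts (cartesian_product {1..t} (B t)))) = n"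
        unfolding n_def V_def cartesian_product_def by simp
      have dG: "real (\<Sum>j\<in>{1..t}. k t j) = d" unfolding d_def deg_def by simp
      have "1 - (3200 * (real K * d)\<^sup>2 / (\<epsilon>\<^sup>2 * n) + 5000 * (real Kb)\<^sup>2 / (\<epsilon>\<^sup>2 * n)
        + d / c1 * exp (- (\<kappa> * d)) + exp (- (c / 2 * n / d)) + exp (- (cs / 2 * n / d))) \<le> f t"
        using main_bound[of c K Kb, unfolded eqs, folded c1_def q_def, folded cs_def \<kappa>_def,
          OF c_def K Kb cd(1-4) KbD cd(6) big cd(8-10) nK]
        unfolding f_def vG dG p_def .
      moreover have "3200 * (real K * d)\<^sup>2 / (\<epsilon>\<^sup>2 * n) + 5000 * (real Kb)\<^sup>2 / (\<epsilon>\<^sup>2 * n)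
        + d / c1 * exp (- (\<kappa> * d)) + exp (- (c / 2 * n / d)) + exp (- (cs / 2 * n / d)) \<le> err t"
      proof -
        have t0: "0 < real t" using t by simp
        have e2: "0 < \<epsilon>\<^sup>2" using \<epsilon>0 by simp
        have d0': "0 < d" using td t0 by linarith
        have "3200 * (real K * d)\<^sup>2 / (\<epsilon>\<^sup>2 * n) \<le> 3200 * (real K * (real C * real t))\<^sup>2 / (\<epsilon>\<^sup>2 * 2 ^ t)"
          using td n2 e2 d0' by (intro frac_le mult_left_mono power_mono) auto
        then have b1: "3200 * (real K * d)\<^sup>2 / (\<epsilon>\<^sup>2 * n) \<le> 3200 * (real K)\<^sup>2 * (real C)\<^sup>2 / \<epsilon>\<^sup>2 * (real t)\<^sup>2 / 2 ^ t"
          by (simp add: power_mult_distrib mult.assoc)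
        have "5000 * (real Kb)\<^sup>2 / (\<epsilon>\<^sup>2 * n) \<le> 5000 * (real Kb)\<^sup>2 / (\<epsilon>\<^sup>2 * 2 ^ t)"
          using n2 e2 by (intro frac_le mult_left_mono) auto
        then have b2: "5000 * (real Kb)\<^sup>2 / (\<epsilon>\<^sup>2 * n) \<le> 5000 * (real Kb)\<^sup>2 / \<epsilon>\<^sup>2 / 2 ^ t" by simp
        have "d / c1 * exp (- (\<kappa> * d)) \<le> (real C * real t) / c1 * exp (- (\<kappa> * real t))"
          using td c10 \<kappa>0 d0' by (intro mult_mono divide_right_mono) auto
        then have b3: "d / c1 * exp (- (\<kappa> * d)) \<le> real C / c1 * real t * exp (- (\<kappa> * real t))" by simp
        have b4: "exp (- (b * n / d)) \<le> exp (- (b * 2 ^ t / (real C * real t)))" if "0 < b" for b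
        proof -
          have "b * 2 ^ t / (real C * real t) \<le> b * n / d"
            using that n2 td d0' n_pos by (intro frac_le mult_left_mono) auto
          then show ?thesis by simp
        qed
        show ?thesis unfolding err_def
          by (intro add_mono b1 b2 b3 b4) (use c0 cs0 in simp_all)
      qed
      ultimately show "1 - err t \<le> f t" by linarith
    qed
    moreover have "eventually (\<lambda>t. f t \<le> 1) sequentially" by (simp add: f_def)
    moreover have "(\<lambda>t. 1 - err t) \<longlonglongrightarrow> 1" using tendsto_diff[OF tendsto_const[of 1] err0] by simp
    ultimately have "f \<longlonglongrightarrow> 1"
      by (intro tendsto_sandwich[of "\<lambda>t. 1 - err t" f sequentially "\<lambda>_. 1"]) auto
    then show "(\<lambda>t. measure_pmf.prob
      (percolation (cartesian_product {1..t} (B t)) ((1 + \<epsilon>) / real (\<Sum>j\<in>{1..t}. k t j)))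
      {Gp. expanding_giant \<epsilon> c (real (card (verts (cartesian_product {1..t} (B t))))) (real (\<Sum>j\<in>{1..t}. k t j)) Gp}) \<longlonglongrightarrow> 1"
      unfolding f_def .
  qed
qed

theorem theorem5:
  fixes C :: nat
  assumes "C > 1"
  shows "\<exists>\<epsilon>\<^sub>0>0. \<forall>\<epsilon>::real. 0 < \<epsilon> \<and> \<epsilon> \<le> \<epsilon>\<^sub>0 \<longrightarrow>
    (\<exists>c::real. c > 0 \<and>
      (\<forall>(B :: nat \<Rightarrow> nat \<Rightarrow> 'a ugraph) (k :: nat \<Rightarrow> nat \<Rightarrow> nat).
        (\<forall>t. \<forall>j\<in>{1..t}. simple_graph (B t j) \<and> connected_graph (B t j) \<and>
            regular_graph (k t j) (B t j) \<and>
            1 < card (verts (B t j)) \<and> card (verts (B t j)) \<le> C) \<longrightarrow>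
        (\<lambda>t. let G = cartesian_product {1..t} (B t);
                 n = real (card (verts G));
                 d = real (\<Sum>j\<in>{1..t}. k t j);
                 p = (1 + \<epsilon>) / d
             in measure_pmf.prob (percolation G p)
                  {Gp. \<forall>L\<^sub>1. largest_component Gp L\<^sub>1 \<longrightarrow>
                     (\<exists>H. is_subgraph H L\<^sub>1 \<and>
                          real (card (verts H)) \<ge> 3 * \<epsilon> * n / 2 \<and>
                          (\<forall>S. S \<subseteq> verts H \<and> real (card S) \<le> real (card (verts H)) / 2 \<longrightarrow>
                             real (card (nbhd H S)) \<ge> c * real (card S) / (d * ln d)))})
          \<longlonglongrightarrow> 1))"
  unfolding Let_def expanding_giant_def[symmetric]
  by (rule exI[of _ "1 / 1000"], rule conjI, simp, intro allI impI, elim conjE)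
    (rule expanding_giant_whp[OF assms])

end
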